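(* Let $f:\mathcal{X}\to\mathbb{R}$ be continuously differentiable on $\mathcal{X}:=\mathbb{R}^{m_1\times n_1}\times\cdots\times\mathbb{R}^{m_J\times n_J}$ ($m_j\le n_j$), let $L_1,\dots,L_J>0$, and suppose: (a) there is a finite $f_{\mathrm{low}}$ with $f(\mathbf X)\ge f_{\mathrm{low}}$ for all $\mathbf X\in\mathcal{X}$; (b) $\alpha\in[2,\infty]$, $\beta\in[1,2]$ are a conjugate pair, and $p_j\in[2,\infty]$, $q_j\in[1,2]$ are a conjugate pair for every $j\in[J]$; (c) $\|\nabla f(\mathbf Y)-\nabla f(\mathbf X)\|_{\mathbf v,\mathbf q}\le\|\mathbf Y-\mathbf X\|_{\mathbf w,\mathbf p}$ for all $\mathbf X,\mathbf Y\in\mathcal{X}$, with the mixed norms defined in the context; (d) there are $V_j\in\mathbb{R}^{m_j\times m_j}$, $j\in[J]$, such that the stochastic gradient estimator $\mathbf G:\mathcal{X}\times\Xi\to\mathcal{X}$ satisfies, for all $\mathbf X\in\mathcal{X}$ and $j\in[J]$, $\mathbb{E}[\mathbf G(\mathbf X;\xi)]=\nabla f(\mathbf X)$ and $\mathbb{E}[([\mathbf G(\mathbf X;\xi)]_j-[\nabla f(\mathbf X)]_j)([\mathbf G(\mathbf X;\xi)]_j-[\nabla f(\mathbf X)]_j)^T]\preceq V_jV_j^T$. Let $B\ge1$ be an integer, assume $\Delta_f:=f(\mathbf X_0)-f_{\mathrm{low}}>0$, and let $$\sigma_{\mathbf v,\mathbf q,B}:=\frac{1}{\sqrt B}\left\|\left(L_1^{-1/2}\|V_1\|_{S_{q_1}},\ldots,L_J^{-1/2}\|V_J\|_{S_{q_J}}\right)\right\|_\beta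 .$$ Let $K\ge1$ be any integer, and let $\{\mathbf X_k\}$ be generated by the multi-block method with ball oracle (see context) with batch size $B$ and parameters $$\eta=\sqrt{\frac{\Delta_f\theta}{K}},\qquad\theta=\min\left\{\frac{1}{\sigma_{\mathbf v,\mathbf q,B}}\sqrt{\frac{\Delta_f}{K}},\,1\right\}$$ (with $\theta=1$ if $\sigma_{\mathbf v,\mathbf q,B}=0$). Then $$\frac1K\sum_{k=0}^{K-1}\mathbb{E}[\|\nabla f(\mathbf X_k)\|_{\mathbf v,\mathbf q}]\le6\sqrt{\sigma_{\mathbf v,\mathbf q,B}}\left(\frac{\Delta_f}{K}\right)^{1/4}+8\sqrt{\frac{\Delta_f}{K}}+\frac{2\sigma_{\mathbf v,\mathbf q,B}^2}{\sqrt{\Delta_fK}}.$$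
   Context: $[X]_j\in\mathbb{R}^{m_j\times n_j}$ is the $j$th block of $\mathbf X\in\mathcal{X}$, and $[J]=\{1,\dots,J\}$. $\|Z\|_{S_r}$ is the Schatten-$r$ norm (the $\ell_r$ norm of the singular values), $r\in[1,\infty]$. Exponents $a,b\in[1,\infty]$ are conjugate if $1/a+1/b=1$ with $1/\infty:=0$. The inner product on $\mathcal{X}$ is $\langle\mathbf X,\mathbf Y\rangle=\sum_{j=1}^J\langle[X]_j,[Y]_j\rangle$ with the trace inner product on each block. $A_1\preceq A_2$ means $A_2-A_1$ is positive semidefinite. The mixed norms are $$\|\mathbf X\|_{\mathbf w,\mathbf p}:=\big\|\big(L_j^{1/2}\|[X]_j\|_{S_{p_j}}\big)_{j=1}^J\big\|_\alpha,\qquad\|\mathbf X\|_{\mathbf v,\mathbf q}:=\big\|\big(L_j^{-1/2}\|[X]_j\|_{S_{q_j}}\big)_{j=1}^J\big\|_\beta,$$ where $\|\cdot\|_\alpha,\|\cdot\|_\beta$ are the $\ell_\alpha$, $\ell_\beta$ norms on $\mathbb{R}^J$. $\xi$ is a random element of the measurable space $\Xi$ and $\mathbf G$ is measurable. Multi-block method with ball oracle: inputs are a (deterministic) starting point $\mathbf X_0\in\mathcal{X}$, $\theta\in(0,1]$, $\alpha\in[2,\infty]$, $\mathbf p=(p_1,\dots,p_J)\in[2,\infty]^J$, $\eta>0$, and an integer batch size $B\ge1$. For $k=0,1,2,\dots$: draw $\xi_{k,1},\dots,\xi_{k,B}$, i.i.d. copies of $\xi$ independent of all previous samples, and set $\bar{\mathbf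 G}_k=\frac1B\sum_{i=1}^B\mathbf G(\mathbf X_k;\xi_{k,i})$; set $\mathbf M_0=\bar{\mathbf G}_0$ and $\mathbf M_k=(1-\theta)\mathbf M_{k-1}+\theta\bar{\mathbf G}_k$ for $k\ge1$; let $\mathbf X_{k+1}$ be a minimizer of $\langle\mathbf M_k,\mathbf X-\mathbf X_k\rangle$ over $\{\mathbf X:\|\mathbf X-\mathbf X_k\|_{\mathbf w,\mathbf p}\le\eta\}$ (when the minimizer is not unique, it is selected so that $\mathbf X_{k+1}$ is measurable with respect to $\sigma(\{\xi_{s,i}:0\le s\le k,\,1\le i\le B\})$). *)

theory Defs
  imports
    "HOL-Probability.Probability"
    "Jordan_Normal_Form.Char_Poly"
begin

text \<open>
  The space \<open>\<real>^(m\<^sub>1 \<times> n\<^sub>1) \<times> \<dots> \<times> \<real>^(m\<^sub>J \<times> n\<^sub>J)\<close> is represented by \<^typ>\<open>real ^ 'e\<close>, where the finite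
  type \<open>'e\<close> indexes all matrix entries: \<open>ent (j, r, c)\<close> is the index of entry \<open>(r, c)\<close> of block
  \<open>j\<close>, blocks being counted from 1 and rows and columns from 0. Since \<open>ent\<close> is a bijection, the
  map to blocks identifies \<^typ>\<open>real ^ 'e\<close> with the product of the matrix spaces, and \<^const>\<open>inner\<close>
  is the sum of the trace inner products of the blocks (lemma \<open>inner_blocks\<close>).
\<close>

definition block_entries :: "nat \<Rightarrow> (nat \<Rightarrow> nat) \<Rightarrow> (nat \<Rightarrow> nat) \<Rightarrow> (nat \<times> nat \<times> nat) set" where
  "block_entries J m n = (SIGMA j:{1..J}. {..<m j} \<times> {..<n j})"

definition blocks ::
  "(nat \<Rightarrow> nat) \<Rightarrow> (nat \<Rightarrow> nat) \<Rightarrow> (nat \<times> nat \<times> nat \<Rightarrow> 'e) \<Rightarrow> real ^ 'e \<Rightarrow> nat \<Rightarrow> real Matrix.mat" where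
  "blocks m n ent X j = Matrix.mat (m j) (n j) (\<lambda>(r, c). vec_nth X (ent (j, r, c)))"

lemma inner_blocks:
  fixes X Y :: "real ^ 'e"
  assumes "bij_betw ent (block_entries J m n) (UNIV :: 'e set)"
  shows "inner X Y = (\<Sum>j\<in>{1..J}. \<Sum>r<m j. \<Sum>c<n j.
           blocks m n ent X j $$ (r, c) * blocks m n ent Y j $$ (r, c))"
proof -
  have "inner X Y = (\<Sum>z\<in>block_entries J m n. vec_nth X (ent z) * vec_nth Y (ent z))"
    unfolding inner_vec_def inner_real_def
    by (rule sum.reindex_bij_betw[OF assms, symmetric])
  also have "\<dots> = (\<Sum>j\<in>{1..J}. \<Sum>(r, c)\<in>{..<m j} \<times> {..<n j}.
      vec_nth X (ent (j, r, c)) * vec_nth Y (ent (j, r, c)))"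
    unfolding block_entries_def by (subst sum.Sigma) (auto simp: case_prod_unfold)
  also have "\<dots> = (\<Sum>j\<in>{1..J}. \<Sum>r<m j. \<Sum>c<n j.
      vec_nth X (ent (j, r, c)) * vec_nth Y (ent (j, r, c)))"
    by (simp add: sum.cartesian_product)
  finally show ?thesis by (simp add: blocks_def)
qed

text \<open>The \<open>\<ell>\<^sub>r\<close> norm of a finite family of reals, given as a multiset, for \<open>1 \<le> r \<le> \<infinity>\<close>.\<close>

definition lp_norm :: "ereal \<Rightarrow> real multiset \<Rightarrow> real" where
  "lp_norm r S =
     (if r = \<infinity> then Max (insert 0 (abs ` set_mset S))
      else (\<Sum>x\<in>#S. \<bar>x\<bar> powr real_of_ereal r) powr (1 / real_of_ereal r))"

text \<open>
  Singular values are the square roots of the eigenvalues of \<open>A A\<^sup>T\<close>, with multiplicity; if \<open>A\<close> has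
  more rows than columns, this only adds zeros.
\<close>

definition singular_values :: "real Matrix.mat \<Rightarrow> real multiset" where
  "singular_values A = image_mset sqrt (proots (char_poly (A * transpose_mat A)))"

definition schatten_norm :: "ereal \<Rightarrow> real Matrix.mat \<Rightarrow> real" where
  "schatten_norm r A = lp_norm r (singular_values A)"

definition mixed_norm ::
  "nat \<Rightarrow> (nat \<Rightarrow> real) \<Rightarrow> (nat \<Rightarrow> ereal) \<Rightarrow> ereal \<Rightarrow> (nat \<Rightarrow> real Matrix.mat) \<Rightarrow> real" where
  "mixed_norm J w p \<alpha> Z = lp_norm \<alpha> {# w j * schatten_norm (p j) (Z j). j \<in># mset_set {1..J} #}"

definition conjugate_exponents :: "ereal \<Rightarrow> ereal \<Rightarrow> bool" where
  "conjugate_exponents a b \<longleftrightarrow> 1 \<le> a \<and> 1 \<le> b \<and> 1 / a + 1 / b = 1"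

definition psd_mat :: "real Matrix.mat \<Rightarrow> bool" where
  "psd_mat A \<longleftrightarrow> transpose_mat A = A \<and>
     (\<forall>x\<in>carrier_vec (dim_row A). 0 \<le> scalar_prod x (A *\<^sub>v x))"

definition loewner_le :: "real Matrix.mat \<Rightarrow> real Matrix.mat \<Rightarrow> bool" where
  "loewner_le A1 A2 \<longleftrightarrow> psd_mat (A2 - A1)"

definition integrable_mat ::
  "'s measure \<Rightarrow> nat \<Rightarrow> nat \<Rightarrow> ('s \<Rightarrow> real Matrix.mat) \<Rightarrow> bool" where
  "integrable_mat M nr nc Z \<longleftrightarrow> (\<forall>r<nr. \<forall>c<nc. integrable M (\<lambda>s. Z s $$ (r, c)))"

definition expectation_mat ::
  "'s measure \<Rightarrow> nat \<Rightarrow> nat \<Rightarrow> ('s \<Rightarrow> real Matrix.mat) \<Rightarrow> real Matrix.mat" where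
  "expectation_mat M nr nc Z = Matrix.mat nr nc (\<lambda>(r, c). integral\<^sup>L M (\<lambda>s. Z s $$ (r, c)))"

definition minibatch_gradient ::
  "nat \<Rightarrow> ('a::real_vector \<Rightarrow> 'x \<Rightarrow> 'a) \<Rightarrow> 'a \<Rightarrow> (nat \<Rightarrow> 'x) \<Rightarrow> 'a" where
  "minibatch_gradient B G x s = (1 / real B) *\<^sub>R (\<Sum>i = 1..B. G x (s i))"

primrec momentum :: "real \<Rightarrow> (nat \<Rightarrow> 'a::real_vector) \<Rightarrow> nat \<Rightarrow> 'a" where
  "momentum \<theta> g 0 = g 0"
| "momentum \<theta> g (Suc k) = (1 - \<theta>) *\<^sub>R momentum \<theta> g k + \<theta> *\<^sub>R g (Suc k)"

definition iid_samples ::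
  "'w measure \<Rightarrow> 'x measure \<Rightarrow> 'x measure \<Rightarrow> nat \<Rightarrow> (nat \<Rightarrow> nat \<Rightarrow> 'w \<Rightarrow> 'x) \<Rightarrow> bool" where
  "iid_samples M \<Xi> law B samp \<longleftrightarrow>
     prob_space.indep_vars M (\<lambda>_. \<Xi>) (\<lambda>(k, i). samp k i) (UNIV \<times> {1..B}) \<and>
     (\<forall>k. \<forall>i\<in>{1..B}. distr M \<Xi> (samp k i) = law)"

text \<open>The \<open>\<sigma>\<close>-algebra generated by the samples of the iterations \<open>0, \<dots>, k\<close>.\<close>

definition sample_history ::
  "'w measure \<Rightarrow> 'x measure \<Rightarrow> nat \<Rightarrow> (nat \<Rightarrow> nat \<Rightarrow> 'w \<Rightarrow> 'x) \<Rightarrow> nat \<Rightarrow> 'w measure" where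
  "sample_history M \<Xi> B samp k =
     sigma (space M) {samp s i -` A \<inter> space M | s i A. s \<le> k \<and> i \<in> {1..B} \<and> A \<in> sets \<Xi>}"

definition ball_oracle_method ::
  "'w measure \<Rightarrow> 'x measure \<Rightarrow> (nat \<Rightarrow> nat \<Rightarrow> 'w \<Rightarrow> 'x) \<Rightarrow> ('a::euclidean_space \<Rightarrow> 'x \<Rightarrow> 'a) \<Rightarrow>
   ('a \<Rightarrow> real) \<Rightarrow> 'a \<Rightarrow> real \<Rightarrow> real \<Rightarrow> nat \<Rightarrow> (nat \<Rightarrow> 'w \<Rightarrow> 'a) \<Rightarrow> bool" where
  "ball_oracle_method M \<Xi> samp G nrm X0 \<theta> \<eta> B X \<longleftrightarrow>
     (\<forall>\<omega>\<in>space M. X 0 \<omega> = X0) \<and>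
     (\<forall>k. \<forall>\<omega>\<in>space M.
        is_arg_min
          (\<lambda>Y. inner (momentum \<theta> (\<lambda>l. minibatch_gradient B G (X l \<omega>) (\<lambda>i. samp l i \<omega>)) k) (Y - X k \<omega>))
          (\<lambda>Y. nrm (Y - X k \<omega>) \<le> \<eta>)
          (X (Suc k) \<omega>)) \<and>
     (\<forall>k. X (Suc k) \<in> borel_measurable (sample_history M \<Xi> B samp k))"

end

theory Submission
  imports Defs
begin

text \<open>
  The norm \<open>\<parallel>\<cdot>\<parallel>\<^sub>v\<^sub>,\<^sub>q\<close> is dual to \<open>\<parallel>\<cdot>\<parallel>\<^sub>w\<^sub>,\<^sub>p\<close>, so a ball step along the momentum \<open>M\<^sub>k\<close> decreases the linear model by
  \<open>\<eta>\<parallel>M\<^sub>k\<parallel>\<^sub>v\<^sub>,\<^sub>q\<close>, and smoothness gives \<open>f(X\<^sub>k\<^sub>+\<^sub>1) \<le> f(X\<^sub>k) - \<eta>\<parallel>\<nabla>f(X\<^sub>k)\<parallel> + 2\<eta>\<parallel>M\<^sub>k - \<nabla>f(X\<^sub>k)\<parallel> + \<eta>\<^sup>2/2\<close>. The momentum error splits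
  into a drift, bounded pathwise by \<open>\<eta>(1 - \<theta>)/\<theta>\<close>, and a weighted sum of martingale differences whose
  covariance in block \<open>j\<close> is at most a multiple \<open>\<tau>\<^sup>2\<close> of \<open>V\<^sub>j V\<^sub>j\<^sup>T\<close>.

  The noise is bounded without a dimension factor as follows. If \<open>u\<^sub>i\<close> are left singular vectors of \<open>V\<^sub>j\<close>, then
  for \<open>q \<le> 2\<close> the Schatten norm of \<open>D\<close> is at most the \<open>\<ell>\<^sub>q\<close> norm of the numbers \<open>|D\<^sup>T u\<^sub>i|\<close> (by duality, since
  \<open>|Y\<^sup>T u\<^sub>i|\<^sup>2\<close> is a doubly stochastic average of the squared singular values of \<open>Y\<close> and \<open>p \<ge> 2\<close>), and
  \<open>E|D\<^sup>T u\<^sub>i|\<^sup>2 \<le> \<tau>\<^sup>2 s\<^sub>i(V\<^sub>j)\<^sup>2\<close>. Finally \<open>z \<mapsto> \<parallel>\<surd>z\<parallel>\<^sub>q\<^sup>2\<close> is concave for \<open>q \<le> 2\<close>, so expectations pass inside the norms.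
\<close>

section \<open>The \<open>\<ell>\<^sub>r\<close> norm of a finite family\<close>

text \<open>The Loewner hypothesis only controls \<open>E |D^T x|^2\<close> for each fixed x; no
  Schatten norm of the noise D can be averaged directly. So the random matrix is never diagonalised.
  It is measured in the left singular vectors of \<open>V j\<close>, a basis fixed before any sample
  is drawn: exact for \<open>V j\<close>, merely admissible for D, and for q_j \<le> 2 the
  inequality this costs points the right way. The probabilistic part thus treats only scalars
  \<open>inner noise e\<close>, summed over the columns of a block, and orthogonality of the
  differences is enough; conditioning is replaced by the product law of the past and a fresh sample.
  The iterates depend on the noise, so the momentum is split by linearity: averaged true gradients
  against the current one (drift), and averaged errors (noise). The first batch enters the momentum
  with full weight, so the noise starts at variance factor 1 and falls to order \<theta>; this
  transient sums to 1/\<theta> and becomes the last term of the rate.\<close>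

lemma powr_sum_le_sum_powr:
  fixes w x :: "'i \<Rightarrow> real"
  assumes "finite I" "\<And>i. i \<in> I \<Longrightarrow> 0 \<le> w i" "\<And>i. i \<in> I \<Longrightarrow> 0 \<le> x i"
    and "(\<Sum>i\<in>I. w i) = 1" "1 \<le> p"
  shows "(\<Sum>i\<in>I. w i * x i) powr p \<le> (\<Sum>i\<in>I. w i * x i powr p)"
proof (cases "(\<Sum>i\<in>I. w i * x i) = 0 \<or> p = 1")
  case True
  then show ?thesis
  proof
    assume "(\<Sum>i\<in>I. w i * x i) = 0"
    then show ?thesis using assms by (auto intro!: sum_nonneg)
  next
    assume "p = 1"
    then show ?thesis using assms by (simp add: sum_nonneg)
  qed
next
  case False
  define \<mu> where "\<mu> = (\<Sum>i\<in>I. w i * x i)"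
  have "0 \<le> \<mu>" unfolding \<mu>_def using assms by (auto intro!: sum_nonneg)
  with False have \<mu>: "0 < \<mu>" by (auto simp: \<mu>_def)
  have p: "1 < p" using False assms by auto
  define q where "q = p / (p - 1)"
  have q: "1 < q" "1 / p + 1 / q = 1" using p by (auto simp: q_def field_simps)
  \<comment> \<open>The tangent of \<open>t powr p\<close> at the mean \<mu>, from Young's
    inequality for \<open>t / \<mu>\<close> and 1. Averaging it over the weights gives Jensen's
    inequality, since the linear part has mean \<open>\<mu> powr p\<close>.\<close>
  have tangent: "\<mu> powr p * (p * (t / \<mu>) - (p - 1)) \<le> t powr p" if "0 \<le> t" for t
  proof -
    have "t / \<mu> * 1 \<le> (t / \<mu>) powr p / p + 1 powr q / q"
      using Youngs_inequality[OF p q, of "t / \<mu>" 1] \<mu> that by simp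
    then have "p * (t / \<mu>) - p * (1 / q) \<le> (t / \<mu>) powr p"
      using p by (simp add: field_simps)
    moreover have "p * (1 / q) = p - 1" using p by (simp add: q_def)
    ultimately have "\<mu> powr p * (p * (t / \<mu>) - (p - 1)) \<le> \<mu> powr p * (t / \<mu>) powr p"
      by (intro mult_left_mono) auto
    also have "\<dots> = t powr p" using \<mu> that by (simp flip: powr_mult)
    finally show ?thesis .
  qed
  have "(\<Sum>i\<in>I. w i * (\<mu> powr p * (p * (x i / \<mu>) - (p - 1)))) =
    \<mu> powr p * (p / \<mu> * (\<Sum>i\<in>I. w i * x i) - (p - 1) * (\<Sum>i\<in>I. w i))"
    unfolding sum_distrib_left sum_subtractf[symmetric]
    by (intro sum.cong refl) (simp add: algebra_simps)
  also have "\<dots> = \<mu> powr p" using \<mu> by (simp add: assms(4) \<mu>_def[symmetric])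
  finally have "\<mu> powr p = (\<Sum>i\<in>I. w i * (\<mu> powr p * (p * (x i / \<mu>) - (p - 1))))" ..
  also have "\<dots> \<le> (\<Sum>i\<in>I. w i * x i powr p)"
    using assms by (intro sum_mono mult_left_mono tangent)
  finally show ?thesis unfolding \<mu>_def .
qed

text \<open>The bound r \<le> 2 keeps r real, so infinity can occur only as s, and then r = 1. After
  this split the work is in real exponents, where \<open>powr\<close> and Young's inequality
  apply.\<close>

lemma conjugate_exponents_cases:
  assumes "s \<in> {2..\<infinity>}" "r \<in> {1..2}" "conjugate_exponents s r"
  obtains "s = \<infinity>" "r = 1"
  | s' r' :: real where "s = ereal s'" "r = ereal r'" "2 \<le> s'" "1 < r'" "r' \<le> 2" "1 / s' + 1 / r' = 1"
proof -
  obtain r' where r': "r = ereal r'" "1 \<le> r'" "r' \<le> 2"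
    using assms(2) by (cases r) (auto simp: one_ereal_def)
  show ?thesis
  proof (cases s)
    case (real s')
    have s': "2 \<le> s'" using assms(1) real by auto
    have "1 / ereal s' + 1 / ereal r' = 1"
      using assms(3) by (simp add: conjugate_exponents_def real r')
    then have e: "1 / s' + 1 / r' = 1"
      using s' r' by (simp add: divide_ereal_def one_ereal_def inverse_eq_divide)
    moreover have "r' \<noteq> 1" using e s' by auto
    ultimately show ?thesis using that(2) s' r' real by auto
  next
    case PInf
    have "1 / ereal r' = 1"
      using assms(3) by (simp add: conjugate_exponents_def PInf r')
    then have "r' = 1" using r' by (simp add: divide_ereal_def one_ereal_def inverse_eq_divide)
    then show ?thesis using that(1) PInf r' by (simp add: one_ereal_def)
  next
    case MInf
    then show ?thesis using assms(1) by auto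
  qed
qed

lemma lp_norm_real:
  "lp_norm (ereal \<rho>) {# x i. i \<in># mset_set I #} = (\<Sum>i\<in>I. \<bar>x i\<bar> powr \<rho>) powr (1 / \<rho>)"
  by (simp add: lp_norm_def image_mset.compositionality o_def sum_unfold_sum_mset)

lemma lp_norm_top:
  assumes "finite I"
  shows "lp_norm \<infinity> {# x i. i \<in># mset_set I #} = Max (insert 0 ((\<lambda>i. \<bar>x i\<bar>) ` I))"
  using assms by (simp add: lp_norm_def image_image)

lemma lp_norm_nonneg: "0 \<le> lp_norm r S"
  by (simp add: lp_norm_def)

lemma le_lp_norm_top:
  assumes "finite I" "i \<in> I"
  shows "\<bar>x i\<bar> \<le> lp_norm \<infinity> {# x i. i \<in># mset_set I #}"
  using assms by (simp add: lp_norm_top)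

lemma lp_norm_top_le:
  assumes "finite I" "0 \<le> b" "\<And>i. i \<in> I \<Longrightarrow> \<bar>x i\<bar> \<le> b"
  shows "lp_norm \<infinity> {# x i. i \<in># mset_set I #} \<le> b"
  using assms by (auto simp: lp_norm_top)

lemma lp_norm_cong:
  assumes "\<And>i. i \<in> I \<Longrightarrow> x i = y i"
  shows "lp_norm r {# x i. i \<in># mset_set I #} = lp_norm r {# y i. i \<in># mset_set I #}"
  using assms by (metis (no_types, lifting) finite_set_mset_mset_set image_mset_cong
      infinite_set_mset_mset_set empty_iff)

lemma lp_norm_mono:
  assumes "finite I" "1 \<le> r" "\<And>i. i \<in> I \<Longrightarrow> \<bar>x i\<bar> \<le> \<bar>y i\<bar>"
  shows "lp_norm r {# x i. i \<in># mset_set I #} \<le> lp_norm r {# y i. i \<in># mset_set I #}"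
proof (cases r)
  case (real \<rho>)
  then have "1 \<le> \<rho>" using assms(2) by (simp add: one_ereal_def)
  then show ?thesis unfolding real lp_norm_real
    by (intro powr_mono2 sum_mono assms sum_nonneg) auto
next
  case PInf
  show ?thesis unfolding PInf
    using assms by (intro lp_norm_top_le) (auto intro: order_trans le_lp_norm_top simp: lp_norm_nonneg)
qed (use assms(2) in auto)

lemma lp_norm_scale:
  assumes "finite I" "1 \<le> r"
  shows "lp_norm r {# c * x i. i \<in># mset_set I #} = \<bar>c\<bar> * lp_norm r {# x i. i \<in># mset_set I #}"
proof (cases r)
  case (real \<rho>)
  then have \<rho>: "1 \<le> \<rho>" using assms(2) by (simp add: one_ereal_def)
  have "(\<Sum>i\<in>I. \<bar>c * x i\<bar> powr \<rho>) = \<bar>c\<bar> powr \<rho> * (\<Sum>i\<in>I. \<bar>x i\<bar> powr \<rho>)"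
    by (simp add: abs_mult powr_mult sum_distrib_left)
  then show ?thesis unfolding real lp_norm_real using \<rho>
    by (simp add: powr_mult powr_powr sum_nonneg)
next
  case PInf
  have le: "lp_norm \<infinity> {# c * x i. i \<in># mset_set I #} \<le> \<bar>c\<bar> * lp_norm \<infinity> {# x i. i \<in># mset_set I #}"
    for c x
    using assms by (intro lp_norm_top_le)
      (auto simp: abs_mult lp_norm_nonneg intro!: mult_left_mono le_lp_norm_top)
  show ?thesis
  proof (cases "c = 0")
    case True
    then show ?thesis using le[of c x] lp_norm_nonneg[of r] unfolding PInf by (simp add: antisym)
  next
    case False
    have "\<bar>c\<bar> * lp_norm \<infinity> {# x i. i \<in># mset_set I #} \<le> lp_norm \<infinity> {# c * x i. i \<in># mset_set I #}"
      using le[of "1 / c" "\<lambda>i. c * x i"] False by (simp add: field_simps)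
    then show ?thesis using le[of c x] unfolding PInf by simp
  qed
qed (use assms(2) in auto)

lemma lp_norm_one: "lp_norm 1 {# x i. i \<in># mset_set I #} = (\<Sum>i\<in>I. \<bar>x i\<bar>)"
  unfolding one_ereal_def lp_norm_real by (simp add: sum_nonneg)

text \<open>Young's inequality for entries divided by the norms \<open>na\<close> and
  \<open>nb\<close>; the power sums are then 1, and 1/r' + 1/s' = 1 closes the bound. A vanishing
  norm cannot be divided by, but makes the left side zero.\<close>

lemma lp_norm_Hoelder:
  fixes x y :: "'i \<Rightarrow> real"
  assumes "finite I" "s \<in> {2..\<infinity>}" "r \<in> {1..2}" "conjugate_exponents s r"
  shows "(\<Sum>i\<in>I. x i * y i) \<le>
    lp_norm r {# x i. i \<in># mset_set I #} * lp_norm s {# y i. i \<in># mset_set I #}"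
  using assms(2-4)
proof (cases rule: conjugate_exponents_cases)
  case 1
  have "(\<Sum>i\<in>I. x i * y i) \<le> (\<Sum>i\<in>I. \<bar>x i\<bar> * lp_norm \<infinity> {# y i. i \<in># mset_set I #})"
  proof (rule sum_mono)
    fix i assume "i \<in> I"
    have "x i * y i \<le> \<bar>x i\<bar> * \<bar>y i\<bar>" by (metis abs_ge_self abs_mult)
    also have "\<dots> \<le> \<bar>x i\<bar> * lp_norm \<infinity> {# y i. i \<in># mset_set I #}"
      using \<open>i \<in> I\<close> assms(1) by (intro mult_left_mono le_lp_norm_top) auto
    finally show "x i * y i \<le> \<dots>" .
  qed
  then show ?thesis unfolding 1 lp_norm_one by (simp add: sum_distrib_right)
next
  case (2 s' r')
  define a where "a = (\<Sum>i\<in>I. \<bar>x i\<bar> powr r')"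
  define b where "b = (\<Sum>i\<in>I. \<bar>y i\<bar> powr s')"
  have ab: "0 \<le> a" "0 \<le> b" unfolding a_def b_def by (auto intro!: sum_nonneg)
  show ?thesis
  proof (cases "a = 0 \<or> b = 0")
    case True
    then have "x i = 0 \<or> y i = 0" if "i \<in> I" for i
      using that assms(1) by (auto simp: a_def b_def sum_nonneg_eq_0_iff)
    then have "(\<Sum>i\<in>I. x i * y i) = 0" by (intro sum.neutral) auto
    then show ?thesis by (simp add: lp_norm_nonneg)
  next
    case False
    then have pos: "0 < a" "0 < b" using ab by auto
    define na where "na = a powr (1 / r')"
    define nb where "nb = b powr (1 / s')"
    have n: "0 < na" "0 < nb" using pos by (auto simp: na_def nb_def)
    have na: "na powr r' = a" and nb: "nb powr s' = b"
      using pos 2 by (auto simp: na_def nb_def powr_powr)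
    have "(\<Sum>i\<in>I. x i * y i) \<le> (\<Sum>i\<in>I. na * nb * (\<bar>x i\<bar> powr r' / a / r' + \<bar>y i\<bar> powr s' / b / s'))"
    proof (rule sum_mono)
      fix i assume "i \<in> I"
      have "(\<bar>x i\<bar> / na) * (\<bar>y i\<bar> / nb) \<le> (\<bar>x i\<bar> / na) powr r' / r' + (\<bar>y i\<bar> / nb) powr s' / s'"
        using 2 n by (intro Youngs_inequality) auto
      also have "\<dots> = \<bar>x i\<bar> powr r' / a / r' + \<bar>y i\<bar> powr s' / b / s'"
        using n by (simp add: powr_divide na nb)
      finally have "na * nb * ((\<bar>x i\<bar> / na) * (\<bar>y i\<bar> / nb)) \<le> na * nb * (\<bar>x i\<bar> powr r' / a / r' + \<bar>y i\<bar> powr s' / b / s')"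
        using n by (intro mult_left_mono) auto
      moreover have "na * nb * ((\<bar>x i\<bar> / na) * (\<bar>y i\<bar> / nb)) = \<bar>x i * y i\<bar>"
        using n by (simp add: abs_mult)
      ultimately show "x i * y i \<le> na * nb * (\<bar>x i\<bar> powr r' / a / r' + \<bar>y i\<bar> powr s' / b / s')"
        by linarith
    qed
    also have "\<dots> = na * nb * (a / a / r' + b / b / s')"
      unfolding sum_distrib_left[symmetric] sum.distrib sum_divide_distrib[symmetric] a_def b_def ..
    also have "\<dots> = na * nb" using pos 2 by (simp add: add.commute)
    finally show ?thesis unfolding 2 lp_norm_real na_def nb_def a_def b_def .
  qed
qed

text \<open>The extremal vector in Hoelder's inequality. That c vanishes wherever x does is recorded
  because quotients c_i / x_i are formed later: where x_i = 0 the quotient is 0, which must agree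
  with c_i.\<close>

lemma lp_norm_dual_attained:
  fixes x :: "'i \<Rightarrow> real"
  assumes "finite I" "s \<in> {2..\<infinity>}" "r \<in> {1..2}" "conjugate_exponents s r"
    and "\<And>i. i \<in> I \<Longrightarrow> 0 \<le> x i"
  obtains c where "\<And>i. i \<in> I \<Longrightarrow> 0 \<le> c i" "\<And>i. i \<in> I \<Longrightarrow> x i = 0 \<Longrightarrow> c i = 0"
    "lp_norm s {# c i. i \<in># mset_set I #} \<le> 1"
    "(\<Sum>i\<in>I. c i * x i) = lp_norm r {# x i. i \<in># mset_set I #}"
  using assms(2-4)
proof (cases rule: conjugate_exponents_cases)
  case 1
  show ?thesis
  proof (rule that[of "\<lambda>i. if x i = 0 then 0 else 1"])
    show "lp_norm s {# if x i = 0 then 0 else 1. i \<in># mset_set I #} \<le> 1"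
      unfolding 1 using assms(1) by (intro lp_norm_top_le) auto
    show "(\<Sum>i\<in>I. (if x i = 0 then 0 else 1) * x i) = lp_norm r {# x i. i \<in># mset_set I #}"
      unfolding 1 lp_norm_one using assms(5) by (intro sum.cong) auto
  qed auto
next
  case (2 s' r')
  define a where "a = (\<Sum>i\<in>I. \<bar>x i\<bar> powr r')"
  have a: "0 \<le> a" unfolding a_def by (auto intro!: sum_nonneg)
  have sr: "s' * (r' - 1) = r'" "1 - 1 / s' = 1 / r'" using 2 by (auto simp: field_simps)
  show ?thesis
  proof (cases "a = 0")
    case True
    have "lp_norm s {# (0::real). i \<in># mset_set I #} \<le> 1"
      using 2 by (simp only: 2(1) lp_norm_real) simp
    moreover have "lp_norm r {# x i. i \<in># mset_set I #} = 0"
      using True by (simp add: 2 lp_norm_real a_def)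
    ultimately show ?thesis by (intro that[of "\<lambda>i. 0"]) auto
  next
    case False
    then have pos: "0 < a" using a by auto
    \<comment> \<open>The power r' - 1 is the equality case of Young's inequality. The denominator
      is the norm of x to the power r' - 1, as r'/s' = r' - 1.\<close>
    define c where "c i = x i powr (r' - 1) / a powr (1 / s')" for i
    have "\<bar>c i\<bar> powr s' = \<bar>x i\<bar> powr r' / a" if "i \<in> I" for i
      using that assms(5)[OF that] pos 2 sr by (simp add: c_def powr_divide powr_powr mult.commute)
    then have "(\<Sum>i\<in>I. \<bar>c i\<bar> powr s') = 1"
      using pos by (simp add: sum_divide_distrib[symmetric] a_def[symmetric])
    then have 1: "lp_norm s {# c i. i \<in># mset_set I #} \<le> 1" by (simp add: 2 lp_norm_real)
    have "c i * x i = \<bar>x i\<bar> powr r' / a powr (1 / s')" if "i \<in> I" for i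
    proof -
      have "x i powr (r' - 1) * x i = x i powr r'"
        using assms(5)[OF that] by (cases "x i = 0") (auto simp: powr_diff)
      then show ?thesis using assms(5)[OF that] by (simp add: c_def)
    qed
    then have "(\<Sum>i\<in>I. c i * x i) = a / a powr (1 / s')"
      by (simp add: sum_divide_distrib[symmetric] a_def[symmetric])
    also have "\<dots> = a powr (1 - 1 / s')" using pos by (simp add: powr_diff)
    finally have "(\<Sum>i\<in>I. c i * x i) = lp_norm r {# x i. i \<in># mset_set I #}"
      by (simp only: 2 lp_norm_real sr a_def)
    with 1 show ?thesis by (intro that[of c]) (auto simp: c_def)
  qed
qed

text \<open>Since p/2 \<ge> 1, Jensen's inequality applies to the squares with the row weights; the
  column sums then give each t_k total weight 1. For p = \<infinity>, an average does not exceed the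
  maximum.\<close>

lemma lp_norm_doubly_stochastic:
  fixes t y :: "'i \<Rightarrow> real"
  assumes "finite I" "p \<in> {2..\<infinity>}"
    and w: "\<And>i k. i \<in> I \<Longrightarrow> k \<in> I \<Longrightarrow> 0 \<le> w i k" "\<And>i. i \<in> I \<Longrightarrow> (\<Sum>k\<in>I. w i k) = 1"
      "\<And>k. k \<in> I \<Longrightarrow> (\<Sum>i\<in>I. w i k) = 1"
    and y: "\<And>i. i \<in> I \<Longrightarrow> (y i)\<^sup>2 = (\<Sum>k\<in>I. w i k * (t k)\<^sup>2)"
  shows "lp_norm p {# y i. i \<in># mset_set I #} \<le> lp_norm p {# t i. i \<in># mset_set I #}"
proof (cases p)
  case (real \<rho>)
  then have \<rho>: "2 \<le> \<rho>" using assms(2) by simp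
  have sq: "\<bar>z\<bar> powr \<rho> = (z\<^sup>2) powr (\<rho> / 2)" for z :: real
  proof (cases "z = 0")
    case False
    have "(z\<^sup>2) powr (\<rho> / 2) = (\<bar>z\<bar> powr 2) powr (\<rho> / 2)"
      using False by (simp add: powr_numeral)
    then show ?thesis unfolding powr_powr by simp
  qed simp
  have "(\<Sum>i\<in>I. \<bar>y i\<bar> powr \<rho>) \<le> (\<Sum>i\<in>I. \<Sum>k\<in>I. w i k * \<bar>t k\<bar> powr \<rho>)"
    unfolding sq using w \<rho> by (intro sum_mono) (auto simp: y intro!: powr_sum_le_sum_powr assms(1))
  also have "\<dots> = (\<Sum>k\<in>I. (\<Sum>i\<in>I. w i k) * \<bar>t k\<bar> powr \<rho>)"
    by (subst sum.swap) (simp add: sum_distrib_right)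
  also have "\<dots> = (\<Sum>k\<in>I. \<bar>t k\<bar> powr \<rho>)" using w by simp
  finally show ?thesis unfolding real lp_norm_real using \<rho>
    by (intro powr_mono2) (auto intro!: sum_nonneg)
next
  case PInf
  have sq_le: "z\<^sup>2 \<le> b\<^sup>2" if "\<bar>z\<bar> \<le> b" for z b :: real
    using power_mono[OF that, of 2] by simp
  let ?T = "lp_norm \<infinity> {# t i. i \<in># mset_set I #}"
  have "\<bar>y i\<bar> \<le> ?T" if "i \<in> I" for i
  proof -
    have "(y i)\<^sup>2 \<le> (\<Sum>k\<in>I. w i k * ?T\<^sup>2)"
      unfolding y[OF that] using w that assms(1)
      by (intro sum_mono mult_left_mono sq_le le_lp_norm_top) auto
    also have "\<dots> = ?T\<^sup>2" using w that by (simp flip: sum_distrib_right)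
    finally show ?thesis by (auto intro: power2_le_imp_le[OF _ lp_norm_nonneg])
  qed
  then show ?thesis unfolding PInf using assms(1) by (intro lp_norm_top_le lp_norm_nonneg)
qed (use assms(2) in auto)

section \<open>Spectral theorem and singular values\<close>

definition dot :: "nat \<Rightarrow> (nat \<Rightarrow> real) \<Rightarrow> (nat \<Rightarrow> real) \<Rightarrow> real" where
  "dot m x y = (\<Sum>r<m. x r * y r)"

definition orthonormal_family :: "nat \<Rightarrow> nat \<Rightarrow> (nat \<Rightarrow> nat \<Rightarrow> real) \<Rightarrow> bool" where
  "orthonormal_family m k u \<longleftrightarrow> (\<forall>i<k. \<forall>j<k. dot m (u i) (u j) = (if i = j then 1 else 0))"

lemma dot_commute: "dot m x y = dot m y x"
  by (simp add: dot_def mult.commute)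

lemma dot_add: "dot m x (\<lambda>r. y r + z r) = dot m x y + dot m x z"
  by (simp add: dot_def algebra_simps sum.distrib)

lemma dot_diff: "dot m x (\<lambda>r. y r - z r) = dot m x y - dot m x z"
  by (simp add: dot_def algebra_simps sum_subtractf)

lemma dot_scale: "dot m x (\<lambda>r. c * y r) = c * dot m x y"
  by (simp add: dot_def sum_distrib_left mult_ac)

lemma dot_sum: "dot m x (\<lambda>r. \<Sum>i\<in>I. y i r) = (\<Sum>i\<in>I. dot m x (y i))"
  unfolding dot_def by (simp add: sum_distrib_left sum.swap[of _ I])

lemma dot_add': "dot m (\<lambda>r. y r + z r) x = dot m y x + dot m z x"
  using dot_add dot_commute by metis

lemma dot_scale': "dot m (\<lambda>r. c * y r) x = c * dot m y x"
  using dot_scale dot_commute by metis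

lemma dot_cong: "(\<And>r. r < m \<Longrightarrow> x r = x' r) \<Longrightarrow> (\<And>r. r < m \<Longrightarrow> y r = y' r) \<Longrightarrow> dot m x y = dot m x' y'"
  by (simp add: dot_def)

lemma dot_nonneg: "0 \<le> dot m x x"
  by (simp add: dot_def sum_nonneg)

lemma dot_eq_0D: "dot m x x = 0 \<Longrightarrow> r < m \<Longrightarrow> x r = 0"
  by (simp add: dot_def sum_nonneg_eq_0_iff)

lemma dot_unit: "r < m \<Longrightarrow> dot m (\<lambda>s. if s = r then 1 else 0) x = x r"
  by (simp add: dot_def if_distrib[of "\<lambda>z. z * _"] cong: if_cong)

context
  fixes m k :: nat and u :: "nat \<Rightarrow> nat \<Rightarrow> real"
  assumes ortho: "orthonormal_family m k u"
begin

text \<open>The part of the r-th unit vector orthogonal to all \<open>u i\<close>. The squared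
  lengths of these m vectors add up to m - k, which is the whole dimension count: for k < m one of
  them is nonzero and can be normalised, for k = m all of them vanish.\<close>

private definition residual :: "nat \<Rightarrow> nat \<Rightarrow> real" where
  "residual r s = (if s = r then 1 else 0) - (\<Sum>i<k. u i r * u i s)"

private lemma dot_residual:
  assumes "r < m"
  shows "l < k \<Longrightarrow> dot m (u l) (residual r) = 0"
    and "dot m (residual r) (residual r) = 1 - (\<Sum>i<k. (u i r)\<^sup>2)"
proof -
  show 0: "dot m (u l) (residual r) = 0" if "l < k" for l
  proof -
    have "(\<Sum>i<k. u i r * dot m (u l) (u i)) = (\<Sum>i<k. if l = i then u i r else 0)"
      using ortho that by (intro sum.cong) (auto simp: orthonormal_family_def)
    also have "\<dots> = u l r" using that by simp
    finally have "dot m (u l) (\<lambda>s. \<Sum>i<k. u i r * u i s) = u l r" by (simp add: dot_sum dot_scale)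
    then show ?thesis unfolding residual_def dot_diff
      using dot_unit[OF assms, of "u l"] by (simp add: dot_commute)
  qed
  have "dot m (residual r) (residual r) =
      dot m (residual r) (\<lambda>s. if s = r then 1 else 0) - dot m (residual r) (\<lambda>s. \<Sum>i<k. u i r * u i s)"
    by (subst (2) residual_def[abs_def]) (simp add: dot_diff)
  also have "dot m (residual r) (\<lambda>s. \<Sum>i<k. u i r * u i s) = 0"
    using 0 by (simp add: dot_sum dot_scale dot_commute[of m "residual r"])
  also have "dot m (residual r) (\<lambda>s. if s = r then 1 else 0) = residual r r"
    using dot_unit[OF assms] by (simp add: dot_commute)
  finally have "dot m (residual r) (residual r) = residual r r" by simp
  also have "residual r r = 1 - (\<Sum>i<k. (u i r)\<^sup>2)"
    by (simp add: residual_def power2_eq_square)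
  finally show "dot m (residual r) (residual r) = 1 - (\<Sum>i<k. (u i r)\<^sup>2)" .
qed

private lemma sum_dot_residual: "(\<Sum>r<m. dot m (residual r) (residual r)) = real m - real k"
proof -
  have "(\<Sum>r<m. \<Sum>i<k. (u i r)\<^sup>2) = (\<Sum>i<k. dot m (u i) (u i))"
    by (subst sum.swap) (simp add: dot_def power2_eq_square)
  also have "\<dots> = real k" using ortho by (simp add: orthonormal_family_def)
  finally show ?thesis by (simp add: dot_residual sum_subtractf)
qed

lemma orthonormal_family_extend:
  assumes "k < m"
  obtains x where "dot m x x = 1" "\<And>i. i < k \<Longrightarrow> dot m (u i) x = 0" "\<And>r. m \<le> r \<Longrightarrow> x r = 0"
proof -
  have "\<exists>r<m. dot m (residual r) (residual r) \<noteq> 0"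
    using sum_dot_residual assms by (metis (no_types, lifting) diff_gt_0_iff_gt lessThan_iff of_nat_less_iff order_less_irrefl sum.neutral)
  then obtain r where r: "r < m" "dot m (residual r) (residual r) \<noteq> 0" by blast
  define z where "z = residual r"
  have z: "0 < dot m z z" using r dot_nonneg[of m z] by (simp add: z_def)
  define c where "c = 1 / sqrt (dot m z z)"
  define x where "x s = (if s < m then c * z s else 0)" for s
  have x: "dot m y x = c * dot m y z" for y
    unfolding dot_scale[symmetric] by (rule dot_cong) (auto simp: x_def)
  have "dot m x x = c * c * dot m z z"
    by (simp add: x dot_commute[of m x z])
  also have "\<dots> = 1" using z by (simp add: c_def)
  finally show ?thesis
    using dot_residual(1)[OF r(1)] by (intro that[of x]) (auto simp: x z_def[symmetric] x_def)
qed

text \<open>Orthonormal rows of a square array force orthonormal columns: the vanishing residuals,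
  read entrywise, say precisely this.\<close>

lemma orthonormal_basis_completeness:
  assumes "k = m" "r < m" "s < m"
  shows "(\<Sum>i<m. u i r * u i s) = (if s = r then 1 else 0)"
proof -
  have "(\<Sum>r<m. dot m (residual r) (residual r)) = 0"
    using sum_dot_residual assms(1) by simp
  then have "dot m (residual r) (residual r) = 0"
    using assms(2) by (simp add: sum_nonneg_eq_0_iff dot_nonneg)
  from dot_eq_0D[OF this assms(3)] have "(if s = r then 1 else 0) - (\<Sum>i<k. u i r * u i s) = 0"
    unfolding residual_def .
  then show ?thesis using assms(1) by simp
qed

end

lemma orthonormal_expansion:
  assumes "orthonormal_family m m u" "r < m"
  shows "x r = (\<Sum>i<m. dot m (u i) x * u i r)"
proof -
  have "(\<Sum>i<m. dot m (u i) x * u i r) = (\<Sum>s<m. (\<Sum>i<m. u i s * u i r) * x s)"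
    unfolding dot_def sum_distrib_right by (subst sum.swap) (simp add: mult_ac)
  also have "\<dots> = (\<Sum>s<m. (if s = r then x s else 0))"
    using assms by (intro sum.cong refl) (auto simp: orthonormal_basis_completeness)
  finally show ?thesis using assms(2) by simp
qed

lemma orthonormal_parseval:
  assumes "orthonormal_family m m u"
  shows "dot m x y = (\<Sum>i<m. dot m (u i) x * dot m (u i) y)"
proof -
  have "dot m x y = dot m y (\<lambda>r. \<Sum>i<m. dot m (u i) x * u i r)"
    unfolding dot_commute[of m x] using assms by (intro dot_cong refl orthonormal_expansion)
  then show ?thesis by (simp add: dot_sum dot_scale dot_commute[of m y])
qed

section \<open>Eigenvectors of a symmetric array by maximising the Rayleigh quotient\<close>

lemma compact_unit_cube:
  "compact (PiE UNIV (\<lambda>_. {-1..1}) :: (nat \<Rightarrow> real) set)"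
  using compactin_PiE[of "\<lambda>_. euclidean :: real topology" UNIV "\<lambda>_. {-1..1}"]
  by (simp add: euclidean_product_topology compactin_euclidean_iff)

lemma continuous_on_dot [continuous_intros]:
  assumes "\<And>r. continuous_on A (\<lambda>x. f x r)" "\<And>r. continuous_on A (\<lambda>x. g x r)"
  shows "continuous_on A (\<lambda>x. dot m (f x) (g x))"
  unfolding dot_def by (intro continuous_intros assms)

text \<open>Induction on the number of eigenvectors: the next one maximises the quadratic form on
  the unit sphere of the orthogonal complement of those found so far, a complement which symmetry
  keeps invariant.\<close>

lemma symmetric_eigenvectors:
  fixes S :: "nat \<Rightarrow> nat \<Rightarrow> real"
  assumes sym: "\<And>r s. r < m \<Longrightarrow> s < m \<Longrightarrow> S r s = S s r" and "k \<le> m"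
  shows "\<exists>u d. orthonormal_family m k u \<and> (\<forall>i<k. \<forall>r<m. dot m (S r) (u i) = d i * u i r)"
  using \<open>k \<le> m\<close>
proof (induction k)
  case 0
  then show ?case by (auto simp: orthonormal_family_def)
next
  case (Suc k)
  then obtain u d where u: "orthonormal_family m k u"
    and d: "\<And>i r. i < k \<Longrightarrow> r < m \<Longrightarrow> dot m (S r) (u i) = d i * u i r" by auto
  define T where "T x r = dot m (S r) x" for x r
  have T: "dot m x (T y) = dot m y (T x)" for x y
    unfolding T_def dot_def sum_distrib_left
    by (subst sum.swap) (auto simp: sym mult_ac intro!: sum.cong)
  have T_add: "dot m z (T (\<lambda>r. x r + t * y r)) = dot m z (T x) + t * dot m z (T y)" for z x y t
    unfolding T_def dot_add dot_scale ..
  \<comment> \<open>The dot products see only the first m coordinates. The cube bounds the remaining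
    ones too, so that C is a closed part of a compact product.\<close>
  define C where "C = {x \<in> PiE UNIV (\<lambda>_. {-1..1}). dot m x x = 1 \<and> (\<forall>i<k. dot m (u i) x = 0)}"
  have C_I: "x \<in> C" if "dot m x x = 1" "\<And>i. i < k \<Longrightarrow> dot m (u i) x = 0" "\<And>r. m \<le> r \<Longrightarrow> x r = 0" for x
  proof -
    have "\<bar>x r\<bar> \<le> 1" for r
    proof (cases "r < m")
      case True
      have "x r * x r \<le> dot m x x" unfolding dot_def
        using True by (intro member_le_sum) auto
      then show ?thesis using that(1) by (simp add: abs_square_le_1[symmetric] power2_eq_square)
    qed (use that in auto)
    then show ?thesis using that(1,2) by (auto simp: C_def abs_le_iff minus_le_iff)
  qed
  have cont: "continuous_on A (\<lambda>x. x r :: real)" for A and r :: nat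
    by (rule continuous_on_subset[OF continuous_on_product_coordinates]) simp
  have cl: "closed {x. dot m x x = 1 \<and> (\<forall>i\<in>{..<k}. dot m (u i) x = 0)}"
    unfolding Collect_conj_eq ball_conj_distrib Ball_def
    by (intro closed_Int closed_Collect_all closed_Collect_imp closed_Collect_eq continuous_intros cont) auto
  have "compact C"
    using compact_Int_closed[OF compact_unit_cube cl] by (simp add: C_def Int_def Ball_def)
  moreover have "C \<noteq> {}"
  proof -
    have "k < m" using Suc.prems by simp
    from orthonormal_family_extend[OF u this] C_I show ?thesis by (metis empty_iff)
  qed
  moreover have "continuous_on C (\<lambda>x. dot m x (T x))"
    unfolding T_def by (intro continuous_intros cont)
  ultimately obtain x where x: "x \<in> C" and max: "\<And>y. y \<in> C \<Longrightarrow> dot m y (T y) \<le> dot m x (T x)"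
    using continuous_attains_sup by metis
  define \<mu> where "\<mu> = dot m x (T x)"
  have x1: "dot m x x = 1" and ux: "\<And>i. i < k \<Longrightarrow> dot m (u i) x = 0" using x by (auto simp: C_def)
  \<comment> \<open>For vectors of any length: y is normalised and cut off beyond index m, which
    brings it into C, and the cut-off changes no dot product.\<close>
  have rayleigh: "dot m y (T y) \<le> \<mu> * dot m y y" if uy: "\<And>i. i < k \<Longrightarrow> dot m (u i) y = 0" for y
  proof (cases "dot m y y = 0")
    case True
    then have "dot m y (T y) = dot m (\<lambda>_. 0) (T y)"
      by (intro dot_cong refl) (auto dest: dot_eq_0D)
    then show ?thesis using True by (simp add: dot_def)
  next
    case False
    then have y: "0 < dot m y y" using dot_nonneg[of m y] by simp
    define c where "c = 1 / sqrt (dot m y y)"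
    have cc: "c * c * dot m y y = 1" using y by (simp add: c_def)
    define z where "z s = (if s < m then c * y s else 0)" for s
    have z: "dot m v z = c * dot m v y" for v
      unfolding dot_scale[symmetric] by (rule dot_cong) (auto simp: z_def)
    have Tz: "T z = (\<lambda>r. c * T y r)"
      by (simp add: T_def z fun_eq_iff)
    have "z \<in> C"
    proof (rule C_I)
      show "dot m z z = 1" unfolding z dot_commute[of m z y] using cc by simp
    qed (auto simp: z uy z_def)
    moreover have "dot m z (T z) = c * c * dot m y (T y)"
      unfolding Tz dot_scale dot_commute[of m z "T y"] z by (simp add: dot_commute)
    ultimately have "c * c * dot m y (T y) \<le> \<mu>"
      using max[of z] by (simp add: \<mu>_def)
    then have "dot m y y * (c * c * dot m y (T y)) \<le> dot m y y * \<mu>"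
      using y by (intro mult_left_mono) auto
    moreover have "dot m y y * (c * c * dot m y (T y)) = (c * c * dot m y y) * dot m y (T y)" by simp
    ultimately show ?thesis by (simp add: cc mult.commute)
  qed
  \<comment> \<open>The defect of the eigenvector equation at the maximiser. It is orthogonal to x
    and to every earlier \<open>u i\<close>, so x + t w stays admissible in \<open>rayleigh\<close>
    for every t.\<close>
  define w where "w r = T x r - \<mu> * x r" for r
  have xw: "dot m x w = 0"
    unfolding w_def dot_diff dot_scale by (simp add: x1 \<mu>_def)
  have uw: "dot m (u i) w = 0" if "i < k" for i
  proof -
    have "dot m x (T (u i)) = dot m x (\<lambda>r. d i * u i r)"
      using d that by (intro dot_cong) (auto simp: T_def)
    then have "dot m x (T (u i)) = 0" using ux[OF that] by (simp add: dot_scale dot_commute[of m x])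
    then have "dot m (u i) (T x) = 0" by (simp add: T)
    then show ?thesis unfolding w_def dot_diff dot_scale using ux[OF that] by simp
  qed
  have wT: "dot m w (T x) = dot m w w"
  proof -
    have "dot m w w = dot m w (T x) - \<mu> * dot m w x"
      by (subst (2) w_def[abs_def]) (simp add: dot_diff dot_scale)
    then show ?thesis using xw by (simp add: dot_commute)
  qed
  text \<open>First-order optimality of \<open>x\<close> in the direction \<open>w\<close> forces \<open>w = 0\<close>.\<close>
  define b where "b = \<mu> * dot m w w - dot m w (T w)"
  have quad: "2 * t * dot m w w \<le> t\<^sup>2 * b" for t
  proof -
    let ?y = "\<lambda>r. x r + t * w r"
    have "dot m ?y (T ?y) \<le> \<mu> * dot m ?y ?y"
      by (rule rayleigh) (simp add: dot_add dot_scale ux uw)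
    moreover have "dot m ?y (T ?y) = \<mu> + 2 * t * dot m w w + t\<^sup>2 * dot m w (T w)"
      by (simp add: T_add dot_add' dot_scale' \<mu>_def wT T[of x w] power2_eq_square algebra_simps)
    moreover have "dot m ?y ?y = 1 + t\<^sup>2 * dot m w w"
      by (simp add: dot_add dot_add' dot_scale dot_scale' x1 xw dot_commute[of m w x] power2_eq_square)
    ultimately show ?thesis by (simp add: b_def algebra_simps)
  qed
  have w0: "dot m w w = 0"
  proof (rule ccontr)
    assume "dot m w w \<noteq> 0"
    then have w: "0 < dot m w w" using dot_nonneg[of m w] by simp
    \<comment> \<open>Small enough that t |b| is at most the squared length of w, while
      \<open>quad\<close> demands twice that length; the + 1 avoids division by zero.\<close>
    define t where "t = dot m w w / (\<bar>b\<bar> + 1)"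
    have t: "0 < t" "t * \<bar>b\<bar> \<le> dot m w w" using w by (auto simp: t_def field_simps)
    have "t * (2 * dot m w w) \<le> t * (t * \<bar>b\<bar>)"
    proof -
      have "t\<^sup>2 * b \<le> t\<^sup>2 * \<bar>b\<bar>" by (intro mult_left_mono) auto
      then show ?thesis using quad[of t] by (simp add: power2_eq_square)
    qed
    then have "2 * dot m w w \<le> t * \<bar>b\<bar>" using t by simp
    then show False using t w by linarith
  qed
  define u' where "u' = u(k := x)"
  define d' where "d' = d(k := \<mu>)"
  have "orthonormal_family m (Suc k) u'"
    using u ux x1 by (auto simp: orthonormal_family_def u'_def less_Suc_eq dot_commute[of m x "u _"])
  moreover have "dot m (S r) (u' i) = d' i * u' i r" if "i < Suc k" "r < m" for i r
  proof (cases "i = k")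
    case True
    have "w r = 0" using dot_eq_0D[OF w0 that(2)] .
    then show ?thesis using True by (simp add: u'_def d'_def w_def T_def)
  qed (use that d in \<open>auto simp: u'_def d'_def\<close>)
  ultimately show ?case by blast
qed

text \<open>Ties the definition of singular values through characteristic polynomials to eigenbases:
  with the \<open>u i\<close> as columns of an orthogonal P, A = P D P^T is similar to a diagonal
  matrix, so the roots are the d_i with multiplicity.\<close>

lemma proots_char_poly_orthonormal:
  fixes A :: "real Matrix.mat"
  assumes A: "A \<in> carrier_mat m m" and u: "orthonormal_family m m u"
    and ev: "\<And>i r. i < m \<Longrightarrow> r < m \<Longrightarrow> (\<Sum>s<m. A $$ (r, s) * u i s) = d i * u i r"
  shows "proots (char_poly A) = {# d i. i \<in># mset_set {..<m} #}"
proof -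
  define P where "P = Matrix.mat m m (\<lambda>(r, i). u i r)"
  define D where "D = Matrix.mat m m (\<lambda>(i, j). if i = j then d i else 0)"
  have car: "P \<in> carrier_mat m m" "transpose_mat P \<in> carrier_mat m m" "D \<in> carrier_mat m m"
    by (auto simp: P_def D_def)
  have "transpose_mat P * P = 1\<^sub>m m"
    using u by (intro eq_matI)
      (auto simp: P_def scalar_prod_def orthonormal_family_def dot_def atLeast0LessThan)
  moreover have "P * transpose_mat P = 1\<^sub>m m"
    using orthonormal_basis_completeness[OF u refl] by (intro eq_matI)
      (auto simp: P_def scalar_prod_def atLeast0LessThan)
  moreover have "A = P * D * transpose_mat P"
  proof (rule eq_matI)
    fix r s assume "r < dim_row (P * D * transpose_mat P)" "s < dim_col (P * D * transpose_mat P)"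
    then have rs: "r < m" "s < m" by (auto simp: P_def)
    have PD: "(P * D) $$ (r, i) = d i * u i r" if "i < m" for i
    proof -
      have "(P * D) $$ (r, i) = (\<Sum>l<m. u l r * (if l = i then d l else 0))"
        using rs that by (simp add: P_def D_def scalar_prod_def atLeast0LessThan)
      also have "\<dots> = (\<Sum>l<m. if l = i then d l * u l r else 0)" by (intro sum.cong) auto
      finally show ?thesis using that by simp
    qed
    have "(P * D * transpose_mat P) $$ (r, s) = (\<Sum>i<m. (P * D) $$ (r, i) * u i s)"
      using rs by (auto simp: P_def scalar_prod_def atLeast0LessThan D_def intro!: sum.cong)
    also have "\<dots> = (\<Sum>i<m. (\<Sum>t<m. A $$ (r, t) * u i t) * u i s)"
      using rs by (intro sum.cong refl) (simp add: PD ev)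
    also have "\<dots> = (\<Sum>t<m. A $$ (r, t) * (\<Sum>i<m. u i t * u i s))"
      unfolding sum_distrib_right sum_distrib_left by (subst sum.swap) (simp add: mult_ac)
    also have "\<dots> = (\<Sum>t<m. if t = s then A $$ (r, t) else 0)"
      using rs by (intro sum.cong refl) (auto simp: orthonormal_basis_completeness[OF u refl])
    finally show "A $$ (r, s) = (P * D * transpose_mat P) $$ (r, s)" using rs by simp
  qed (use A in \<open>auto simp: P_def\<close>)
  ultimately have "similar_mat_wit A D P (transpose_mat P)"
    using A car by (auto simp: similar_mat_wit_def Let_def)
  then have "similar_mat A D" by (auto simp: similar_mat_def)
  then have "char_poly A = char_poly D" by (rule char_poly_similar)
  also have "\<dots> = (\<Prod>a\<leftarrow>diag_mat D. [:- a, 1:])"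
    by (rule char_poly_upper_triangular[OF car(3)]) (auto simp: D_def upper_triangular_def)
  also have "diag_mat D = map d [0..<m]" by (auto simp: diag_mat_def D_def)
  finally have "char_poly A = (\<Prod>i\<leftarrow>[0..<m]. [:- d i, 1:])" by (simp add: o_def)
  also have "\<dots> = (\<Prod>i<m. [:- d i, 1:])"
    by (simp add: prod.distinct_set_conv_list[symmetric] atLeast0LessThan)
  finally have cp: "char_poly A = (\<Prod>i<m. [:- d i, 1:])" .
  have "proots (char_poly A) = (\<Sum>i<m. {#d i#})"
    unfolding cp by (subst proots_prod) auto
  also have "\<dots> = {# d i. i \<in># mset_set {..<m} #}"
    by (induction m) (auto simp: lessThan_Suc)
  finally show ?thesis .
qed

section \<open>Left singular vectors\<close>

definition coldot :: "real Matrix.mat \<Rightarrow> (nat \<Rightarrow> real) \<Rightarrow> nat \<Rightarrow> real" where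
  "coldot A x c = dot (dim_row A) x (\<lambda>r. A $$ (r, c))"

text \<open>A singular value decomposition without right singular vectors: the vectors A^T u_i are
  mutually orthogonal with lengths s_i, which says that the u_i diagonalise A A^T. Zero values are
  allowed, so the u_i always form a full basis.\<close>

definition left_singular_system :: "real Matrix.mat \<Rightarrow> (nat \<Rightarrow> nat \<Rightarrow> real) \<Rightarrow> (nat \<Rightarrow> real) \<Rightarrow> bool" where
  "left_singular_system A u s \<longleftrightarrow> orthonormal_family (dim_row A) (dim_row A) u \<and>
     (\<forall>i<dim_row A. 0 \<le> s i) \<and>
     (\<forall>i<dim_row A. \<forall>k<dim_row A.
        dot (dim_col A) (coldot A (u i)) (coldot A (u k)) = (if i = k then (s i)\<^sup>2 else 0))"

lemma gram_entry:
  assumes "r < dim_row A" "s < dim_row A"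
  shows "(A * transpose_mat A) $$ (r, s) = (\<Sum>c<dim_col A. A $$ (r, c) * A $$ (s, c))"
  using assms by (simp add: scalar_prod_def atLeast0LessThan)

lemma dot_gram:
  assumes "r < dim_row A"
  shows "(\<Sum>s<dim_row A. (A * transpose_mat A) $$ (r, s) * x s) =
    (\<Sum>c<dim_col A. A $$ (r, c) * coldot A x c)"
proof -
  have "(\<Sum>s<dim_row A. (A * transpose_mat A) $$ (r, s) * x s) =
      (\<Sum>s<dim_row A. \<Sum>c<dim_col A. A $$ (r, c) * (x s * A $$ (s, c)))"
    using assms by (intro sum.cong refl) (simp del: index_mult_mat add: gram_entry sum_distrib_left mult_ac)
  then show ?thesis by (subst (asm) sum.swap) (simp add: coldot_def dot_def sum_distrib_left)
qed

lemma dot_coldot: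
  "dot (dim_col A) (coldot A x) (coldot A y) =
    dot (dim_row A) x (\<lambda>r. \<Sum>s<dim_row A. (A * transpose_mat A) $$ (r, s) * y s)"
proof -
  have "dot (dim_row A) x (\<lambda>r. \<Sum>s<dim_row A. (A * transpose_mat A) $$ (r, s) * y s) =
      dot (dim_row A) x (\<lambda>r. \<Sum>c<dim_col A. A $$ (r, c) * coldot A y c)"
    by (intro dot_cong refl dot_gram)
  also have "\<dots> = (\<Sum>c<dim_col A. coldot A x c * coldot A y c)"
    unfolding dot_sum by (simp add: coldot_def[of A x] dot_def sum_distrib_left mult_ac)
  finally show ?thesis by (simp add: dot_def)
qed

text \<open>Expanding A A^T u_i in the basis leaves only s_i^2 u_i. Hence any such system certifies
  the singular values, and those of a matrix built on a known basis can be read off.\<close>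

lemma singular_values_left_singular_system:
  assumes "left_singular_system A u s"
  shows "singular_values A = {# s i. i \<in># mset_set {..<dim_row A} #}"
proof -
  let ?m = "dim_row A"
  have u: "orthonormal_family ?m ?m u" using assms by (simp add: left_singular_system_def)
  have "(\<Sum>t<?m. (A * transpose_mat A) $$ (r, t) * u i t) = (s i)\<^sup>2 * u i r" if "i < ?m" "r < ?m" for i r
  proof -
    let ?x = "\<lambda>r. \<Sum>t<?m. (A * transpose_mat A) $$ (r, t) * u i t"
    have "?x r = (\<Sum>k<?m. dot ?m (u k) ?x * u k r)"
      by (rule orthonormal_expansion[OF u that(2)])
    also have "\<dots> = (\<Sum>k<?m. if k = i then (s i)\<^sup>2 * u i r else 0)"
      using assms that by (intro sum.cong refl) (auto simp: dot_coldot[symmetric] left_singular_system_def)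
    finally show ?thesis using that by simp
  qed
  then have "proots (char_poly (A * transpose_mat A)) = {# (s i)\<^sup>2. i \<in># mset_set {..<?m} #}"
    by (intro proots_char_poly_orthonormal[OF _ u]) auto
  moreover have "{# sqrt ((s i)\<^sup>2). i \<in># mset_set {..<?m} #} = {# s i. i \<in># mset_set {..<?m} #}"
    using assms by (intro image_mset_cong) (auto simp: left_singular_system_def)
  ultimately show ?thesis by (simp add: singular_values_def image_mset.compositionality o_def)
qed

text \<open>The eigenvalues of A A^T are the squared lengths of the vectors A^T u_i, hence
  nonnegative, and their roots serve as singular values.\<close>

lemma left_singular_system_exists:
  obtains u s where "left_singular_system A u s"
proof -
  let ?m = "dim_row A"
  have "\<exists>u d. orthonormal_family ?m ?m u \<and>
      (\<forall>i<?m. \<forall>r<?m. dot ?m (\<lambda>s. (A * transpose_mat A) $$ (r, s)) (u i) = d i * u i r)"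
    by (intro symmetric_eigenvectors) (simp_all del: index_mult_mat add: gram_entry mult.commute)
  then obtain u d where u: "orthonormal_family ?m ?m u"
    and d: "\<And>i r. i < ?m \<Longrightarrow> r < ?m \<Longrightarrow> (\<Sum>s<?m. (A * transpose_mat A) $$ (r, s) * u i s) = d i * u i r"
    unfolding dot_def by blast
  have gram: "dot (dim_col A) (coldot A (u i)) (coldot A (u k)) = (if i = k then d i else 0)"
    if "i < ?m" "k < ?m" for i k
  proof -
    have "dot (dim_col A) (coldot A (u i)) (coldot A (u k)) = dot ?m (u i) (\<lambda>r. d k * u k r)"
      unfolding dot_coldot using that by (intro dot_cong refl d)
    then show ?thesis using u that by (auto simp: dot_scale orthonormal_family_def)
  qed
  have "0 \<le> d i" if "i < ?m" for i
    using gram[OF that that] dot_nonneg[of "dim_col A" "coldot A (u i)"] by simp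
  then have "left_singular_system A u (\<lambda>i. sqrt (d i))"
    using u gram by (auto simp: left_singular_system_def)
  then show ?thesis by (rule that)
qed

section \<open>Schatten norms\<close>

lemma schatten_norm_nonneg: "0 \<le> schatten_norm r A"
  by (simp add: schatten_norm_def lp_norm_nonneg)

definition frob :: "real Matrix.mat \<Rightarrow> real Matrix.mat \<Rightarrow> real" where
  "frob A Y = (\<Sum>r<dim_row A. \<Sum>c<dim_col A. A $$ (r, c) * Y $$ (r, c))"

definition row_image_norm :: "real Matrix.mat \<Rightarrow> (nat \<Rightarrow> real) \<Rightarrow> real" where
  "row_image_norm A x = sqrt (dot (dim_col A) (coldot A x) (coldot A x))"

lemma row_image_norm_sq: "(row_image_norm A x)\<^sup>2 = dot (dim_col A) (coldot A x) (coldot A x)"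
  by (simp add: row_image_norm_def dot_nonneg)

lemma dot_Cauchy_Schwarz: "dot m x y \<le> sqrt (dot m x x) * sqrt (dot m y y)"
proof -
  have "(dot m x y)\<^sup>2 \<le> dot m x x * dot m y y"
    using Cauchy_Schwarz_ineq_sum[of x y "{..<m}"] by (simp add: dot_def power2_eq_square)
  then have "\<bar>dot m x y\<bar> \<le> sqrt (dot m x x * dot m y y)" using real_le_rsqrt by force
  then show ?thesis by (simp add: real_sqrt_mult)
qed

lemma frob_eq_sum_coldot:
  assumes "orthonormal_family m m u" "A \<in> carrier_mat m n" "Y \<in> carrier_mat m n"
  shows "frob A Y = (\<Sum>i<m. dot n (coldot A (u i)) (coldot Y (u i)))"
proof -
  have "frob A Y = (\<Sum>c<n. dot m (\<lambda>r. A $$ (r, c)) (\<lambda>r. Y $$ (r, c)))"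
    unfolding frob_def dot_def using assms by (subst sum.swap) simp
  also have "\<dots> = (\<Sum>c<n. \<Sum>i<m. coldot A (u i) c * coldot Y (u i) c)"
    using assms by (subst orthonormal_parseval[OF assms(1)]) (simp add: coldot_def)
  finally show ?thesis by (subst (asm) sum.swap) (simp add: dot_def)
qed

lemma frob_le_sum_row_image_norm:
  assumes "orthonormal_family m m u" "A \<in> carrier_mat m n" "Y \<in> carrier_mat m n"
  shows "frob A Y \<le> (\<Sum>i<m. row_image_norm A (u i) * row_image_norm Y (u i))"
  unfolding frob_eq_sum_coldot[OF assms] using assms
  by (intro sum_mono) (simp add: row_image_norm_def dot_Cauchy_Schwarz)

lemma row_image_norm_left_singular_system:
  assumes "left_singular_system A u s" "i < dim_row A"
  shows "row_image_norm A (u i) = s i"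
  using assms by (simp add: row_image_norm_def left_singular_system_def)

lemma schatten_norm_left_singular_system:
  assumes "left_singular_system A u s" "A \<in> carrier_mat m n"
  shows "schatten_norm r A = lp_norm r {# s i. i \<in># mset_set {..<m} #}"
  using singular_values_left_singular_system[OF assms(1)] assms(2) by (simp add: schatten_norm_def)

text \<open>The weights are squared inner products between two orthonormal bases, u and the left
  singular vectors x_k of Y. Parseval in each basis gives row and column sums 1, and orthogonality
  of the vectors Y^T x_k removes the mixed terms.\<close>

lemma lp_row_image_norm_le_schatten:
  assumes "orthonormal_family m m u" "Y \<in> carrier_mat m n" "p \<in> {2..\<infinity>}"
  shows "lp_norm p {# row_image_norm Y (u i). i \<in># mset_set {..<m} #} \<le> schatten_norm p Y"
proof -
  obtain x t where xt: "left_singular_system Y x t" by (rule left_singular_system_exists)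
  then have x: "orthonormal_family m m x" using assms(2) by (simp add: left_singular_system_def)
  have unit: "(\<Sum>k<m. (dot m (v k) z)\<^sup>2) = dot m z z" if "orthonormal_family m m v" for v z
    using orthonormal_parseval[OF that, of z z] by (simp add: power2_eq_square)
  have "(row_image_norm Y (u i))\<^sup>2 = (\<Sum>k<m. (dot m (x k) (u i))\<^sup>2 * (t k)\<^sup>2)" if "i < m" for i
  proof -
    have exp: "coldot Y (u i) c = (\<Sum>k<m. dot m (x k) (u i) * coldot Y (x k) c)" for c
      using orthonormal_parseval[OF x, of "u i" "\<lambda>r. Y $$ (r, c)"] assms(2) by (simp add: coldot_def)
    have "(row_image_norm Y (u i))\<^sup>2 = (\<Sum>k<m. dot m (x k) (u i) * dot n (coldot Y (x k)) (coldot Y (u i)))"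
      unfolding row_image_norm_sq using assms(2)
      by (subst (2) exp[abs_def]) (simp add: dot_sum dot_scale dot_commute[of n "coldot Y (u i)" "coldot Y (x _)"])
    also have "\<dots> = (\<Sum>k<m. dot m (x k) (u i) * (\<Sum>l<m. dot m (x l) (u i) * dot n (coldot Y (x k)) (coldot Y (x l))))"
      by (subst exp[abs_def]) (simp add: dot_sum dot_scale)
    also have "\<dots> = (\<Sum>k<m. dot m (x k) (u i) * (\<Sum>l<m. if l = k then dot m (x l) (u i) * (t k)\<^sup>2 else 0))"
      using xt assms(2) by (intro sum.cong refl arg_cong2[where f="(*)"]) (auto simp: left_singular_system_def)
    finally show ?thesis by (simp add: power2_eq_square mult_ac)
  qed
  moreover have "(\<Sum>k<m. (dot m (x k) (u i))\<^sup>2) = 1" if "i < m" for i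
    using unit[OF x, of "u i"] assms(1) that by (simp add: orthonormal_family_def)
  moreover have "(\<Sum>i<m. (dot m (x k) (u i))\<^sup>2) = 1" if "k < m" for k
    using unit[OF assms(1), of "x k"] x that
    by (simp add: orthonormal_family_def dot_commute[of m "x k" "u _"])
  ultimately have "lp_norm p {# row_image_norm Y (u i). i \<in># mset_set {..<m} #} \<le>
      lp_norm p {# t i. i \<in># mset_set {..<m} #}"
    using assms(3)
    by (intro lp_norm_doubly_stochastic[where w = "\<lambda>i k. (dot m (x k) (u i))\<^sup>2"]) auto
  then show ?thesis using schatten_norm_left_singular_system[OF xt assms(2)] by simp
qed

lemma schatten_norm_dual_attained:
  assumes "A \<in> carrier_mat m n" "p \<in> {2..\<infinity>}" "q \<in> {1..2}" "conjugate_exponents p q"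
  obtains Y where "Y \<in> carrier_mat m n" "schatten_norm p Y \<le> 1" "frob A Y = schatten_norm q A"
proof -
  obtain u s where us: "left_singular_system A u s" by (rule left_singular_system_exists)
  then have u: "orthonormal_family m m u" and s: "\<And>i. i < m \<Longrightarrow> 0 \<le> s i"
    and orth: "\<And>i k. i < m \<Longrightarrow> k < m \<Longrightarrow>
      dot n (coldot A (u i)) (coldot A (u k)) = (if i = k then (s i)\<^sup>2 else 0)"
    using assms(1) by (auto simp: left_singular_system_def)
  obtain c where c: "\<And>i. i \<in> {..<m} \<Longrightarrow> 0 \<le> c i" "\<And>i. i \<in> {..<m} \<Longrightarrow> s i = 0 \<Longrightarrow> c i = 0"
    "lp_norm p {# c i. i \<in># mset_set {..<m} #} \<le> 1"
    "(\<Sum>i<m. c i * s i) = lp_norm q {# s i. i \<in># mset_set {..<m} #}"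
    using lp_norm_dual_attained[of "{..<m}" p q s] assms s by auto
  \<comment> \<open>Y has the singular vectors of A, with c_i in place of s_i; the right ones are
    A^T u_i / s_i. Where s_i = 0 the quotient is 0 and so is c_i, so the singular value is still
    c_i.\<close>
  define Y where "Y = Matrix.mat m n (\<lambda>(r, col). \<Sum>i<m. u i r * (c i / s i * coldot A (u i) col))"
  have Y: "Y \<in> carrier_mat m n" by (simp add: Y_def)
  have col: "coldot Y (u k) b = c k / s k * coldot A (u k) b" if "k < m" "b < n" for k b
  proof -
    have "coldot Y (u k) b = dot m (u k) (\<lambda>r. Y $$ (r, b))"
      using Y by (simp add: coldot_def)
    also have "\<dots> = dot m (u k) (\<lambda>r. \<Sum>i<m. (c i / s i * coldot A (u i) b) * u i r)"
      using that by (intro dot_cong refl) (simp add: Y_def mult_ac)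
    also have "\<dots> = (\<Sum>i<m. if i = k then c i / s i * coldot A (u i) b else 0)"
      unfolding dot_sum dot_scale using u that
      by (intro sum.cong refl) (auto simp: orthonormal_family_def)
    finally show ?thesis using that by simp
  qed
  have YA: "dot n z (coldot Y (u k)) = c k / s k * dot n z (coldot A (u k))" if "k < m" for k z
    unfolding dot_scale[symmetric] using that by (intro dot_cong col refl)
  have "dot n (coldot Y (u i)) (coldot Y (u k)) = (if i = k then (c i)\<^sup>2 else 0)" if "i < m" "k < m" for i k
  proof -
    have "dot n (coldot Y (u i)) (coldot Y (u k)) =
        c k / s k * (c i / s i * dot n (coldot A (u k)) (coldot A (u i)))"
      using that by (simp add: YA dot_commute[of n "coldot Y (u i)" "coldot A (u k)"])
    then show ?thesis using that orth[OF that(2,1)] c(2)[of i]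
      by (auto simp: power2_eq_square)
  qed
  then have "left_singular_system Y u c" using Y u c(1) by (auto simp: left_singular_system_def)
  then have "schatten_norm p Y \<le> 1" using schatten_norm_left_singular_system[OF _ Y] c(3) by simp
  moreover have "frob A Y = (\<Sum>i<m. c i * s i)"
    unfolding frob_eq_sum_coldot[OF u assms(1) Y] using orth c(2)
    by (intro sum.cong refl) (auto simp: YA power2_eq_square)
  then have "frob A Y = schatten_norm q A"
    using c(4) schatten_norm_left_singular_system[OF us assms(1)] by simp
  ultimately show ?thesis using that Y by blast
qed

text \<open>The basis is chosen without regard to A, so it can be fixed before a random A is seen. A
  dual matrix Y turns the left side into a trace product, and the averaging bound for p \<ge> 2 is
  applied to Y instead of A.\<close>

lemma schatten_norm_le_lp_row_image_norm:
  assumes "orthonormal_family m m u" "A \<in> carrier_mat m n"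
    and "p \<in> {2..\<infinity>}" "q \<in> {1..2}" "conjugate_exponents p q"
  shows "schatten_norm q A \<le> lp_norm q {# row_image_norm A (u i). i \<in># mset_set {..<m} #}"
proof -
  obtain Y where Y: "Y \<in> carrier_mat m n" "schatten_norm p Y \<le> 1" "frob A Y = schatten_norm q A"
    using schatten_norm_dual_attained[OF assms(2-5)] by blast
  have "schatten_norm q A \<le> (\<Sum>i<m. row_image_norm A (u i) * row_image_norm Y (u i))"
    using frob_le_sum_row_image_norm[OF assms(1,2) Y(1)] Y(3) by simp
  also have "\<dots> \<le> lp_norm q {# row_image_norm A (u i). i \<in># mset_set {..<m} #} *
      lp_norm p {# row_image_norm Y (u i). i \<in># mset_set {..<m} #}"
    using assms by (intro lp_norm_Hoelder) auto
  also have "\<dots> \<le> lp_norm q {# row_image_norm A (u i). i \<in># mset_set {..<m} #} * 1"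
    using lp_row_image_norm_le_schatten[OF assms(1) Y(1) assms(3)] Y(2)
    by (intro mult_left_mono lp_norm_nonneg) linarith
  finally show ?thesis by simp
qed

text \<open>Here the basis is that of A, so its factor after Hoelder's inequality is exactly the
  Schatten norm, and only Y pays the averaging inequality.\<close>

lemma schatten_norm_Hoelder:
  assumes "A \<in> carrier_mat m n" "Y \<in> carrier_mat m n"
    and "p \<in> {2..\<infinity>}" "q \<in> {1..2}" "conjugate_exponents p q"
  shows "frob A Y \<le> schatten_norm q A * schatten_norm p Y"
proof -
  obtain u s where us: "left_singular_system A u s" by (rule left_singular_system_exists)
  then have u: "orthonormal_family m m u" using assms(1) by (simp add: left_singular_system_def)
  have "frob A Y \<le> (\<Sum>i<m. s i * row_image_norm Y (u i))"
    using frob_le_sum_row_image_norm[OF u assms(1,2)] assms(1)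
    by (simp add: row_image_norm_left_singular_system[OF us])
  also have "\<dots> \<le> schatten_norm q A * lp_norm p {# row_image_norm Y (u i). i \<in># mset_set {..<m} #}"
    unfolding schatten_norm_left_singular_system[OF us assms(1)]
    using assms by (intro lp_norm_Hoelder) auto
  also have "\<dots> \<le> schatten_norm q A * schatten_norm p Y"
    using assms by (intro mult_left_mono schatten_norm_nonneg lp_row_image_norm_le_schatten[OF u])
  finally show ?thesis .
qed

lemma schatten_norm_smult:
  assumes "1 \<le> r"
  shows "schatten_norm r (a \<cdot>\<^sub>m A) = \<bar>a\<bar> * schatten_norm r A"
proof -
  obtain u s where us: "left_singular_system A u s" by (rule left_singular_system_exists)
  have col: "coldot (a \<cdot>\<^sub>m A) x c = a * coldot A x c" if "c < dim_col A" for x c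
    unfolding coldot_def dot_scale[symmetric] using that by (auto intro!: dot_cong)
  have "dot (dim_col A) (coldot (a \<cdot>\<^sub>m A) x) (coldot (a \<cdot>\<^sub>m A) y) =
      dot (dim_col A) (\<lambda>c. a * coldot A x c) (\<lambda>c. a * coldot A y c)" for x y
    by (intro dot_cong col)
  then have "dot (dim_col A) (coldot (a \<cdot>\<^sub>m A) x) (coldot (a \<cdot>\<^sub>m A) y) =
      a * (a * dot (dim_col A) (coldot A x) (coldot A y))" for x y
    by (simp add: dot_scale dot_scale')
  then have "left_singular_system (a \<cdot>\<^sub>m A) u (\<lambda>i. \<bar>a\<bar> * s i)"
    using us by (auto simp: left_singular_system_def power2_eq_square)
  then have "schatten_norm r (a \<cdot>\<^sub>m A) = lp_norm r {# \<bar>a\<bar> * s i. i \<in># mset_set {..<dim_row A} #}"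
    by (rule schatten_norm_left_singular_system[where n = "dim_col A"]) simp
  also have "\<dots> = \<bar>a\<bar> * schatten_norm r A"
    using schatten_norm_left_singular_system[OF us, of "dim_row A" "dim_col A" r] assms
    by (simp add: lp_norm_scale)
  finally show ?thesis .
qed

section \<open>Steepest descent with momentum over a norm ball\<close>

lemma momentum_diff:
  "momentum \<theta> (\<lambda>k. a k - b k) k = momentum \<theta> a k - momentum \<theta> b k"
proof (induction k)
  case (Suc k)
  show ?case unfolding momentum.simps Suc by (simp add: algebra_simps)
qed simp

text \<open>The last two conditions make \<open>dnrm\<close> the support function of the unit ball
  of \<open>nrm\<close>. Subadditivity, convexity and hence measurability of \<open>dnrm\<close> are
  derived from this, so the descent argument never mentions Schatten norms.\<close>

locale dual_norm_pair =
  fixes nrm dnrm :: "'a::euclidean_space \<Rightarrow> real"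
  assumes nrm_nonneg: "0 \<le> nrm x" and dnrm_nonneg: "0 \<le> dnrm x"
    and nrm_scaleR: "nrm (c *\<^sub>R x) = \<bar>c\<bar> * nrm x"
    and inner_le: "inner x y \<le> dnrm x * nrm y"
    and dual_attained: "\<exists>y. nrm y \<le> 1 \<and> inner x y = dnrm x"
begin

lemma dnrm_le:
  assumes "\<And>y. nrm y \<le> 1 \<Longrightarrow> inner x y \<le> b"
  shows "dnrm x \<le> b"
  using dual_attained[of x] assms by force

lemma inner_le_dnrm: "nrm y \<le> 1 \<Longrightarrow> inner x y \<le> dnrm x"
  using inner_le[of x y] mult_left_mono[of "nrm y" 1 "dnrm x"] dnrm_nonneg[of x] by simp

lemma dnrm_add_le: "dnrm (x + y) \<le> dnrm x + dnrm y"
  by (rule dnrm_le) (simp add: inner_add_left add_mono inner_le_dnrm)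

lemma dnrm_scaleR_le: "0 \<le> c \<Longrightarrow> dnrm (c *\<^sub>R x) \<le> c * dnrm x"
  by (rule dnrm_le) (simp add: mult_left_mono inner_le_dnrm)

lemma dnrm_minus_le: "dnrm (- x) \<le> dnrm x"
proof (rule dnrm_le)
  fix y assume "nrm y \<le> 1"
  then have "nrm (- y) \<le> 1" using nrm_scaleR[of "-1" y] by simp
  from inner_le_dnrm[OF this, of x] show "inner (- x) y \<le> dnrm x" by simp
qed

lemma dnrm_diff_le: "dnrm (x - y) \<le> dnrm x + dnrm y"
  using dnrm_add_le[of x "- y"] dnrm_minus_le[of y] by simp

lemma dnrm_0: "dnrm 0 = 0"
  using dual_attained[of 0] by auto

lemma continuous_on_dnrm: "continuous_on UNIV dnrm"
proof (rule convex_on_continuous)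
  show "convex_on UNIV dnrm"
    using dnrm_add_le dnrm_scaleR_le by (intro convex_onI) (smt (verit) convex_UNIV)+
qed simp

lemma borel_measurable_dnrm [measurable]: "dnrm \<in> borel_measurable borel"
  by (rule borel_measurable_continuous_onI[OF continuous_on_dnrm])

text \<open>The minimiser is compared with \<open>x - \<eta> *\<^sub>R y\<close>, where y attains
  the dual norm of M.\<close>

lemma ball_oracle_step:
  assumes "is_arg_min (\<lambda>y. inner M (y - x)) (\<lambda>y. nrm (y - x) \<le> \<eta>) x'" "0 \<le> \<eta>"
  shows "nrm (x' - x) \<le> \<eta>" "inner M (x' - x) \<le> - \<eta> * dnrm M"
proof -
  show "nrm (x' - x) \<le> \<eta>" using assms by (simp add: is_arg_min_def)
  obtain y where y: "nrm y \<le> 1" "inner M y = dnrm M" using dual_attained by blast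
  let ?y = "x - \<eta> *\<^sub>R y"
  have "nrm (?y - x) \<le> \<eta>"
    using nrm_scaleR[of "- \<eta>" y] y assms(2) mult_left_mono[of "nrm y" 1 \<eta>] by simp
  then have "\<not> inner M (?y - x) < inner M (x' - x)" using assms(1) unfolding is_arg_min_def by blast
  then show "inner M (x' - x) \<le> - \<eta> * dnrm M" using y by simp
qed

end

section \<open>Smoothness, descent and drift\<close>

locale smooth_function = dual_norm_pair nrm dnrm
  for nrm dnrm :: "'a::euclidean_space \<Rightarrow> real" +
  fixes f :: "'a \<Rightarrow> real" and g :: "'a \<Rightarrow> 'a"
  assumes gderiv: "GDERIV f x :> g x"
    and lipschitz: "dnrm (g y - g x) \<le> nrm (y - x)"
begin

text \<open>Along the segment, h subtracts from f all but the constant term of its quadratic upper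
  model. Duality and the Lipschitz condition make the derivative of h nonpositive for t \<ge>
  0.\<close>

lemma descent: "f y \<le> f x + inner (g x) (y - x) + (nrm (y - x))\<^sup>2 / 2"
proof -
  define d where "d = y - x"
  define h where "h t = f (x + t *\<^sub>R d) - t * inner (g x) d - t\<^sup>2 / 2 * (nrm d)\<^sup>2" for t
  have "(h has_real_derivative inner (g (x + t *\<^sub>R d)) d - inner (g x) d - t * (nrm d)\<^sup>2) (at t)" for t
  proof -
    have "((\<lambda>t. f (x + t *\<^sub>R d)) has_derivative (\<lambda>s. inner (s *\<^sub>R d) (g (x + t *\<^sub>R d)))) (at t)"
      using gderiv[of "x + t *\<^sub>R d"] unfolding gderiv_def
      by (rule has_derivative_compose[rotated]) (auto intro!: derivative_eq_intros)
    then have "((\<lambda>t. f (x + t *\<^sub>R d)) has_real_derivative inner (g (x + t *\<^sub>R d)) d) (at t)"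
      by (simp add: has_field_derivative_def inner_commute mult_commute_abs)
    then show ?thesis unfolding h_def
      by (auto intro!: derivative_eq_intros)
  qed
  moreover have "inner (g (x + t *\<^sub>R d)) d - inner (g x) d - t * (nrm d)\<^sup>2 \<le> 0" if "0 \<le> t" for t
  proof -
    have "inner (g (x + t *\<^sub>R d) - g x) d \<le> dnrm (g (x + t *\<^sub>R d) - g x) * nrm d"
      by (rule inner_le)
    also have "\<dots> \<le> (t * nrm d) * nrm d"
      using lipschitz[of "x + t *\<^sub>R d" x] that
      by (intro mult_right_mono nrm_nonneg) (simp add: nrm_scaleR)
    finally show ?thesis by (simp add: inner_diff_left power2_eq_square)
  qed
  ultimately have "h 1 \<le> h 0"
    by (intro DERIV_nonpos_imp_nonincreasing[of 0 1 h]) (auto intro!: exI)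
  then show ?thesis by (simp add: h_def d_def)
qed

text \<open>The bound is the fixed point of
  \<open>r \<mapsto> (1 - \<theta>) * (r + \<eta>)\<close>, the effect of one more step. At k = 0
  there is no bias, since the average starts at the gradient itself.\<close>

lemma momentum_bias_le:
  assumes "0 < \<theta>" "\<theta> \<le> 1" "\<And>l. nrm (x (Suc l) - x l) \<le> \<eta>"
  shows "dnrm (momentum \<theta> (\<lambda>l. g (x l)) k - g (x k)) \<le> \<eta> * (1 - \<theta>) / \<theta>"
proof (induction k)
  case 0
  have "0 \<le> \<eta>" using assms(3)[of 0] nrm_nonneg[of "x 1 - x 0"] by simp
  then show ?case using assms by (simp add: dnrm_0)
next
  case (Suc k)
  let ?b = "momentum \<theta> (\<lambda>l. g (x l)) k - g (x k)"
  have "momentum \<theta> (\<lambda>l. g (x l)) (Suc k) - g (x (Suc k)) =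
      (1 - \<theta>) *\<^sub>R (?b - (g (x (Suc k)) - g (x k)))"
    by (simp add: algebra_simps)
  also have "dnrm \<dots> \<le> (1 - \<theta>) * dnrm (?b - (g (x (Suc k)) - g (x k)))"
    using assms by (intro dnrm_scaleR_le) simp
  also have "\<dots> \<le> (1 - \<theta>) * (\<eta> * (1 - \<theta>) / \<theta> + \<eta>)"
  proof (rule mult_left_mono)
    have "dnrm (?b - (g (x (Suc k)) - g (x k))) \<le> dnrm ?b + dnrm (g (x (Suc k)) - g (x k))"
      by (rule dnrm_diff_le)
    then show "dnrm (?b - (g (x (Suc k)) - g (x k))) \<le> \<eta> * (1 - \<theta>) / \<theta> + \<eta>"
      using lipschitz[of "x (Suc k)" "x k"] assms(3)[of k] Suc by linarith
  qed (use assms in simp)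
  also have "\<dots> = \<eta> * (1 - \<theta>) / \<theta>" using assms(1) by (simp add: field_simps)
  finally show ?case .
qed

text \<open>A statement about a single path, without probability. The momentum error enters twice,
  once when M replaces the gradient in the linear model and once when the norm of M is replaced by
  that of the gradient; this is the factor 2.\<close>

lemma ball_oracle_path_bound:
  fixes x G :: "nat \<Rightarrow> 'a"
  assumes step: "\<And>k. is_arg_min (\<lambda>y. inner (momentum \<theta> G k) (y - x k)) (\<lambda>y. nrm (y - x k) \<le> \<eta>) (x (Suc k))"
    and "0 < \<theta>" "\<theta> \<le> 1" "0 \<le> \<eta>" and low: "\<And>y. f_low \<le> f y"
  shows "\<eta> * (\<Sum>k<K. dnrm (g (x k))) \<le> f (x 0) - f_low +
    2 * \<eta> * (\<Sum>k<K. dnrm (momentum \<theta> (\<lambda>l. G l - g (x l)) k)) +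
    real K * (2 * \<eta> * (\<eta> * (1 - \<theta>) / \<theta>) + \<eta>\<^sup>2 / 2)"
proof -
  note ball = ball_oracle_step[OF step \<open>0 \<le> \<eta>\<close>]
  define N where "N k = momentum \<theta> (\<lambda>l. G l - g (x l)) k" for k
  define r where "r = \<eta> * (1 - \<theta>) / \<theta>"
  define c where "c = 2 * \<eta> * r + \<eta>\<^sup>2 / 2"
  have decrease: "f (x (Suc k)) + \<eta> * dnrm (g (x k)) \<le> f (x k) + 2 * \<eta> * dnrm (N k) + c" for k
  proof -
    let ?M = "momentum \<theta> G k" and ?d = "x (Suc k) - x k"
    define E where "E = ?M - g (x k)"
    have "E = N k + (momentum \<theta> (\<lambda>l. g (x l)) k - g (x k))"
      by (simp add: E_def N_def momentum_diff)
    then have "dnrm E \<le> dnrm (N k) + r"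
      using dnrm_add_le[of "N k" "momentum \<theta> (\<lambda>l. g (x l)) k - g (x k)"]
        momentum_bias_le[OF assms(2,3), where x = x and \<eta> = \<eta> and k = k, OF ball(1)] by (simp add: r_def)
    then have E: "\<eta> * dnrm E \<le> \<eta> * (dnrm (N k) + r)"
      using \<open>0 \<le> \<eta>\<close> by (intro mult_left_mono)
    have "dnrm (g (x k)) \<le> dnrm ?M + dnrm E"
      using dnrm_diff_le[of ?M E] by (simp add: E_def)
    then have M: "\<eta> * dnrm (g (x k)) \<le> \<eta> * (dnrm ?M + dnrm E)"
      using \<open>0 \<le> \<eta>\<close> by (intro mult_left_mono)
    have "inner (- E) ?d \<le> dnrm (- E) * nrm ?d" by (rule inner_le)
    also have "\<dots> \<le> dnrm E * \<eta>"
      using ball(1) by (intro mult_mono dnrm_minus_le dnrm_nonneg nrm_nonneg)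
    finally have "inner (g (x k)) ?d \<le> inner ?M ?d + \<eta> * dnrm E"
      by (simp add: E_def inner_diff_left mult.commute)
    moreover have "(nrm ?d)\<^sup>2 \<le> \<eta>\<^sup>2"
      using ball(1) by (intro power_mono nrm_nonneg)
    ultimately have "f (x (Suc k)) \<le> f (x k) - \<eta> * dnrm ?M + \<eta> * dnrm E + \<eta>\<^sup>2 / 2"
      using descent[of "x (Suc k)" "x k"] ball(2)[of k] by simp
    then show ?thesis using E M by (simp add: c_def algebra_simps)
  qed
  have "f (x K) + \<eta> * (\<Sum>k<K. dnrm (g (x k))) \<le> f (x 0) + 2 * \<eta> * (\<Sum>k<K. dnrm (N k)) + real K * c"
  proof (induction K)
    case (Suc K)
    then show ?case using decrease[of K] by (simp add: algebra_simps)
  qed simp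
  then show ?thesis using low[of "x K"] by (simp add: N_def c_def r_def)
qed

end

section \<open>Mixed Schatten norms\<close>

lemma blocks_carrier [simp]: "blocks m n ent X j \<in> carrier_mat (m j) (n j)"
  by (simp add: blocks_def)

lemma blocks_scaleR: "blocks m n ent (a *\<^sub>R X) j = a \<cdot>\<^sub>m blocks m n ent X j"
  by (intro eq_matI) (auto simp: blocks_def)

lemma blocks_diff: "blocks m n ent (X - Y) j = blocks m n ent X j - blocks m n ent Y j"
  by (intro eq_matI) (auto simp: blocks_def)

text \<open>Dual maximisers are found block by block; this glues them into one vector, which exists
  because \<open>ent\<close> is injective on the entries.\<close>

lemma blocks_surj:
  fixes ent :: "nat \<times> nat \<times> nat \<Rightarrow> 'e::finite"
  assumes "bij_betw ent (block_entries J m n) UNIV"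
    and Z: "\<And>j. j \<in> {1..J} \<Longrightarrow> Z j \<in> carrier_mat (m j) (n j)"
  obtains Y :: "real ^ 'e" where "\<And>j. j \<in> {1..J} \<Longrightarrow> blocks m n ent Y j = Z j"
proof
  let ?Y = "vec_lambda (\<lambda>e. case the_inv_into (block_entries J m n) ent e of (j, r, c) \<Rightarrow> Z j $$ (r, c)) :: real ^ 'e"
  fix j assume j: "j \<in> {1..J}"
  show "blocks m n ent ?Y j = Z j"
  proof (rule eq_matI)
    fix r c assume "r < dim_row (Z j)" "c < dim_col (Z j)"
    then have rc: "r < m j" "c < n j" using Z[OF j] by auto
    then have "(j, r, c) \<in> block_entries J m n" using j by (simp add: block_entries_def)
    then have "the_inv_into (block_entries J m n) ent (ent (j, r, c)) = (j, r, c)"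
      using assms(1) by (intro the_inv_into_f_f) (auto simp: bij_betw_def)
    then show "blocks m n ent ?Y j $$ (r, c) = Z j $$ (r, c)" using rc by (simp add: blocks_def)
  qed (use Z[OF j] in \<open>auto simp: blocks_def\<close>)
qed

locale mixed_norm_setting =
  fixes J :: nat and m n :: "nat \<Rightarrow> nat" and ent :: "nat \<times> nat \<times> nat \<Rightarrow> 'e::finite"
    and L :: "nat \<Rightarrow> real" and \<alpha> \<beta> :: ereal and p q :: "nat \<Rightarrow> ereal"
  assumes ent: "bij_betw ent (block_entries J m n) UNIV"
    and L: "j \<in> {1..J} \<Longrightarrow> 0 < L j"
    and \<alpha>: "\<alpha> \<in> {2..\<infinity>}" and \<beta>: "\<beta> \<in> {1..2}" and \<alpha>\<beta>: "conjugate_exponents \<alpha> \<beta>"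
    and p: "j \<in> {1..J} \<Longrightarrow> p j \<in> {2..\<infinity>}" and q: "j \<in> {1..J} \<Longrightarrow> q j \<in> {1..2}"
    and pq: "j \<in> {1..J} \<Longrightarrow> conjugate_exponents (p j) (q j)"
begin

definition wp_norm :: "real ^ 'e \<Rightarrow> real" where
  "wp_norm X = mixed_norm J (\<lambda>j. sqrt (L j)) p \<alpha> (blocks m n ent X)"

definition vq_norm :: "real ^ 'e \<Rightarrow> real" where
  "vq_norm X = mixed_norm J (\<lambda>j. 1 / sqrt (L j)) q \<beta> (blocks m n ent X)"

lemma one_le_exponents:
  "1 \<le> \<alpha>" "1 \<le> \<beta>" "j \<in> {1..J} \<Longrightarrow> 1 \<le> p j" "j \<in> {1..J} \<Longrightarrow> 1 \<le> q j"
  using \<alpha> \<beta> q[of j] order_trans[of 1 "2::ereal"] p[of j] by auto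

lemma inner_eq_sum_frob:
  "inner X Y = (\<Sum>j\<in>{1..J}. frob (blocks m n ent X j) (blocks m n ent Y j))"
  unfolding inner_blocks[OF ent] frob_def by (simp add: blocks_def)

text \<open>The weights \<open>sqrt (L j)\<close> and their inverses cancel, so Hoelder's inequality
  inside the blocks can be followed by the one across the blocks.\<close>

lemma inner_le_mixed: "inner X Y \<le> vq_norm X * wp_norm Y"
proof -
  let ?x = "\<lambda>j. 1 / sqrt (L j) * schatten_norm (q j) (blocks m n ent X j)"
  let ?y = "\<lambda>j. sqrt (L j) * schatten_norm (p j) (blocks m n ent Y j)"
  have "inner X Y \<le> (\<Sum>j\<in>{1..J}. ?x j * ?y j)"
    unfolding inner_eq_sum_frob
  proof (rule sum_mono)
    fix j assume j: "j \<in> {1..J}"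
    have "frob (blocks m n ent X j) (blocks m n ent Y j) \<le>
        schatten_norm (q j) (blocks m n ent X j) * schatten_norm (p j) (blocks m n ent Y j)"
      using p[OF j] q[OF j] pq[OF j] by (intro schatten_norm_Hoelder[OF blocks_carrier blocks_carrier])
    also have "\<dots> = ?x j * ?y j" using L[OF j] by simp
    finally show "frob (blocks m n ent X j) (blocks m n ent Y j) \<le> ?x j * ?y j" .
  qed
  also have "\<dots> \<le> vq_norm X * wp_norm Y"
    unfolding vq_norm_def wp_norm_def mixed_norm_def
    using \<alpha> \<beta> \<alpha>\<beta> by (intro lp_norm_Hoelder) auto
  finally show ?thesis .
qed

lemma mixed_dual_attained: "\<exists>Y. wp_norm Y \<le> 1 \<and> inner X Y = vq_norm X"
proof -
  let ?X = "blocks m n ent X"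
  have "\<exists>Y. Y \<in> carrier_mat (m j) (n j) \<and> schatten_norm (p j) Y \<le> 1 \<and>
      frob (?X j) Y = schatten_norm (q j) (?X j)" if j: "j \<in> {1..J}" for j
    using schatten_norm_dual_attained[OF blocks_carrier p[OF j] q[OF j] pq[OF j]] by metis
  then have "\<exists>W. \<forall>j\<in>{1..J}. W j \<in> carrier_mat (m j) (n j) \<and> schatten_norm (p j) (W j) \<le> 1 \<and>
      frob (?X j) (W j) = schatten_norm (q j) (?X j)"
    by (intro bchoice) blast
  then obtain W where W: "\<And>j. j \<in> {1..J} \<Longrightarrow> W j \<in> carrier_mat (m j) (n j)"
    "\<And>j. j \<in> {1..J} \<Longrightarrow> schatten_norm (p j) (W j) \<le> 1"
    "\<And>j. j \<in> {1..J} \<Longrightarrow> frob (?X j) (W j) = schatten_norm (q j) (?X j)"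
    by blast
  let ?x = "\<lambda>j. 1 / sqrt (L j) * schatten_norm (q j) (?X j)"
  have x_nonneg: "0 \<le> ?x j" if "j \<in> {1..J}" for j
    using L[OF that] by (simp add: schatten_norm_nonneg)
  obtain c where c: "\<And>j. j \<in> {1..J} \<Longrightarrow> 0 \<le> c j"
    "\<And>j. j \<in> {1..J} \<Longrightarrow> ?x j = 0 \<Longrightarrow> c j = 0"
    "lp_norm \<alpha> {# c j. j \<in># mset_set {1..J} #} \<le> 1"
    "(\<Sum>j\<in>{1..J}. c j * ?x j) = lp_norm \<beta> {# ?x j. j \<in># mset_set {1..J} #}"
    by (rule lp_norm_dual_attained[OF finite_atLeastAtMost \<alpha> \<beta> \<alpha>\<beta> x_nonneg]) blast+
  \<comment> \<open>A two-level maximiser: \<open>W j\<close> is extremal inside block j, c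
    distributes the weight over the blocks, and the factor 1 / sqrt (L j) cancels the weight of the
    primal norm.\<close>
  have "(c j / sqrt (L j)) \<cdot>\<^sub>m W j \<in> carrier_mat (m j) (n j)" if "j \<in> {1..J}" for j
    using W(1)[OF that] by simp
  then obtain Y where Y: "\<And>j. j \<in> {1..J} \<Longrightarrow> blocks m n ent Y j = (c j / sqrt (L j)) \<cdot>\<^sub>m W j"
    using blocks_surj[OF ent, of "\<lambda>j. (c j / sqrt (L j)) \<cdot>\<^sub>m W j"] by blast
  have "wp_norm Y \<le> lp_norm \<alpha> {# c j. j \<in># mset_set {1..J} #}"
    unfolding wp_norm_def mixed_norm_def
  proof (intro lp_norm_mono one_le_exponents finite_atLeastAtMost)
    fix j assume j: "j \<in> {1..J}"
    have "sqrt (L j) * schatten_norm (p j) (blocks m n ent Y j) = c j * schatten_norm (p j) (W j)"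
      using L[OF j] c(1)[OF j] one_le_exponents(3)[OF j] by (simp add: Y[OF j] schatten_norm_smult)
    also have "\<dots> \<le> c j * 1" using c(1)[OF j] W(2)[OF j] by (intro mult_left_mono)
    finally show "\<bar>sqrt (L j) * schatten_norm (p j) (blocks m n ent Y j)\<bar> \<le> \<bar>c j\<bar>"
      using c(1)[OF j] L[OF j] by (simp add: abs_mult schatten_norm_nonneg)
  qed
  moreover have "inner X Y = (\<Sum>j\<in>{1..J}. c j * ?x j)"
    unfolding inner_eq_sum_frob
  proof (rule sum.cong[OF refl])
    fix j assume j: "j \<in> {1..J}"
    have "frob (?X j) (a \<cdot>\<^sub>m W j) = a * frob (?X j) (W j)" for a
      using W(1)[OF j] by (simp add: frob_def sum_distrib_left mult_ac blocks_def)
    then show "frob (?X j) (blocks m n ent Y j) = c j * ?x j"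
      by (simp add: Y[OF j] W(3)[OF j])
  qed
  ultimately show ?thesis using c(3,4) unfolding vq_norm_def mixed_norm_def by (intro exI[of _ Y]) simp
qed

lemma wp_norm_scaleR: "wp_norm (a *\<^sub>R X) = \<bar>a\<bar> * wp_norm X"
proof -
  have "wp_norm (a *\<^sub>R X) =
      lp_norm \<alpha> {# \<bar>a\<bar> * (sqrt (L j) * schatten_norm (p j) (blocks m n ent X j)). j \<in># mset_set {1..J} #}"
    unfolding wp_norm_def mixed_norm_def
    using one_le_exponents(3) by (intro lp_norm_cong) (simp add: blocks_scaleR schatten_norm_smult)
  then show ?thesis by (simp add: lp_norm_scale one_le_exponents wp_norm_def mixed_norm_def)
qed

sublocale dual_norm_pair wp_norm vq_norm
  using wp_norm_scaleR inner_le_mixed mixed_dual_attained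
  by unfold_locales (auto simp: wp_norm_def vq_norm_def mixed_norm_def lp_norm_nonneg)

lemma vq_norm_le_lp_row_image_norm:
  assumes "\<And>j. j \<in> {1..J} \<Longrightarrow> orthonormal_family (m j) (m j) (u j)"
  shows "vq_norm X \<le> lp_norm \<beta> {# 1 / sqrt (L j) *
    lp_norm (q j) {# row_image_norm (blocks m n ent X j) (u j i). i \<in># mset_set {..<m j} #}.
    j \<in># mset_set {1..J} #}"
  unfolding vq_norm_def mixed_norm_def
proof (intro lp_norm_mono one_le_exponents finite_atLeastAtMost)
  fix j assume j: "j \<in> {1..J}"
  have "schatten_norm (q j) (blocks m n ent X j) \<le>
      lp_norm (q j) {# row_image_norm (blocks m n ent X j) (u j i). i \<in># mset_set {..<m j} #}"
    by (rule schatten_norm_le_lp_row_image_norm[OF assms[OF j] blocks_carrier[of m n ent X j]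
          p[OF j] q[OF j] pq[OF j]])
  then show "\<bar>1 / sqrt (L j) * schatten_norm (q j) (blocks m n ent X j)\<bar> \<le> \<bar>1 / sqrt (L j) *
      lp_norm (q j) {# row_image_norm (blocks m n ent X j) (u j i). i \<in># mset_set {..<m j} #}\<bar>"
    using L[OF j] by (simp add: abs_mult schatten_norm_nonneg lp_norm_nonneg divide_right_mono)
qed

end

section \<open>Second moments of mixed norms\<close>

text \<open>A quadratic bound that is an equality at \<open>y = b\<close>: Jensen's inequality for \<open>t powr (2 / \<rho>)\<close> with weights \<open>b\<^sub>i powr \<rho> / S\<close>.\<close>

lemma lp_norm_sq_le_weighted:
  fixes b y :: "'i \<Rightarrow> real"
  assumes "finite I" "1 \<le> \<rho>" "\<rho> \<le> 2" and b: "\<And>i. i \<in> I \<Longrightarrow> 0 \<le> b i"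
    and y: "\<And>i. i \<in> I \<Longrightarrow> b i = 0 \<Longrightarrow> y i = 0"
  defines "S \<equiv> \<Sum>i\<in>I. b i powr \<rho>"
  shows "(lp_norm (ereal \<rho>) {# y i. i \<in># mset_set I #})\<^sup>2 \<le>
    (\<Sum>i\<in>I. S powr (2 / \<rho>) * (b i powr \<rho> / S / (b i)\<^sup>2) * (y i)\<^sup>2)"
proof (cases "S = 0")
  case True
  then have "y i = 0" if "i \<in> I" for i
    using that y[OF that] \<open>finite I\<close> by (simp add: S_def sum_nonneg_eq_0_iff)
  then have "(\<Sum>i\<in>I. \<bar>y i\<bar> powr \<rho>) = 0" by (intro sum.neutral) simp
  then show ?thesis using True by (simp add: lp_norm_real)
next
  case False
  then have S: "0 < S" by (simp add: S_def sum_nonneg order_less_le)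
  define w where "w i = b i powr \<rho> / S" for i
  define t where "t i = (\<bar>y i\<bar> / b i) powr \<rho>" for i
  have wt: "w i * t i = \<bar>y i\<bar> powr \<rho> / S" if "i \<in> I" for i
  proof (cases "b i = 0")
    case False
    then show ?thesis using b[OF that] by (simp add: w_def t_def powr_divide)
  qed (use y[OF that] in \<open>simp add: w_def\<close>)
  have t2: "w i * t i powr (2 / \<rho>) = b i powr \<rho> / S / (b i)\<^sup>2 * (y i)\<^sup>2" if "i \<in> I" for i
    using b[OF that] assms(2) by (cases "y i = 0") (auto simp: w_def t_def powr_powr power_divide)
  have "(\<Sum>i\<in>I. \<bar>y i\<bar> powr \<rho>) / S = (\<Sum>i\<in>I. w i * t i)"
    by (simp add: wt sum_divide_distrib)
  moreover have "(\<Sum>i\<in>I. w i * t i) powr (2 / \<rho>) \<le> (\<Sum>i\<in>I. w i * t i powr (2 / \<rho>))"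
  proof (rule powr_sum_le_sum_powr)
    show "(\<Sum>i\<in>I. w i) = 1" using S by (simp add: w_def sum_divide_distrib[symmetric] S_def[symmetric])
  qed (use assms S in \<open>auto simp: w_def t_def\<close>)
  ultimately have "((\<Sum>i\<in>I. \<bar>y i\<bar> powr \<rho>) / S) powr (2 / \<rho>) \<le> (\<Sum>i\<in>I. b i powr \<rho> / S / (b i)\<^sup>2 * (y i)\<^sup>2)"
    by (simp add: t2)
  then have "S powr (2 / \<rho>) * ((\<Sum>i\<in>I. \<bar>y i\<bar> powr \<rho>) / S) powr (2 / \<rho>) \<le>
      S powr (2 / \<rho>) * (\<Sum>i\<in>I. b i powr \<rho> / S / (b i)\<^sup>2 * (y i)\<^sup>2)"
    by (rule mult_left_mono) simp
  moreover have "S powr (2 / \<rho>) * ((\<Sum>i\<in>I. \<bar>y i\<bar> powr \<rho>) / S) powr (2 / \<rho>) =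
      (\<Sum>i\<in>I. \<bar>y i\<bar> powr \<rho>) powr (2 / \<rho>)"
    using S by (simp add: powr_divide sum_nonneg)
  moreover have "(\<Sum>i\<in>I. \<bar>y i\<bar> powr \<rho>) powr (2 / \<rho>) = (lp_norm (ereal \<rho>) {# y i. i \<in># mset_set I #})\<^sup>2"
    unfolding lp_norm_real power2_eq_square by (simp flip: powr_add)
  ultimately show ?thesis by (simp add: sum_distrib_left mult.assoc)
qed

context prob_space
begin

lemma expectation_le_of_square:
  fixes X :: "'a \<Rightarrow> real"
  assumes "X \<in> borel_measurable M" "integrable M (\<lambda>\<omega>. (X \<omega>)\<^sup>2)"
    and "expectation (\<lambda>\<omega>. (X \<omega>)\<^sup>2) \<le> b\<^sup>2" "0 \<le> b"
  shows "integrable M X" "expectation X \<le> b"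
proof -
  show X: "integrable M X"
    by (rule square_integrable_imp_integrable[OF assms(1,2)])
  have "0 \<le> variance X" by (rule variance_positive)
  then have "(expectation X)\<^sup>2 \<le> b\<^sup>2"
    using variance_eq[OF X assms(2)] assms(3) by simp
  then show "expectation X \<le> b" using assms(4) by (rule power2_le_imp_le)
qed

text \<open>The squared norm lies below a quadratic form whose coefficients depend only on b.
  Expectation commutes with that form, and at y = b it is an equality; integrability comes from the
  same domination.\<close>

lemma lp_norm_second_moment:
  fixes x :: "'i \<Rightarrow> 'a \<Rightarrow> real"
  assumes "finite I" "r \<in> {1..2}" "\<And>i. i \<in> I \<Longrightarrow> x i \<in> borel_measurable M"
    and int: "\<And>i. i \<in> I \<Longrightarrow> integrable M (\<lambda>\<omega>. (x i \<omega>)\<^sup>2)"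
    and le: "\<And>i. i \<in> I \<Longrightarrow> expectation (\<lambda>\<omega>. (x i \<omega>)\<^sup>2) \<le> (b i)\<^sup>2"
    and b: "\<And>i. i \<in> I \<Longrightarrow> 0 \<le> b i"
  shows "(\<lambda>\<omega>. lp_norm r {# x i \<omega>. i \<in># mset_set I #}) \<in> borel_measurable M"
    and "integrable M (\<lambda>\<omega>. (lp_norm r {# x i \<omega>. i \<in># mset_set I #})\<^sup>2)"
    and "expectation (\<lambda>\<omega>. (lp_norm r {# x i \<omega>. i \<in># mset_set I #})\<^sup>2) \<le> (lp_norm r {# b i. i \<in># mset_set I #})\<^sup>2"
proof -
  obtain \<rho> where r: "r = ereal \<rho>" "1 \<le> \<rho>" "\<rho> \<le> 2"
    using assms(2) by (cases r) (auto simp: one_ereal_def)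
  define S where "S = (\<Sum>i\<in>I. b i powr \<rho>)"
  \<comment> \<open>The partial derivatives of
    \<open>z \<mapsto> \<parallel>\<surd>z\<parallel>\<^sub>r\<^sup>2\<close> at
    \<open>z = b\<^sup>2\<close>, and 0 where \<open>b i = 0\<close> by the convention for
    division.\<close>
  define a where "a i = S powr (2 / \<rho>) * (b i powr \<rho> / S / (b i)\<^sup>2)" for i
  let ?Z = "\<lambda>\<omega>. lp_norm r {# x i \<omega>. i \<in># mset_set I #}"
  show meas: "?Z \<in> borel_measurable M"
    unfolding r lp_norm_real using assms(3) by measurable
  \<comment> \<open>A coordinate with \<open>b i = 0\<close> has zero second moment, hence vanishes
    almost everywhere, as the quadratic bound asks.\<close>
  have "AE \<omega> in M. b i = 0 \<longrightarrow> x i \<omega> = 0" if i: "i \<in> I" for i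
  proof (cases "b i = 0")
    case True
    then have "expectation (\<lambda>\<omega>. (x i \<omega>)\<^sup>2) = 0"
      using le[OF i] by (simp add: antisym)
    then have "AE \<omega> in M. (x i \<omega>)\<^sup>2 = 0"
      using integral_nonneg_eq_0_iff_AE[OF int[OF i]] by simp
    then show ?thesis by eventually_elim simp
  qed simp
  then have "AE \<omega> in M. \<forall>i\<in>I. b i = 0 \<longrightarrow> x i \<omega> = 0"
    using assms(1) by (simp add: AE_ball_countable uncountable_infinite countable_finite)
  then have bound: "AE \<omega> in M. (?Z \<omega>)\<^sup>2 \<le> (\<Sum>i\<in>I. a i * (x i \<omega>)\<^sup>2)"
  proof eventually_elim
    case (elim \<omega>)
    then show ?case using lp_norm_sq_le_weighted[of I \<rho> b "\<lambda>i. x i \<omega>"] assms(1) b r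
      by (simp add: a_def S_def)
  qed
  have dom: "integrable M (\<lambda>\<omega>. \<Sum>i\<in>I. a i * (x i \<omega>)\<^sup>2)"
    using int by (intro Bochner_Integration.integrable_sum integrable_mult_right)
  show Z: "integrable M (\<lambda>\<omega>. (?Z \<omega>)\<^sup>2)"
    using dom
  proof (rule Bochner_Integration.integrable_bound)
    show "AE \<omega> in M. norm ((?Z \<omega>)\<^sup>2) \<le> norm (\<Sum>i\<in>I. a i * (x i \<omega>)\<^sup>2)"
      using bound by eventually_elim auto
  qed (use meas in simp)
  have a_nonneg: "0 \<le> a i" for i by (simp add: a_def S_def sum_nonneg)
  have "expectation (\<lambda>\<omega>. (?Z \<omega>)\<^sup>2) \<le> expectation (\<lambda>\<omega>. \<Sum>i\<in>I. a i * (x i \<omega>)\<^sup>2)"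
    by (rule integral_mono_AE[OF Z dom bound])
  also have "\<dots> = (\<Sum>i\<in>I. a i * expectation (\<lambda>\<omega>. (x i \<omega>)\<^sup>2))"
    using int by simp
  also have "\<dots> \<le> (\<Sum>i\<in>I. a i * (b i)\<^sup>2)"
    by (intro sum_mono mult_left_mono le a_nonneg)
  also have "\<dots> = (\<Sum>i\<in>I. S powr (2 / \<rho>) * (b i powr \<rho> / S))"
  proof (intro sum.cong refl)
    fix i assume "i \<in> I"
    show "a i * (b i)\<^sup>2 = S powr (2 / \<rho>) * (b i powr \<rho> / S)"
      by (cases "b i = 0") (auto simp: a_def)
  qed
  also have "\<dots> = S powr (2 / \<rho>)"
    unfolding sum_distrib_left[symmetric] sum_divide_distrib[symmetric] S_def[symmetric]
    by (cases "S = 0") auto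
  also have "\<dots> = (lp_norm r {# b i. i \<in># mset_set I #})\<^sup>2"
    unfolding r lp_norm_real power2_eq_square using b by (simp add: S_def flip: powr_add)
  finally show "expectation (\<lambda>\<omega>. (?Z \<omega>)\<^sup>2) \<le> (lp_norm r {# b i. i \<in># mset_set I #})\<^sup>2" .
qed

end

text \<open>One fixed linear functional per column: the form in which second moments of the noise
  are computed.\<close>

lemma row_image_norm_blocks_sq:
  "(row_image_norm (blocks m n ent X j) x)\<^sup>2 =
    (\<Sum>c<n j. (inner X (\<Sum>r<m j. x r *\<^sub>R axis (ent (j, r, c)) 1))\<^sup>2)"
  unfolding row_image_norm_sq
  by (simp add: dot_def coldot_def blocks_def power2_eq_square inner_sum_right inner_axis)

text \<open>Second moments pass through norms twice: inside block j, in the left singular basis of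
  \<open>V j\<close> with targets \<tau> s_i, then across blocks with exponent \<beta>. Keeping
  squares until the end lets the two stages compose.\<close>

lemma (in mixed_norm_setting) expectation_vq_norm_le:
  fixes D :: "'w \<Rightarrow> real ^ 'e"
  assumes "prob_space M" and D: "D \<in> borel_measurable M"
    and V: "\<And>j. j \<in> {1..J} \<Longrightarrow> V j \<in> carrier_mat (m j) (m j)" and "0 \<le> \<tau>"
    and int: "\<And>j x. j \<in> {1..J} \<Longrightarrow> integrable M (\<lambda>\<omega>. (row_image_norm (blocks m n ent (D \<omega>) j) x)\<^sup>2)"
    and le: "\<And>j x. j \<in> {1..J} \<Longrightarrow>
      integral\<^sup>L M (\<lambda>\<omega>. (row_image_norm (blocks m n ent (D \<omega>) j) x)\<^sup>2) \<le> \<tau>\<^sup>2 * (row_image_norm (V j) x)\<^sup>2"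
  shows "integrable M (\<lambda>\<omega>. vq_norm (D \<omega>))"
    and "integral\<^sup>L M (\<lambda>\<omega>. vq_norm (D \<omega>)) \<le> \<tau> * mixed_norm J (\<lambda>j. 1 / sqrt (L j)) q \<beta> V"
proof -
  interpret M: prob_space M by fact
  have "\<forall>j. \<exists>u s. left_singular_system (V j) u s"
    using left_singular_system_exists by metis
  then obtain u s where us: "\<And>j. left_singular_system (V j) (u j) (s j)" by metis
  have u: "orthonormal_family (m j) (m j) (u j)" and s: "\<And>i. i < m j \<Longrightarrow> 0 \<le> s j i"
    and ri: "\<And>i. i < m j \<Longrightarrow> row_image_norm (V j) (u j i) = s j i"
    if "j \<in> {1..J}" for j
    using us[of j] V[OF that] row_image_norm_left_singular_system[OF us, of _ j]
    by (auto simp: left_singular_system_def)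
  define x where "x j i \<omega> = row_image_norm (blocks m n ent (D \<omega>) j) (u j i)" for j i \<omega>
  define y where "y j \<omega> = 1 / sqrt (L j) * lp_norm (q j) {# x j i \<omega>. i \<in># mset_set {..<m j} #}" for j \<omega>
  define Z where "Z \<omega> = lp_norm \<beta> {# y j \<omega>. j \<in># mset_set {1..J} #}" for \<omega>
  have meas: "(\<lambda>\<omega>. row_image_norm (blocks m n ent (D \<omega>) j) v) \<in> borel_measurable M" for j v
  proof -
    have [measurable]: "(\<lambda>\<omega>. D \<omega> $ i) \<in> borel_measurable M" for i
      using D unfolding cart_eq_inner_axis by measurable
    show ?thesis unfolding row_image_norm_def dot_def coldot_def blocks_def by simp
  qed
  have inner_moment: "y j \<in> borel_measurable M" "integrable M (\<lambda>\<omega>. (y j \<omega>)\<^sup>2)"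
    "integral\<^sup>L M (\<lambda>\<omega>. (y j \<omega>)\<^sup>2) \<le> (\<tau> * (1 / sqrt (L j) * schatten_norm (q j) (V j)))\<^sup>2"
    if j: "j \<in> {1..J}" for j
  proof -
    have xs: "integral\<^sup>L M (\<lambda>\<omega>. (x j i \<omega>)\<^sup>2) \<le> (\<tau> * s j i)\<^sup>2" if "i \<in> {..<m j}" for i
      using le[OF j, of "u j i"] ri[OF j, of i] that by (simp add: x_def power_mult_distrib)
    have prem: "x j i \<in> borel_measurable M" "integrable M (\<lambda>\<omega>. (x j i \<omega>)\<^sup>2)" for i
      using meas int[OF j] by (auto simp: x_def[abs_def])
    have ts: "0 \<le> \<tau> * s j i" if "i \<in> {..<m j}" for i using s[OF j] \<open>0 \<le> \<tau>\<close> that by simp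
    note mom = M.lp_norm_second_moment[of "{..<m j}" "q j" "x j" "\<lambda>i. \<tau> * s j i",
        OF finite_lessThan q[OF j] prem xs ts]
    have "lp_norm (q j) {# \<tau> * s j i. i \<in># mset_set {..<m j} #} = \<tau> * schatten_norm (q j) (V j)"
      using schatten_norm_left_singular_system[OF us V[OF j]] one_le_exponents(4)[OF j] \<open>0 \<le> \<tau>\<close>
      by (simp add: lp_norm_scale)
    then have "integral\<^sup>L M (\<lambda>\<omega>. (lp_norm (q j) {# x j i \<omega>. i \<in># mset_set {..<m j} #})\<^sup>2) \<le>
        (\<tau> * schatten_norm (q j) (V j))\<^sup>2"
      using mom(3) by simp
    then have "(1 / sqrt (L j))\<^sup>2 * integral\<^sup>L M (\<lambda>\<omega>. (lp_norm (q j) {# x j i \<omega>. i \<in># mset_set {..<m j} #})\<^sup>2) \<le>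
        (1 / sqrt (L j))\<^sup>2 * (\<tau> * schatten_norm (q j) (V j))\<^sup>2"
      by (rule mult_left_mono) simp
    then show "integral\<^sup>L M (\<lambda>\<omega>. (y j \<omega>)\<^sup>2) \<le> (\<tau> * (1 / sqrt (L j) * schatten_norm (q j) (V j)))\<^sup>2"
      unfolding y_def power_mult_distrib integral_mult_right_zero by (simp add: mult_ac)
    show "integrable M (\<lambda>\<omega>. (y j \<omega>)\<^sup>2)" unfolding y_def power_mult_distrib
      using mom(2) by (intro integrable_mult_right) simp
    show "y j \<in> borel_measurable M" unfolding y_def
      using mom(1) by simp
  qed
  have hat_nonneg: "0 \<le> \<tau> * (1 / sqrt (L j) * schatten_norm (q j) (V j))" if "j \<in> {1..J}" for j
    using L[OF that] \<open>0 \<le> \<tau>\<close> by (simp add: schatten_norm_nonneg)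
  note mom = M.lp_norm_second_moment[of "{1..J}" \<beta> y, OF finite_atLeastAtMost \<beta> inner_moment hat_nonneg]
  have hat: "lp_norm \<beta> {# \<tau> * (1 / sqrt (L j) * schatten_norm (q j) (V j)). j \<in># mset_set {1..J} #} =
      \<tau> * mixed_norm J (\<lambda>j. 1 / sqrt (L j)) q \<beta> V"
    unfolding mixed_norm_def using one_le_exponents(2) \<open>0 \<le> \<tau>\<close>
    by (subst lp_norm_scale) simp_all
  have Z_moment: "Z \<in> borel_measurable M" "integrable M (\<lambda>\<omega>. (Z \<omega>)\<^sup>2)"
    "integral\<^sup>L M (\<lambda>\<omega>. (Z \<omega>)\<^sup>2) \<le> (\<tau> * mixed_norm J (\<lambda>j. 1 / sqrt (L j)) q \<beta> V)\<^sup>2"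
    using mom unfolding hat Z_def by simp_all
  have "0 \<le> \<tau> * mixed_norm J (\<lambda>j. 1 / sqrt (L j)) q \<beta> V"
    using \<open>0 \<le> \<tau>\<close> by (simp add: mixed_norm_def lp_norm_nonneg)
  note Z = M.expectation_le_of_square[OF Z_moment this]
  have vq_le: "vq_norm (D \<omega>) \<le> Z \<omega>" for \<omega>
    unfolding Z_def y_def x_def by (rule vq_norm_le_lp_row_image_norm[OF u])
  show vq: "integrable M (\<lambda>\<omega>. vq_norm (D \<omega>))"
  proof (rule Bochner_Integration.integrable_bound[OF Z(1)])
    show "(\<lambda>\<omega>. vq_norm (D \<omega>)) \<in> borel_measurable M" using D by simp
    have "norm (vq_norm (D \<omega>)) \<le> norm (Z \<omega>)" for \<omega>
      using vq_le[of \<omega>] dnrm_nonneg[of "D \<omega>"] by simp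
    then show "AE \<omega> in M. norm (vq_norm (D \<omega>)) \<le> norm (Z \<omega>)" by simp
  qed
  have "integral\<^sup>L M (\<lambda>\<omega>. vq_norm (D \<omega>)) \<le> integral\<^sup>L M Z"
    by (rule integral_mono[OF vq Z(1) vq_le])
  then show "integral\<^sup>L M (\<lambda>\<omega>. vq_norm (D \<omega>)) \<le> \<tau> * mixed_norm J (\<lambda>j. 1 / sqrt (L j)) q \<beta> V"
    using Z(2) by simp
qed

section \<open>Accumulated gradient noise\<close>

text \<open>The sum of the squared weights that the momentum after step k puts on iterations 0 to k;
  at k = 0 the only weight is 1.\<close>

primrec momentum_variance :: "real \<Rightarrow> nat \<Rightarrow> real" where
  "momentum_variance \<theta> 0 = 1"
| "momentum_variance \<theta> (Suc k) = (1 - \<theta>)\<^sup>2 * momentum_variance \<theta> k + \<theta>\<^sup>2"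

lemma momentum_variance_nonneg: "0 \<le> momentum_variance \<theta> k"
  by (induction k) auto

lemma sum_sqrt_momentum_variance_le:
  assumes "0 < \<theta>" "\<theta> \<le> 1"
  shows "(\<Sum>k<K. sqrt (momentum_variance \<theta> k)) \<le> 1 / \<theta> + real K * sqrt \<theta>"
proof -
  \<comment> \<open>The decaying part is the memory of iteration 0, and \<theta> bounds the rest
    because (1 - \<theta>)^2 \<theta> + \<theta>^2 \<le> \<theta>. Under the square root they
    separate into a geometric sum and K copies of sqrt \<theta>.\<close>
  have variance: "momentum_variance \<theta> k \<le> ((1 - \<theta>) ^ k)\<^sup>2 + \<theta>" for k
  proof (induction k)
    case (Suc k)
    have "(1 - \<theta>)\<^sup>2 * momentum_variance \<theta> k \<le> (1 - \<theta>)\<^sup>2 * (((1 - \<theta>) ^ k)\<^sup>2 + \<theta>)"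
      using Suc by (intro mult_left_mono) auto
    moreover have "(1 - \<theta>)\<^sup>2 * \<theta> + \<theta>\<^sup>2 \<le> \<theta>"
    proof -
      have "\<theta> * \<theta>\<^sup>2 \<le> \<theta> * \<theta>"
        using assms mult_left_le[of \<theta> \<theta>] by (intro mult_left_mono) (auto simp: power2_eq_square)
      then show ?thesis by (simp add: power2_eq_square algebra_simps)
    qed
    ultimately show ?case by (simp add: power2_eq_square algebra_simps)
  qed (use assms in simp)
  have "sqrt (momentum_variance \<theta> k) \<le> (1 - \<theta>) ^ k + sqrt \<theta>" for k
  proof (rule real_le_lsqrt)
    have "0 \<le> 2 * (1 - \<theta>) ^ k * sqrt \<theta>" using assms by simp
    then show "momentum_variance \<theta> k \<le> ((1 - \<theta>) ^ k + sqrt \<theta>)\<^sup>2"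
      using variance[of k] assms real_sqrt_pow2[of \<theta>] unfolding power2_sum by linarith
  qed (use assms in simp)
  then have "(\<Sum>k<K. sqrt (momentum_variance \<theta> k)) \<le> (\<Sum>k<K. (1 - \<theta>) ^ k + sqrt \<theta>)"
    by (intro sum_mono)
  also have "\<dots> = (1 - (1 - \<theta>) ^ K) / \<theta> + real K * sqrt \<theta>"
    using assms by (simp add: sum.distrib sum_gp_strict)
  also have "\<dots> \<le> 1 / \<theta> + real K * sqrt \<theta>"
    using assms by (intro add_right_mono divide_right_mono) auto
  finally show ?thesis .
qed

section \<open>The past and a fresh sample\<close>

locale stochastic_gradient_run = M: prob_space M + N: prob_space N
  for M :: "'w measure" and N :: "'s measure" +
  fixes \<Xi> :: "'x measure" and \<xi> :: "'s \<Rightarrow> 'x" and G :: "'a::euclidean_space \<Rightarrow> 'x \<Rightarrow> 'a"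
    and g :: "'a \<Rightarrow> 'a" and samp :: "nat \<Rightarrow> nat \<Rightarrow> 'w \<Rightarrow> 'x" and B :: nat
    and X0 :: 'a and X :: "nat \<Rightarrow> 'w \<Rightarrow> 'a" and c :: real
  assumes \<xi> [measurable]: "\<xi> \<in> measurable N \<Xi>"
    and G [measurable]: "(\<lambda>(y, s). G y s) \<in> borel_measurable (borel \<Otimes>\<^sub>M \<Xi>)"
    and g [measurable]: "g \<in> borel_measurable borel"
    and unbiased: "has_bochner_integral N (\<lambda>s. G y (\<xi> s)) (g y)"
    and noise_integrable: "integrable N (\<lambda>s. (norm (G y (\<xi> s) - g y))\<^sup>2)"
    and noise_le: "integral\<^sup>L N (\<lambda>s. (norm (G y (\<xi> s) - g y))\<^sup>2) \<le> c"
    and iid: "iid_samples M \<Xi> (distr N \<Xi> \<xi>) B samp"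
    and B: "1 \<le> B"
    and X_0: "\<omega> \<in> space M \<Longrightarrow> X 0 \<omega> = X0"
    and X_Suc: "X (Suc k) \<in> borel_measurable (sample_history M \<Xi> B samp k)"
begin

text \<open>Indexed by sets of sample labels rather than by iterations: the samples of a batch are
  added one at a time, and each must be fresh relative to those before it.\<close>

definition past :: "(nat \<times> nat) set \<Rightarrow> 'w measure" where
  "past I = sigma (space M) (\<Union>(s, i)\<in>I. {samp s i -` A \<inter> space M | A. A \<in> sets \<Xi>})"

lemma samp_measurable [measurable]: "i \<in> {1..B} \<Longrightarrow> samp k i \<in> measurable M \<Xi>"
  using iid by (auto simp: iid_samples_def M.indep_vars_def)

lemma distr_samp: "i \<in> {1..B} \<Longrightarrow> distr M \<Xi> (samp k i) = distr N \<Xi> \<xi>"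
  using iid by (simp add: iid_samples_def)

lemma space_past [simp]: "space (past I) = space M"
  unfolding past_def by (rule space_measure_of) auto

lemma sets_past: "sets (past I) =
    sigma_sets (space M) (\<Union>(s, i)\<in>I. {samp s i -` A \<inter> space M | A. A \<in> sets \<Xi>})"
  unfolding past_def by (rule sets_measure_of) auto

lemma subalgebra_past:
  assumes "I \<subseteq> UNIV \<times> {1..B}"
  shows "subalgebra M (past I)"
proof -
  have "samp s i -` A \<inter> space M \<in> sets M" if "(s, i) \<in> I" "A \<in> sets \<Xi>" for s i A
    using assms that by (intro measurable_sets[OF samp_measurable]) auto
  then have "(\<Union>(s, i)\<in>I. {samp s i -` A \<inter> space M | A. A \<in> sets \<Xi>}) \<subseteq> sets M" by blast
  then show ?thesis unfolding subalgebra_def sets_past by (simp add: sets.sigma_sets_subset)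
qed

lemma subalgebra_past_mono: "I \<subseteq> I' \<Longrightarrow> subalgebra (past I') (past I)"
  unfolding subalgebra_def sets_past by (intro conjI sigma_sets_mono' UN_mono) simp_all

lemma samp_past:
  assumes "(s, i) \<in> I" "i \<in> {1..B}"
  shows "samp s i \<in> measurable (past I) \<Xi>"
proof (rule measurableI)
  fix A assume "A \<in> sets \<Xi>"
  then show "samp s i -` A \<inter> space (past I) \<in> sets (past I)"
    unfolding sets_past using assms(1) by (auto intro!: sigma_sets.Basic)
qed (use measurable_space[OF samp_measurable[OF assms(2)]] in auto)

text \<open>\<open>X (Suc l)\<close> sees the samples of iterations up to l, that is, strictly below
  its own index; the start is deterministic.\<close>

lemma X_past: "X k \<in> borel_measurable (past ({..<k} \<times> {1..B}))"
proof (cases k)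
  case 0
  have "(\<lambda>_. X0) \<in> borel_measurable (past ({..<k} \<times> {1..B}))" by simp
  also have "?this \<longleftrightarrow> ?thesis" using X_0 0 by (intro measurable_cong) simp
  finally show ?thesis .
next
  case (Suc l)
  have "(\<Union>(s, i)\<in>{..<k} \<times> {1..B}. {samp s i -` A \<inter> space M | A. A \<in> sets \<Xi>}) =
      {samp s i -` A \<inter> space M | s i A. s \<le> l \<and> i \<in> {1..B} \<and> A \<in> sets \<Xi>}"
  proof (intro equalityI subsetI)
    fix A assume "A \<in> {samp s i -` A \<inter> space M | s i A. s \<le> l \<and> i \<in> {1..B} \<and> A \<in> sets \<Xi>}"
    then obtain s i C where "s \<le> l" "i \<in> {1..B}" "C \<in> sets \<Xi>" "A = samp s i -` C \<inter> space M" by blast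
    then show "A \<in> (\<Union>(s, i)\<in>{..<k} \<times> {1..B}. {samp s i -` A \<inter> space M | A. A \<in> sets \<Xi>})"
      unfolding Suc by (intro UN_I[of "(s, i)"]) auto
  next
    fix A assume "A \<in> (\<Union>(s, i)\<in>{..<k} \<times> {1..B}. {samp s i -` A \<inter> space M | A. A \<in> sets \<Xi>})"
    then obtain s i C where "s \<le> l" "i \<in> {1..B}" "C \<in> sets \<Xi>" "A = samp s i -` C \<inter> space M"
      unfolding Suc by (force simp: less_Suc_eq_le)
    then show "A \<in> {samp s i -` A \<inter> space M | s i A. s \<le> l \<and> i \<in> {1..B} \<and> A \<in> sets \<Xi>}" by blast
  qed
  then have "past ({..<k} \<times> {1..B}) = sample_history M \<Xi> B samp l"
    by (simp add: past_def sample_history_def)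
  then show ?thesis using X_Suc[of l] Suc by simp
qed

text \<open>Independence of single samples is regrouped into two groups labelled by
  \<open>bool\<close>, the samples in I and the fresh one. The preimage families are closed under
  intersection, as passing to generated \<sigma>-algebras demands.\<close>

lemma indep_set_past:
  assumes I: "I \<subseteq> UNIV \<times> {1..B}" "(k, i) \<notin> I" "i \<in> {1..B}"
  shows "M.indep_set (sets (past I)) (sigma_sets (space M) {samp k i -` A \<inter> space M | A. A \<in> sets \<Xi>})"
proof -
  define E where "E = (\<lambda>(s, i). {samp s i -` A \<inter> space M | A. A \<in> sets \<Xi>})"
  define S where "S b = (if b then I else {(k, i)})" for b
  have "M.indep_sets E (UNIV \<times> {1..B})"
    using iid unfolding iid_samples_def M.indep_vars_def2 E_def by (simp add: case_prod_unfold)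
  then have "M.indep_sets E (\<Union>b\<in>UNIV. S b)"
    using I by (rule_tac M.indep_sets_mono_index) (auto simp: S_def)
  moreover have "Int_stable (E x)" for x
  proof (cases x)
    case (Pair s i)
    have "\<exists>A''. samp s i -` A \<inter> space M \<inter> (samp s i -` A' \<inter> space M) = samp s i -` A'' \<inter> space M \<and> A'' \<in> sets \<Xi>"
      if "A \<in> sets \<Xi>" "A' \<in> sets \<Xi>" for A A'
      using that by (intro exI[of _ "A \<inter> A'"]) auto
    then show ?thesis unfolding Int_stable_def E_def Pair by auto
  qed
  moreover have "disjoint_family_on S UNIV"
    using I(2) by (auto simp: disjoint_family_on_def S_def)
  ultimately have "M.indep_sets (\<lambda>b. sigma_sets (space M) (\<Union>x\<in>S b. E x)) UNIV"
    by (rule M.indep_sets_collect_sigma)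
  then show ?thesis
    unfolding M.indep_set_def sets_past
    by (rule back_subst[where P = "\<lambda>F. M.indep_sets F UNIV"])
      (auto simp: fun_eq_iff S_def E_def case_prod_unfold split: bool.split)
qed

text \<open>Takes the role of conditioning: a past quantity Z can be held fixed while the fresh
  sample is integrated out.\<close>

lemma distr_past_samp:
  assumes I: "I \<subseteq> UNIV \<times> {1..B}" "(k, i) \<notin> I" "i \<in> {1..B}" and Z: "Z \<in> measurable (past I) T"
  shows "distr M (T \<Otimes>\<^sub>M \<Xi>) (\<lambda>\<omega>. (Z \<omega>, samp k i \<omega>)) = distr M T Z \<Otimes>\<^sub>M distr N \<Xi> \<xi>"
proof -
  have ZM [measurable]: "Z \<in> measurable M T"
    by (rule measurable_from_subalg[OF subalgebra_past[OF I(1)] Z])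
  note [measurable] = samp_measurable[OF I(3)]
  interpret Z: prob_space "distr M T Z" by (rule M.prob_space_distr) simp
  interpret S: prob_space "distr M \<Xi> (samp k i)" by (rule M.prob_space_distr) simp
  have "distr M T Z \<Otimes>\<^sub>M distr M \<Xi> (samp k i) = distr M (T \<Otimes>\<^sub>M \<Xi>) (\<lambda>\<omega>. (Z \<omega>, samp k i \<omega>))"
  proof (rule pair_measure_eqI)
    fix A C assume "A \<in> sets (distr M T Z)" "C \<in> sets (distr M \<Xi> (samp k i))"
    then have [measurable]: "A \<in> sets T" "C \<in> sets \<Xi>" by auto
    have "Z -` A \<inter> space M \<in> sets (past I)" using measurable_sets[OF Z, of A] by simp
    moreover have "samp k i -` C \<inter> space M \<in>
        sigma_sets (space M) {samp k i -` A \<inter> space M | A. A \<in> sets \<Xi>}"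
      using \<open>C \<in> sets \<Xi>\<close> by (intro sigma_sets.Basic) blast
    ultimately have "M.prob ((Z -` A \<inter> space M) \<inter> (samp k i -` C \<inter> space M)) =
        M.prob (Z -` A \<inter> space M) * M.prob (samp k i -` C \<inter> space M)"
      by (rule M.indep_setD[OF indep_set_past[OF I]])
    moreover have "(\<lambda>\<omega>. (Z \<omega>, samp k i \<omega>)) -` (A \<times> C) \<inter> space M =
        (Z -` A \<inter> space M) \<inter> (samp k i -` C \<inter> space M)" by auto
    ultimately show "emeasure (distr M T Z) A * emeasure (distr M \<Xi> (samp k i)) C =
        emeasure (distr M (T \<Otimes>\<^sub>M \<Xi>) (\<lambda>\<omega>. (Z \<omega>, samp k i \<omega>))) (A \<times> C)"
      by (simp add: emeasure_distr M.emeasure_eq_measure ennreal_mult)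
  qed (simp_all add: Z.sigma_finite_measure_axioms S.sigma_finite_measure_axioms cong: sets_pair_measure_cong)
  then show ?thesis by (simp add: distr_samp[OF I(3)])
qed

text \<open>The bound holds for every frozen value y, so integrating over the fresh sample first
  gives it for random Y. Nonnegativity permits this before integrability is known.\<close>

lemma fresh_sample_expectation_le:
  fixes \<psi> :: "'a \<Rightarrow> 'x \<Rightarrow> real"
  assumes I: "I \<subseteq> UNIV \<times> {1..B}" "(k, i) \<notin> I" "i \<in> {1..B}" and Y: "Y \<in> borel_measurable (past I)"
    and \<psi> [measurable]: "(\<lambda>(y, s). \<psi> y s) \<in> borel_measurable (borel \<Otimes>\<^sub>M \<Xi>)"
    and nonneg: "\<And>y s. 0 \<le> \<psi> y s"
    and int: "\<And>y. integrable N (\<lambda>s. \<psi> y (\<xi> s))" and le: "\<And>y. integral\<^sup>L N (\<lambda>s. \<psi> y (\<xi> s)) \<le> v"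
  shows "integrable M (\<lambda>\<omega>. \<psi> (Y \<omega>) (samp k i \<omega>))"
    and "integral\<^sup>L M (\<lambda>\<omega>. \<psi> (Y \<omega>) (samp k i \<omega>)) \<le> v"
proof -
  have [measurable]: "Y \<in> borel_measurable M"
    by (rule measurable_from_subalg[OF subalgebra_past[OF I(1)] Y])
  note [measurable] = samp_measurable[OF I(3)]
  interpret law: prob_space "distr N \<Xi> \<xi>" by (rule N.prob_space_distr) simp
  interpret Y: prob_space "distr M borel Y" by (rule M.prob_space_distr) simp
  have "0 \<le> integral\<^sup>L N (\<lambda>s. \<psi> 0 (\<xi> s))" by (intro Bochner_Integration.integral_nonneg nonneg)
  then have v: "0 \<le> v" using le[of 0] by simp
  have "(\<integral>\<^sup>+ \<omega>. \<psi> (Y \<omega>) (samp k i \<omega>) \<partial>M) =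
      (\<integral>\<^sup>+ z. (case z of (y, s) \<Rightarrow> ennreal (\<psi> y s)) \<partial>distr M (borel \<Otimes>\<^sub>M \<Xi>) (\<lambda>\<omega>. (Y \<omega>, samp k i \<omega>)))"
    by (subst nn_integral_distr) auto
  also have "\<dots> = (\<integral>\<^sup>+ y. \<integral>\<^sup>+ s. \<psi> y s \<partial>distr N \<Xi> \<xi> \<partial>distr M borel Y)"
    unfolding distr_past_samp[OF I Y] by (subst law.nn_integral_fst[symmetric]) auto
  also have "\<dots> \<le> (\<integral>\<^sup>+ y. ennreal v \<partial>distr M borel Y)"
  proof (rule nn_integral_mono)
    fix y
    have "(\<integral>\<^sup>+ s. \<psi> y s \<partial>distr N \<Xi> \<xi>) = (\<integral>\<^sup>+ s. \<psi> y (\<xi> s) \<partial>N)"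
      by (subst nn_integral_distr) auto
    also have "\<dots> = ennreal (integral\<^sup>L N (\<lambda>s. \<psi> y (\<xi> s)))"
      by (rule nn_integral_eq_integral[OF int]) (simp add: nonneg)
    also have "\<dots> \<le> ennreal v" by (intro ennreal_leI le)
    finally show "(\<integral>\<^sup>+ s. \<psi> y s \<partial>distr N \<Xi> \<xi>) \<le> ennreal v" .
  qed
  also have "\<dots> = ennreal v" using Y.emeasure_space_1 by simp
  finally have nn: "(\<integral>\<^sup>+ \<omega>. \<psi> (Y \<omega>) (samp k i \<omega>) \<partial>M) \<le> ennreal v" .
  show *: "integrable M (\<lambda>\<omega>. \<psi> (Y \<omega>) (samp k i \<omega>))"
    by (rule integrableI_bounded) (use le_less_trans[OF nn ennreal_less_top] in \<open>simp_all add: nonneg\<close>)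
  show "integral\<^sup>L M (\<lambda>\<omega>. \<psi> (Y \<omega>) (samp k i \<omega>)) \<le> v"
    using nn unfolding nn_integral_eq_integral[OF * AE_I2[OF nonneg]] using v by simp
qed

text \<open>R carries the noise accumulated so far and Y the current iterate; as a pair they form
  one past variable. The integrand is signed, so Fubini asks for the integrability premise.\<close>

lemma fresh_sample_expectation_eq_0:
  fixes \<phi> :: "'a \<Rightarrow> 'x \<Rightarrow> real" and R :: "'w \<Rightarrow> real"
  assumes I: "I \<subseteq> UNIV \<times> {1..B}" "(k, i) \<notin> I" "i \<in> {1..B}"
    and Y: "Y \<in> borel_measurable (past I)" and R: "R \<in> borel_measurable (past I)"
    and \<phi> [measurable]: "(\<lambda>(y, s). \<phi> y s) \<in> borel_measurable (borel \<Otimes>\<^sub>M \<Xi>)"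
    and zero: "\<And>y. integral\<^sup>L N (\<lambda>s. \<phi> y (\<xi> s)) = 0"
    and int: "integrable M (\<lambda>\<omega>. R \<omega> * \<phi> (Y \<omega>) (samp k i \<omega>))"
  shows "integral\<^sup>L M (\<lambda>\<omega>. R \<omega> * \<phi> (Y \<omega>) (samp k i \<omega>)) = 0"
proof -
  have Z: "(\<lambda>\<omega>. (R \<omega>, Y \<omega>)) \<in> measurable (past I) (borel \<Otimes>\<^sub>M borel)"
    using R Y by (rule measurable_Pair)
  have [measurable]: "Y \<in> borel_measurable M" "R \<in> borel_measurable M"
    using measurable_from_subalg[OF subalgebra_past[OF I(1)]] Y R by auto
  note [measurable] = samp_measurable[OF I(3)]
  interpret law: prob_space "distr N \<Xi> \<xi>" by (rule N.prob_space_distr) simp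
  interpret Z: prob_space "distr M (borel \<Otimes>\<^sub>M borel) (\<lambda>\<omega>. (R \<omega>, Y \<omega>))"
    by (rule M.prob_space_distr) simp
  interpret P: pair_prob_space "distr M (borel \<Otimes>\<^sub>M borel) (\<lambda>\<omega>. (R \<omega>, Y \<omega>))" "distr N \<Xi> \<xi>" ..
  define h where "h z = fst (fst z) * \<phi> (snd (fst z)) (snd z)" for z
  have [measurable]: "h \<in> borel_measurable ((borel \<Otimes>\<^sub>M borel) \<Otimes>\<^sub>M \<Xi>)"
    unfolding h_def by simp
  let ?J = "distr M ((borel \<Otimes>\<^sub>M borel) \<Otimes>\<^sub>M \<Xi>) (\<lambda>\<omega>. ((R \<omega>, Y \<omega>), samp k i \<omega>))"
  have "integrable ?J h"
    by (subst integrable_distr_eq) (use int in \<open>auto simp: h_def\<close>)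
  then have h: "integrable (distr M (borel \<Otimes>\<^sub>M borel) (\<lambda>\<omega>. (R \<omega>, Y \<omega>)) \<Otimes>\<^sub>M distr N \<Xi> \<xi>) h"
    unfolding distr_past_samp[OF I Z] .
  have "integral\<^sup>L M (\<lambda>\<omega>. R \<omega> * \<phi> (Y \<omega>) (samp k i \<omega>)) = integral\<^sup>L ?J h"
    by (subst integral_distr) (auto simp: h_def)
  also have "\<dots> = (\<integral>z. \<integral>s. h (z, s) \<partial>distr N \<Xi> \<xi> \<partial>distr M (borel \<Otimes>\<^sub>M borel) (\<lambda>\<omega>. (R \<omega>, Y \<omega>)))"
    unfolding distr_past_samp[OF I Z] by (rule P.integral_fst'[OF h, symmetric])
  also have "(\<lambda>z. \<integral>s. h (z, s) \<partial>distr N \<Xi> \<xi>) = (\<lambda>z. 0)"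
  proof
    fix z :: "real \<times> 'a"
    have "(\<integral>s. h (z, s) \<partial>distr N \<Xi> \<xi>) = (\<integral>s. fst z * \<phi> (snd z) (\<xi> s) \<partial>N)"
      by (subst integral_distr) (auto simp: h_def case_prod_unfold)
    then show "(\<integral>s. h (z, s) \<partial>distr N \<Xi> \<xi>) = 0" by (simp add: zero)
  qed
  finally show ?thesis by simp
qed

section \<open>Orthogonality and second moments of the momentum noise\<close>

definition sample_noise :: "nat \<Rightarrow> nat \<Rightarrow> 'w \<Rightarrow> 'a" where
  "sample_noise k i \<omega> = G (X k \<omega>) (samp k i \<omega>) - g (X k \<omega>)"

definition accumulated_noise :: "real \<Rightarrow> nat \<Rightarrow> 'w \<Rightarrow> 'a" where
  "accumulated_noise \<theta> k \<omega> =
     momentum \<theta> (\<lambda>l. minibatch_gradient B G (X l \<omega>) (\<lambda>i. samp l i \<omega>) - g (X l \<omega>)) k"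

lemma minibatch_noise:
  "minibatch_gradient B G (X l \<omega>) (\<lambda>i. samp l i \<omega>) - g (X l \<omega>) =
    (1 / real B) *\<^sub>R (\<Sum>i = 1..B. sample_noise l i \<omega>)"
  using B by (simp add: minibatch_gradient_def sample_noise_def sum_subtractf scaleR_diff_right scaleR_sum_left
      sum_constant_scaleR)

lemma inner_noise_bound: "(inner (G y (\<xi> s) - g y) e)\<^sup>2 \<le> (norm e)\<^sup>2 * (norm (G y (\<xi> s) - g y))\<^sup>2"
  using Cauchy_Schwarz_ineq[of "G y (\<xi> s) - g y" e] by (simp add: power2_norm_eq_inner mult.commute)

lemma inner_noise_integrable: "integrable N (\<lambda>s. (inner (G y (\<xi> s) - g y) e)\<^sup>2)"
proof (rule Bochner_Integration.integrable_bound)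
  show "integrable N (\<lambda>s. (norm e)\<^sup>2 * (norm (G y (\<xi> s) - g y))\<^sup>2)"
    by (intro integrable_mult_right noise_integrable)
  show "AE s in N. norm ((inner (G y (\<xi> s) - g y) e)\<^sup>2) \<le> norm ((norm e)\<^sup>2 * (norm (G y (\<xi> s) - g y))\<^sup>2)"
    using inner_noise_bound by simp
qed simp

lemma inner_noise_le: "integral\<^sup>L N (\<lambda>s. (inner (G y (\<xi> s) - g y) e)\<^sup>2) \<le> (norm e)\<^sup>2 * c"
proof -
  have "integral\<^sup>L N (\<lambda>s. (inner (G y (\<xi> s) - g y) e)\<^sup>2) \<le>
      integral\<^sup>L N (\<lambda>s. (norm e)\<^sup>2 * (norm (G y (\<xi> s) - g y))\<^sup>2)"
    by (intro integral_mono inner_noise_integrable integrable_mult_right noise_integrable inner_noise_bound)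
  also have "\<dots> \<le> (norm e)\<^sup>2 * c" by (simp add: mult_left_mono noise_le)
  finally show ?thesis .
qed

context
  fixes k i :: nat
  assumes i: "i \<in> {1..B}"
begin

private lemma fresh: "{..<k} \<times> {1..B} \<subseteq> UNIV \<times> {1..B}" "(k, i) \<notin> {..<k} \<times> {1..B}"
  by auto

lemma inner_sample_noise_sq_integrable: "integrable M (\<lambda>\<omega>. (inner (sample_noise k i \<omega>) e)\<^sup>2)"
  unfolding sample_noise_def
  by (rule fresh_sample_expectation_le(1)[OF fresh i X_past,
        where \<psi> = "\<lambda>y s. (inner (G y s - g y) e)\<^sup>2", OF _ _ inner_noise_integrable inner_noise_le]) auto

text \<open>The sum over the directions is bounded as a whole, since the covariance hypothesis
  controls all columns of a block together.\<close>

lemma inner_sample_noise_sq_le: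
  assumes v: "\<And>y. (\<Sum>l\<in>C. integral\<^sup>L N (\<lambda>s. (inner (G y (\<xi> s) - g y) (e l))\<^sup>2)) \<le> v"
  shows "(\<Sum>l\<in>C. integral\<^sup>L M (\<lambda>\<omega>. (inner (sample_noise k i \<omega>) (e l))\<^sup>2)) \<le> v"
proof -
  have "integral\<^sup>L M (\<lambda>\<omega>. \<Sum>l\<in>C. (inner (sample_noise k i \<omega>) (e l))\<^sup>2) \<le> v"
    unfolding sample_noise_def
    by (rule fresh_sample_expectation_le(2)[OF fresh i X_past,
          where \<psi> = "\<lambda>y s. \<Sum>l\<in>C. (inner (G y s - g y) (e l))\<^sup>2"])
      (use inner_noise_integrable v in \<open>auto intro!: sum_nonneg\<close>)
  then show ?thesis using inner_sample_noise_sq_integrable by simp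
qed

end

lemma sample_noise_past:
  assumes "{..<k} \<times> {1..B} \<subseteq> I" "(k, i) \<in> I" "i \<in> {1..B}"
  shows "sample_noise k i \<in> borel_measurable (past I)"
proof -
  have [measurable]: "X k \<in> borel_measurable (past I)"
    by (rule measurable_from_subalg[OF subalgebra_past_mono[OF assms(1)] X_past])
  have [measurable]: "samp k i \<in> measurable (past I) \<Xi>" by (rule samp_past[OF assms(2,3)])
  show ?thesis unfolding sample_noise_def[abs_def] by measurable
qed

text \<open>Pythagoras, one sample at a time. Noises of one batch share the iterate
  \<open>X k\<close> and may be dependent, but each averages to zero once everything before it is
  frozen, which removes the cross terms.\<close>

lemma second_moment_add_sample_noise:
  fixes a :: real and e :: 'a
  assumes Q: "Q \<in> borel_measurable (past ({..<k} \<times> {1..B}))" "integrable M (\<lambda>\<omega>. (Q \<omega>)\<^sup>2)"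
    and "i \<le> B"
  defines "W \<equiv> \<lambda>\<omega>. Q \<omega> + a * (\<Sum>l = 1..i. inner (sample_noise k l \<omega>) e)"
  shows "W \<in> borel_measurable (past ({..<k} \<times> {1..B} \<union> {k} \<times> {1..i})) \<and> integrable M (\<lambda>\<omega>. (W \<omega>)\<^sup>2) \<and>
    integral\<^sup>L M (\<lambda>\<omega>. (W \<omega>)\<^sup>2) = integral\<^sup>L M (\<lambda>\<omega>. (Q \<omega>)\<^sup>2) +
      a\<^sup>2 * (\<Sum>l = 1..i. integral\<^sup>L M (\<lambda>\<omega>. (inner (sample_noise k l \<omega>) e)\<^sup>2))"
  using \<open>i \<le> B\<close> unfolding W_def
proof (induction i)
  case 0
  then show ?case using Q by simp
next
  case (Suc i)
  define I where "I j = {..<k} \<times> {1..B} \<union> {k} \<times> {1..j}" for j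
  define W where "W \<omega> = Q \<omega> + a * (\<Sum>l = 1..i. inner (sample_noise k l \<omega>) e)" for \<omega>
  define h where "h \<omega> = inner (sample_noise k (Suc i) \<omega>) e" for \<omega>
  have IH: "W \<in> borel_measurable (past (I i))" "integrable M (\<lambda>\<omega>. (W \<omega>)\<^sup>2)"
    "integral\<^sup>L M (\<lambda>\<omega>. (W \<omega>)\<^sup>2) = integral\<^sup>L M (\<lambda>\<omega>. (Q \<omega>)\<^sup>2) +
      a\<^sup>2 * (\<Sum>l = 1..i. integral\<^sup>L M (\<lambda>\<omega>. (inner (sample_noise k l \<omega>) e)\<^sup>2))"
    using Suc unfolding W_def I_def by auto
  have Si: "Suc i \<in> {1..B}" using Suc.prems by simp
  have Isub: "I i \<subseteq> UNIV \<times> {1..B}" "I (Suc i) \<subseteq> UNIV \<times> {1..B}" "I i \<subseteq> I (Suc i)" "(k, Suc i) \<notin> I i"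
    using Suc.prems by (auto simp: I_def)
  have h_past: "h \<in> borel_measurable (past (I (Suc i)))"
    unfolding h_def[abs_def] using sample_noise_past[of k "I (Suc i)" "Suc i"] Si
    by (auto simp: I_def intro!: borel_measurable_inner)
  have W_past: "W \<in> borel_measurable (past (I (Suc i)))"
    by (rule measurable_from_subalg[OF subalgebra_past_mono[OF Isub(3)] IH(1)])
  have [measurable]: "h \<in> borel_measurable M" "W \<in> borel_measurable M"
    using measurable_from_subalg[OF subalgebra_past[OF Isub(2)]] h_past W_past by auto
  have h2: "integrable M (\<lambda>\<omega>. (h \<omega>)\<^sup>2)"
    unfolding h_def by (rule inner_sample_noise_sq_integrable[OF Si])
  have Wh: "integrable M (\<lambda>\<omega>. W \<omega> * h \<omega>)"
  proof (rule Bochner_Integration.integrable_bound)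
    show "integrable M (\<lambda>\<omega>. (W \<omega>)\<^sup>2 + (h \<omega>)\<^sup>2)" using IH(2) h2 by simp
    have "\<bar>w * z\<bar> \<le> \<bar>w\<^sup>2 + z\<^sup>2\<bar>" for w z :: real
    proof -
      have "2 * (\<bar>w\<bar> * \<bar>z\<bar>) \<le> w\<^sup>2 + z\<^sup>2"
        using sum_squares_bound[of "\<bar>w\<bar>" "\<bar>z\<bar>"] by (simp add: mult.assoc)
      moreover have "0 \<le> \<bar>w\<bar> * \<bar>z\<bar>" by simp
      ultimately show ?thesis unfolding abs_mult using abs_ge_self[of "w\<^sup>2 + z\<^sup>2"] by linarith
    qed
    then show "AE \<omega> in M. norm (W \<omega> * h \<omega>) \<le> norm ((W \<omega>)\<^sup>2 + (h \<omega>)\<^sup>2)" by simp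
  qed simp
  have cross: "integral\<^sup>L M (\<lambda>\<omega>. W \<omega> * h \<omega>) = 0"
    unfolding h_def sample_noise_def
  proof (rule fresh_sample_expectation_eq_0[OF Isub(1,4) Si, where \<phi> = "\<lambda>y s. inner (G y s - g y) e"])
    show "X k \<in> borel_measurable (past (I i))"
      by (rule measurable_from_subalg[OF subalgebra_past_mono X_past]) (auto simp: I_def)
    show "integral\<^sup>L N (\<lambda>s. inner (G y (\<xi> s) - g y) e) = 0" for y
    proof -
      have G: "integrable N (\<lambda>s. G y (\<xi> s))" "integral\<^sup>L N (\<lambda>s. G y (\<xi> s)) = g y"
        using unbiased[of y] by (auto simp: has_bochner_integral_iff)
      then have "integral\<^sup>L N (\<lambda>s. inner (G y (\<xi> s)) e) = inner (g y) e"
        by simp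
      then show ?thesis using G(1) by (simp add: inner_diff_left N.prob_space)
    qed
  qed (use IH(1) Wh in \<open>auto simp: h_def sample_noise_def\<close>)
  have eq: "Q \<omega> + a * (\<Sum>l = 1..Suc i. inner (sample_noise k l \<omega>) e) = W \<omega> + a * h \<omega>" for \<omega>
    by (simp add: W_def h_def algebra_simps)
  have sq: "(W \<omega> + a * h \<omega>)\<^sup>2 = (W \<omega>)\<^sup>2 + 2 * a * (W \<omega> * h \<omega>) + a\<^sup>2 * (h \<omega>)\<^sup>2" for \<omega>
    by (simp add: power2_eq_square algebra_simps)
  have "(\<lambda>\<omega>. W \<omega> + a * h \<omega>) \<in> borel_measurable (past (I (Suc i)))"
    using W_past h_past by simp
  moreover have "integrable M (\<lambda>\<omega>. (W \<omega> + a * h \<omega>)\<^sup>2)"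
    unfolding sq using IH(2) Wh h2 by simp
  moreover have "integral\<^sup>L M (\<lambda>\<omega>. (W \<omega> + a * h \<omega>)\<^sup>2) =
      integral\<^sup>L M (\<lambda>\<omega>. (W \<omega>)\<^sup>2) + a\<^sup>2 * integral\<^sup>L M (\<lambda>\<omega>. (h \<omega>)\<^sup>2)"
    unfolding sq using IH(2) Wh h2 cross by simp
  ultimately show ?case unfolding eq I_def[symmetric] IH(3)
    by (simp add: h_def algebra_simps)
qed

text \<open>The leading 0 stands for Q = 0, so that the same Pythagoras step covers the
  start.\<close>

lemma accumulated_noise_0:
  "inner (accumulated_noise \<theta> 0 \<omega>) e = 0 + 1 / real B * (\<Sum>l = 1..B. inner (sample_noise 0 l \<omega>) e)"
  unfolding accumulated_noise_def momentum.simps minibatch_noise by (simp add: inner_sum_left)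

lemma accumulated_noise_Suc:
  "inner (accumulated_noise \<theta> (Suc k) \<omega>) e = (1 - \<theta>) * inner (accumulated_noise \<theta> k \<omega>) e +
    \<theta> / real B * (\<Sum>l = 1..B. inner (sample_noise (Suc k) l \<omega>) e)"
  unfolding accumulated_noise_def momentum.simps minibatch_noise by (simp add: inner_sum_left inner_add_left)

lemma lessThan_Suc_times: "{..<k} \<times> S \<union> {k} \<times> S = {..<Suc k} \<times> S"
  by auto

lemma accumulated_noise_moment:
  "(\<lambda>\<omega>. inner (accumulated_noise \<theta> k \<omega>) e) \<in> borel_measurable (past ({..<Suc k} \<times> {1..B})) \<and>
   integrable M (\<lambda>\<omega>. (inner (accumulated_noise \<theta> k \<omega>) e)\<^sup>2)"
proof (induction k)
  case 0
  show ?case unfolding accumulated_noise_0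
    using second_moment_add_sample_noise[of "\<lambda>_. 0" 0 B "1 / real B" e]
    unfolding lessThan_Suc_times by simp
next
  case (Suc k)
  have "(\<lambda>\<omega>. (1 - \<theta>) * inner (accumulated_noise \<theta> k \<omega>) e) \<in> borel_measurable (past ({..<Suc k} \<times> {1..B}))"
    "integrable M (\<lambda>\<omega>. ((1 - \<theta>) * inner (accumulated_noise \<theta> k \<omega>) e)\<^sup>2)"
    using Suc by (auto simp: power_mult_distrib)
  from second_moment_add_sample_noise[OF this order_refl, of "\<theta> / real B" e]
  show ?case unfolding accumulated_noise_Suc lessThan_Suc_times by blast
qed

lemma accumulated_noise_measurable: "accumulated_noise \<theta> k \<in> borel_measurable M"
proof (subst borel_measurable_euclidean_space, intro ballI)
  fix e :: 'a
  have "subalgebra M (past ({..<Suc k} \<times> {1..B}))" by (rule subalgebra_past) auto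
  then show "(\<lambda>\<omega>. inner (accumulated_noise \<theta> k \<omega>) e) \<in> borel_measurable M"
    using accumulated_noise_moment by (blast intro: measurable_from_subalg)
qed

text \<open>By orthogonality the second moments obey the recursion of
  \<open>momentum_variance\<close>, with \<open>v / real B\<close> as the unit of one batch.\<close>

lemma accumulated_noise_second_moment_le:
  assumes v: "\<And>y. (\<Sum>j\<in>C. integral\<^sup>L N (\<lambda>s. (inner (G y (\<xi> s) - g y) (e j))\<^sup>2)) \<le> v"
  shows "(\<Sum>j\<in>C. integral\<^sup>L M (\<lambda>\<omega>. (inner (accumulated_noise \<theta> k \<omega>) (e j))\<^sup>2)) \<le>
    momentum_variance \<theta> k * (v / real B)"
proof -
  \<comment> \<open>B orthogonal samples of weight a / B contribute at most (a / B)^2 v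
    each.\<close>
  have batch: "(\<Sum>j\<in>C. (a / real B)\<^sup>2 * (\<Sum>l = 1..B. integral\<^sup>L M (\<lambda>\<omega>. (inner (sample_noise k l \<omega>) (e j))\<^sup>2))) \<le>
      a\<^sup>2 * (v / real B)" for a k
  proof -
    have "(\<Sum>j\<in>C. (a / real B)\<^sup>2 * (\<Sum>l = 1..B. integral\<^sup>L M (\<lambda>\<omega>. (inner (sample_noise k l \<omega>) (e j))\<^sup>2))) =
        (a / real B)\<^sup>2 * (\<Sum>l = 1..B. \<Sum>j\<in>C. integral\<^sup>L M (\<lambda>\<omega>. (inner (sample_noise k l \<omega>) (e j))\<^sup>2))"
      by (subst sum.swap) (simp add: sum_distrib_left)
    also have "\<dots> \<le> (a / real B)\<^sup>2 * (\<Sum>l = 1..B. v)"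
      by (intro mult_left_mono sum_mono inner_sample_noise_sq_le[OF _ v]) auto
    also have "\<dots> = a\<^sup>2 * (v / real B)" using B by (simp add: power2_eq_square)
    finally show ?thesis .
  qed
  show ?thesis
  proof (induction k)
    case 0
    have "(\<Sum>j\<in>C. integral\<^sup>L M (\<lambda>\<omega>. (inner (accumulated_noise \<theta> 0 \<omega>) (e j))\<^sup>2)) =
        (\<Sum>j\<in>C. (1 / real B)\<^sup>2 * (\<Sum>l = 1..B. integral\<^sup>L M (\<lambda>\<omega>. (inner (sample_noise 0 l \<omega>) (e j))\<^sup>2)))"
      using second_moment_add_sample_noise[of "\<lambda>_. 0" 0 B "1 / real B"]
      unfolding accumulated_noise_0 by simp
    then show ?case using batch[of 1 0] by simp
  next
    case (Suc k)
    have "(\<Sum>j\<in>C. integral\<^sup>L M (\<lambda>\<omega>. (inner (accumulated_noise \<theta> (Suc k) \<omega>) (e j))\<^sup>2)) =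
        (\<Sum>j\<in>C. (1 - \<theta>)\<^sup>2 * integral\<^sup>L M (\<lambda>\<omega>. (inner (accumulated_noise \<theta> k \<omega>) (e j))\<^sup>2) +
          (\<theta> / real B)\<^sup>2 * (\<Sum>l = 1..B. integral\<^sup>L M (\<lambda>\<omega>. (inner (sample_noise (Suc k) l \<omega>) (e j))\<^sup>2)))"
    proof (rule sum.cong[OF refl])
      fix j
      let ?Q = "\<lambda>\<omega>. (1 - \<theta>) * inner (accumulated_noise \<theta> k \<omega>) (e j)"
      have "?Q \<in> borel_measurable (past ({..<Suc k} \<times> {1..B}))" "integrable M (\<lambda>\<omega>. (?Q \<omega>)\<^sup>2)"
        using accumulated_noise_moment[of \<theta> k "e j"] by (auto simp: power_mult_distrib)
      from second_moment_add_sample_noise[OF this order_refl, of "\<theta> / real B" "e j"]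
      show "integral\<^sup>L M (\<lambda>\<omega>. (inner (accumulated_noise \<theta> (Suc k) \<omega>) (e j))\<^sup>2) =
          (1 - \<theta>)\<^sup>2 * integral\<^sup>L M (\<lambda>\<omega>. (inner (accumulated_noise \<theta> k \<omega>) (e j))\<^sup>2) +
          (\<theta> / real B)\<^sup>2 * (\<Sum>l = 1..B. integral\<^sup>L M (\<lambda>\<omega>. (inner (sample_noise (Suc k) l \<omega>) (e j))\<^sup>2))"
        unfolding accumulated_noise_Suc power_mult_distrib by simp
    qed
    also have "\<dots> \<le> (1 - \<theta>)\<^sup>2 * (momentum_variance \<theta> k * (v / real B)) + \<theta>\<^sup>2 * (v / real B)"
      unfolding sum.distrib sum_distrib_left[symmetric, of "(1 - \<theta>)\<^sup>2"]
      using Suc batch[of \<theta> "Suc k"] by (intro add_mono mult_left_mono) auto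
    finally show ?case by (simp add: algebra_simps)
  qed
qed

end

section \<open>Convergence rate\<close>

lemma row_image_norm_sq_eq_gram:
  "(row_image_norm A x)\<^sup>2 =
    (\<Sum>r<dim_row A. \<Sum>t<dim_row A. x r * x t * (A * transpose_mat A) $$ (r, t))"
  unfolding row_image_norm_sq dot_coldot
  unfolding dot_def by (simp add: sum_distrib_left mult_ac del: index_mult_mat)

text \<open>The Loewner inequality tested at the vector x; the expectation is moved inside the
  quadratic form entry by entry.\<close>

lemma covariance_row_image_norm:
  fixes D :: "'s \<Rightarrow> real Matrix.mat"
  assumes D: "\<And>s. D s \<in> carrier_mat m n" and V: "V \<in> carrier_mat m m"
    and int: "integrable_mat N m m (\<lambda>s. D s * transpose_mat (D s))"
    and le: "loewner_le (expectation_mat N m m (\<lambda>s. D s * transpose_mat (D s))) (V * transpose_mat V)"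
  shows "integrable N (\<lambda>s. (row_image_norm (D s) x)\<^sup>2)"
    and "integral\<^sup>L N (\<lambda>s. (row_image_norm (D s) x)\<^sup>2) \<le> (row_image_norm V x)\<^sup>2"
proof -
  let ?C = "\<lambda>s. D s * transpose_mat (D s)"
  define E where "E = expectation_mat N m m ?C"
  have dims: "dim_row (D s) = m" "dim_row V = m" for s using D[of s] V by auto
  have C: "integrable N (\<lambda>s. ?C s $$ (r, t))" if "r < m" "t < m" for r t
    using int that by (simp add: integrable_mat_def)
  show "integrable N (\<lambda>s. (row_image_norm (D s) x)\<^sup>2)"
    unfolding row_image_norm_sq_eq_gram dims
    using C by (intro Bochner_Integration.integrable_sum integrable_mult_right) auto
  have "integral\<^sup>L N (\<lambda>s. (row_image_norm (D s) x)\<^sup>2) =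
      (\<Sum>r<m. integral\<^sup>L N (\<lambda>s. \<Sum>t<m. x r * x t * ?C s $$ (r, t)))"
    unfolding row_image_norm_sq_eq_gram dims
    using C by (intro Bochner_Integration.integral_sum Bochner_Integration.integrable_sum integrable_mult_right) auto
  also have "\<dots> = (\<Sum>r<m. \<Sum>t<m. integral\<^sup>L N (\<lambda>s. x r * x t * ?C s $$ (r, t)))"
    using C by (intro sum.cong refl Bochner_Integration.integral_sum integrable_mult_right) auto
  also have "\<dots> = (\<Sum>r<m. \<Sum>t<m. x r * x t * integral\<^sup>L N (\<lambda>s. ?C s $$ (r, t)))"
    unfolding integral_mult_right_zero ..
  also have "\<dots> = (\<Sum>r<m. \<Sum>t<m. x r * x t * E $$ (r, t))"
    by (intro sum.cong refl) (simp add: E_def expectation_mat_def)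
  finally have lhs: "integral\<^sup>L N (\<lambda>s. (row_image_norm (D s) x)\<^sup>2) = (\<Sum>r<m. \<Sum>t<m. x r * x t * E $$ (r, t))" .
  define P where "P = V * transpose_mat V - E"
  have P: "P \<in> carrier_mat m m" 
    unfolding P_def E_def expectation_mat_def by (rule minus_carrier_mat) simp
  have "psd_mat P" using le by (simp add: loewner_le_def P_def E_def)
  moreover have "Matrix.vec m x \<in> carrier_vec (dim_row P)" using P by simp
  ultimately have "0 \<le> scalar_prod (Matrix.vec m x) (P *\<^sub>v Matrix.vec m x)"
    unfolding psd_mat_def by blast
  also have "\<dots> = (\<Sum>r<m. \<Sum>t<m. x r * x t * P $$ (r, t))"
    using P by (simp add: scalar_prod_def mult_mat_vec_def atLeast0LessThan sum_distrib_left mult_ac)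
  also have "\<dots> = (\<Sum>r<m. \<Sum>t<m. x r * x t * (V * transpose_mat V) $$ (r, t)) -
      (\<Sum>r<m. \<Sum>t<m. x r * x t * E $$ (r, t))"
    unfolding sum_subtractf[symmetric]
  proof (intro sum.cong refl)
    fix r t assume "r \<in> {..<m}" "t \<in> {..<m}"
    then have "P $$ (r, t) = (V * transpose_mat V) $$ (r, t) - E $$ (r, t)"
      unfolding P_def by (intro index_minus_mat) (auto simp: E_def expectation_mat_def)
    then show "x r * x t * P $$ (r, t) = x r * x t * (V * transpose_mat V) $$ (r, t) - x r * x t * E $$ (r, t)"
      by (simp add: right_diff_distrib del: index_mult_mat)
  qed
  finally show "integral\<^sup>L N (\<lambda>s. (row_image_norm (D s) x)\<^sup>2) \<le> (row_image_norm V x)\<^sup>2"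
    unfolding lhs unfolding row_image_norm_sq_eq_gram dims by simp
qed

text \<open>With \<delta> = sqrt (\<Delta>/K) and t = sqrt \<theta> the radius is \<delta> t, and
  dividing by \<eta> K leaves multiples of \<delta>/t, \<sigma>/(\<theta> K) and \<sigma> t. The
  choice of \<theta> balances \<delta>/t against \<sigma> t.\<close>

lemma convergence_rate_arithmetic:
  fixes \<Delta> \<sigma> \<theta> \<eta> A :: real
  assumes "0 < \<Delta>" "1 \<le> K" "0 \<le> \<sigma>"
    and \<theta>: "\<theta> = (if \<sigma> = 0 then 1 else min (1 / \<sigma> * sqrt (\<Delta> / real K)) 1)"
    and \<eta>: "\<eta> = sqrt (\<Delta> * \<theta> / real K)"
    and A: "\<eta> * A \<le> \<Delta> + 2 * \<eta> * (\<sigma> * (1 / \<theta> + real K * sqrt \<theta>)) +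
      real K * (2 * \<eta> * (\<eta> * (1 - \<theta>) / \<theta>) + \<eta>\<^sup>2 / 2)"
  shows "1 / real K * A \<le> 6 * sqrt \<sigma> * (\<Delta> / real K) powr (1 / 4) + 8 * sqrt (\<Delta> / real K)
    + 2 * \<sigma>\<^sup>2 / sqrt (\<Delta> * real K)"
proof -
  define \<delta> where "\<delta> = sqrt (\<Delta> / real K)"
  define t where "t = sqrt \<theta>"
  have K: "0 < real K" using assms by simp
  have \<delta>: "0 < \<delta>" using assms by (simp add: \<delta>_def)
  have th: "0 < \<theta>" "\<theta> \<le> 1" using assms by (auto simp: \<theta>)
  have t: "0 < t" "t \<le> 1" "\<theta> = t * t" using th by (auto simp: t_def)
  have \<Delta>: "\<Delta> = real K * (\<delta> * \<delta>)" using assms K by (simp add: \<delta>_def)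
  have \<eta>': "\<eta> = \<delta> * t"
    by (simp add: \<eta> \<delta>_def t_def real_sqrt_mult[symmetric])
  have \<eta>_pos: "0 < \<eta>" using \<delta> t by (simp add: \<eta>')
  have "A / real K \<le> \<delta> / t + 2 * \<sigma> / (\<theta> * real K) + 2 * \<sigma> * t + 2 * (\<delta> * (1 - \<theta>) / t) + \<delta> * t / 2"
  proof -
    let ?R = "\<delta> / t + 2 * \<sigma> / (\<theta> * real K) + 2 * \<sigma> * t + 2 * (\<delta> * (1 - \<theta>) / t) + \<delta> * t / 2"
    have "\<Delta> + 2 * \<eta> * (\<sigma> * (1 / \<theta> + real K * sqrt \<theta>)) + real K * (2 * \<eta> * (\<eta> * (1 - \<theta>) / \<theta>) + \<eta>\<^sup>2 / 2) =
        \<eta> * (real K * ?R)"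
      unfolding \<Delta> \<eta>' t_def[symmetric] t(3) using t(1) K
      by (simp add: field_simps power2_eq_square)
    then have "\<eta> * A \<le> \<eta> * (real K * ?R)" using A by simp
    then have "A \<le> real K * ?R" using \<eta>_pos by simp
    then show ?thesis using K by (simp add: pos_divide_le_eq mult.commute)
  qed
  \<comment> \<open>As (1 - \<theta>)/t = 1/t - t, the drift leaves -2 \<delta> t, which absorbs
    \<delta> t / 2. With the first term the coefficient of \<delta>/t becomes 3.\<close>
  moreover have "2 * (\<delta> * (1 - \<theta>) / t) + \<delta> * t / 2 \<le> 2 * (\<delta> / t)"
  proof -
    have "2 * (\<delta> * (1 - \<theta>) / t) = 2 * (\<delta> / t) - 2 * (\<delta> * t)"
      using t by (simp add: field_simps)
    then show ?thesis using \<delta> t mult_pos_pos[OF \<delta> t(1)] by simp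
  qed
  ultimately have bound: "A / real K \<le> 3 * (\<delta> / t) + 2 * \<sigma> / (\<theta> * real K) + 2 * \<sigma> * t"
    by linarith
  have \<delta>K: "sqrt (\<Delta> * real K) = \<delta> * real K"
    using K \<delta> by (simp add: \<Delta> real_sqrt_mult)
  have "(\<Delta> / real K) powr (1 / 4) = sqrt \<delta>"
    using assms K by (simp add: \<delta>_def powr_half_sqrt[symmetric] powr_powr)
  then have w: "6 * sqrt \<sigma> * (\<Delta> / real K) powr (1 / 4) = 6 * sqrt (\<sigma> * \<delta>)"
    by (simp add: real_sqrt_mult)
  have w_nonneg: "0 \<le> sqrt (\<sigma> * \<delta>)" "0 \<le> 2 * \<sigma>\<^sup>2 / (\<delta> * real K)" using assms \<delta> K by auto
  have "A / real K \<le> 6 * sqrt (\<sigma> * \<delta>) + 8 * \<delta> + 2 * \<sigma>\<^sup>2 / (\<delta> * real K)"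
  proof (cases "\<delta> \<le> \<sigma>")
    \<comment> \<open>Large noise: \<delta>/t and \<sigma> t both equal sqrt (\<sigma> \<delta>),
      which uses 3 + 2 of the allowed 6.\<close>
    case True
    then have \<sigma>: "0 < \<sigma>" using \<delta> by simp
    then have th_eq: "\<theta> = \<delta> / \<sigma>" using True \<delta> by (simp add: \<theta> \<delta>_def[symmetric])
    have "\<sigma> * t = sqrt (\<sigma> * \<delta>)"
      using \<sigma> \<delta> by (simp add: t_def th_eq real_sqrt_mult real_sqrt_divide field_simps)
    moreover have "\<delta> / t = sqrt (\<sigma> * \<delta>)"
      using \<sigma> \<delta> by (simp add: t_def th_eq real_sqrt_mult real_sqrt_divide field_simps)
    moreover have "2 * \<sigma> / (\<theta> * real K) = 2 * \<sigma>\<^sup>2 / (\<delta> * real K)"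
      by (simp add: th_eq power2_eq_square)
    ultimately show ?thesis using bound w_nonneg \<delta> by linarith
  next
    \<comment> \<open>Noise below \<delta>, including \<sigma> = 0: the total 3 \<delta> + 2
      \<sigma> + 2 \<sigma>/K is below 7 \<delta> because K \<ge> 1.\<close>
    case False
    then have "\<theta> = 1" using assms(3) \<delta> by (auto simp: \<theta> \<delta>_def[symmetric] field_simps)
    then have "t = 1" by (simp add: t_def)
    have "2 * \<sigma> / real K \<le> 2 * \<sigma>" using assms(2,3) K by (simp add: field_simps mult_left_mono)
    moreover have "A / real K \<le> 3 * \<delta> + 2 * \<sigma> / real K + 2 * \<sigma>"
      using bound by (simp add: \<open>\<theta> = 1\<close> \<open>t = 1\<close>)
    ultimately show ?thesis using w_nonneg \<delta> False by linarith
  qed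
  then show ?thesis unfolding w \<delta>K by (simp add: \<delta>_def[symmetric])
qed

theorem theorem3:
  fixes J :: nat and m n :: "nat \<Rightarrow> nat"
    and ent :: "nat \<times> nat \<times> nat \<Rightarrow> 'e::finite"
    and L :: "nat \<Rightarrow> real" and \<alpha> \<beta> :: ereal and p q :: "nat \<Rightarrow> ereal"
    and f :: "real ^ 'e \<Rightarrow> real" and gradf :: "real ^ 'e \<Rightarrow> real ^ 'e" and f_low :: real
    and N :: "'s measure" and \<Xi> :: "'x measure" and \<xi> :: "'s \<Rightarrow> 'x"
    and G :: "real ^ 'e \<Rightarrow> 'x \<Rightarrow> real ^ 'e" and V :: "nat \<Rightarrow> real Matrix.mat"
    and M :: "'w measure" and samp :: "nat \<Rightarrow> nat \<Rightarrow> 'w \<Rightarrow> 'x"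
    and B K :: nat and X0 :: "real ^ 'e" and X :: "nat \<Rightarrow> 'w \<Rightarrow> real ^ 'e"
    and \<Delta> \<sigma> \<theta> \<eta> :: real
  defines "wp_norm \<equiv> \<lambda>Y. mixed_norm J (\<lambda>j. sqrt (L j)) p \<alpha> (blocks m n ent Y)"
    and "vq_norm \<equiv> \<lambda>Y. mixed_norm J (\<lambda>j. 1 / sqrt (L j)) q \<beta> (blocks m n ent Y)"
    and "\<Delta> \<equiv> f X0 - f_low"
    and "\<sigma> \<equiv> 1 / sqrt (real B) * mixed_norm J (\<lambda>j. 1 / sqrt (L j)) q \<beta> V"
    and "\<theta> \<equiv> (if \<sigma> = 0 then 1 else min (1 / \<sigma> * sqrt (\<Delta> / real K)) 1)"
    and "\<eta> \<equiv> sqrt (\<Delta> * \<theta> / real K)"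
  assumes "1 \<le> J" and "\<forall>j\<in>{1..J}. 1 \<le> m j \<and> m j \<le> n j"
    and "bij_betw ent (block_entries J m n) UNIV"
    and "\<forall>j\<in>{1..J}. 0 < L j"
    and "\<forall>Y. GDERIV f Y :> gradf Y" and "continuous_on UNIV gradf"
    and "\<forall>Y. f_low \<le> f Y"
    and "\<alpha> \<in> {2..\<infinity>}" "\<beta> \<in> {1..2}" "conjugate_exponents \<alpha> \<beta>"
    and "\<forall>j\<in>{1..J}. p j \<in> {2..\<infinity>} \<and> q j \<in> {1..2} \<and> conjugate_exponents (p j) (q j)"
    and "\<forall>Y Z. vq_norm (gradf Z - gradf Y) \<le> wp_norm (Z - Y)"
    and "prob_space N" "\<xi> \<in> measurable N \<Xi>"
    and "(\<lambda>(Y, s). G Y s) \<in> borel_measurable (borel \<Otimes>\<^sub>M \<Xi>)"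
    and "\<forall>j\<in>{1..J}. V j \<in> carrier_mat (m j) (m j)"
    and "\<forall>Y. has_bochner_integral N (\<lambda>s. G Y (\<xi> s)) (gradf Y)"
    and "\<forall>Y. \<forall>j\<in>{1..J}.
           let D = (\<lambda>s. blocks m n ent (G Y (\<xi> s)) j - blocks m n ent (gradf Y) j);
               C = (\<lambda>s. D s * transpose_mat (D s))
           in integrable_mat N (m j) (m j) C \<and>
              loewner_le (expectation_mat N (m j) (m j) C) (V j * transpose_mat (V j))"
    and "1 \<le> B" and "1 \<le> K" and "0 < \<Delta>"
    and "prob_space M" "iid_samples M \<Xi> (distr N \<Xi> \<xi>) B samp"
    and "ball_oracle_method M \<Xi> samp G wp_norm X0 \<theta> \<eta> B X"
  shows "(\<forall>k<K. integrable M (\<lambda>\<omega>. vq_norm (gradf (X k \<omega>)))) \<and>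
    1 / real K * (\<Sum>k<K. integral\<^sup>L M (\<lambda>\<omega>. vq_norm (gradf (X k \<omega>))))
      \<le> 6 * sqrt \<sigma> * (\<Delta> / real K) powr (1 / 4) + 8 * sqrt (\<Delta> / real K)
         + 2 * \<sigma>\<^sup>2 / sqrt (\<Delta> * real K)"
proof -
  interpret S: mixed_norm_setting J m n ent L \<alpha> \<beta> p q
    using assms by unfold_locales auto
  interpret N: prob_space N by fact
  interpret M: prob_space M by fact
  have wp: "wp_norm = S.wp_norm" and vq: "vq_norm = S.vq_norm"
    by (auto simp: fun_eq_iff wp_norm_def S.wp_norm_def vq_norm_def S.vq_norm_def)
  interpret F: smooth_function S.wp_norm S.vq_norm f gradf
    using assms(11,18) by unfold_locales (auto simp: wp vq)
  have V: "V j \<in> carrier_mat (m j) (m j)" if "j \<in> {1..J}" for j using assms(22) that by blast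
  define D where "D y s = G y (\<xi> s) - gradf y" for y s
  have cov: "integrable N (\<lambda>s. (row_image_norm (blocks m n ent (D y s) j) x)\<^sup>2)"
    "integral\<^sup>L N (\<lambda>s. (row_image_norm (blocks m n ent (D y s) j) x)\<^sup>2) \<le> (row_image_norm (V j) x)\<^sup>2"
    if j: "j \<in> {1..J}" for j y x
  proof -
    let ?C = "\<lambda>s. blocks m n ent (D y s) j * transpose_mat (blocks m n ent (D y s) j)"
    have "integrable_mat N (m j) (m j) ?C"
      "loewner_le (expectation_mat N (m j) (m j) ?C) (V j * transpose_mat (V j))"
      using assms(24) j unfolding Let_def D_def blocks_diff by blast+
    from covariance_row_image_norm[OF blocks_carrier V[OF j] this]
    show "integrable N (\<lambda>s. (row_image_norm (blocks m n ent (D y s) j) x)\<^sup>2)"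
      "integral\<^sup>L N (\<lambda>s. (row_image_norm (blocks m n ent (D y s) j) x)\<^sup>2) \<le> (row_image_norm (V j) x)\<^sup>2" .
  qed
  define unit where "unit r = (\<lambda>s. if s = r then 1 else 0 :: real)" for r :: nat
  have norm_sq: "(norm Y)\<^sup>2 = (\<Sum>j\<in>{1..J}. \<Sum>r<m j. (row_image_norm (blocks m n ent Y j) (unit r))\<^sup>2)" for Y
  proof -
    have "coldot (blocks m n ent Y j) (unit r) c = blocks m n ent Y j $$ (r, c)" if "r < m j" for j r c
      using that dot_unit[of r "m j"] by (simp add: coldot_def unit_def blocks_def)
    then show ?thesis
      unfolding power2_norm_eq_inner S.inner_eq_sum_frob frob_def row_image_norm_sq dot_def
      by (intro sum.cong) (auto simp: blocks_def)
  qed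
  \<comment> \<open>The sum of the squared Frobenius norms of the \<open>V j\<close>: a variance
    bound uniform in the point, which makes the noise at a random iterate square integrable.\<close>
  define c where "c = (\<Sum>j\<in>{1..J}. \<Sum>r<m j. (row_image_norm (V j) (unit r))\<^sup>2)"
  have noise_int: "integrable N (\<lambda>s. (norm (D y s))\<^sup>2)" for y
    unfolding norm_sq by (intro Bochner_Integration.integrable_sum cov)
  have noise_le: "integral\<^sup>L N (\<lambda>s. (norm (D y s))\<^sup>2) \<le> c" for y
  proof -
    have "integral\<^sup>L N (\<lambda>s. (norm (D y s))\<^sup>2) =
        (\<Sum>j\<in>{1..J}. \<Sum>r<m j. integral\<^sup>L N (\<lambda>s. (row_image_norm (blocks m n ent (D y s) j) (unit r))\<^sup>2))"
      unfolding norm_sq using cov(1)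
      by (simp add: Bochner_Integration.integral_sum Bochner_Integration.integrable_sum)
    also have "\<dots> \<le> c" unfolding c_def by (intro sum_mono cov(2))
    finally show ?thesis .
  qed
  have grad_meas [measurable]: "gradf \<in> borel_measurable borel"
    using assms(12) by (rule borel_measurable_continuous_onI)
  have run: "\<And>\<omega>. \<omega> \<in> space M \<Longrightarrow> X 0 \<omega> = X0"
    "\<And>k \<omega>. \<omega> \<in> space M \<Longrightarrow> is_arg_min
      (\<lambda>Y. inner (momentum \<theta> (\<lambda>l. minibatch_gradient B G (X l \<omega>) (\<lambda>i. samp l i \<omega>)) k) (Y - X k \<omega>))
      (\<lambda>Y. S.wp_norm (Y - X k \<omega>) \<le> \<eta>) (X (Suc k) \<omega>)"
    "\<And>k. X (Suc k) \<in> borel_measurable (sample_history M \<Xi> B samp k)"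
    using assms(30) unfolding ball_oracle_method_def wp by auto
  interpret R: stochastic_gradient_run M N \<Xi> \<xi> G gradf samp B X0 X c
    using assms(20,21,23,25,29) grad_meas noise_int noise_le run unfolding D_def
    by unfold_locales auto
  have mixed_nonneg: "0 \<le> mixed_norm J (\<lambda>j. 1 / sqrt (L j)) q \<beta> V"
    by (simp add: mixed_norm_def lp_norm_nonneg)
  then have \<sigma>: "0 \<le> \<sigma>" by (simp add: \<sigma>_def)
  have "0 < \<sigma> \<Longrightarrow> 0 < 1 / \<sigma> * sqrt (\<Delta> / real K)" using assms(26,27) by simp
  then have \<theta>: "0 < \<theta>" "\<theta> \<le> 1" using \<sigma> by (auto simp: \<theta>_def)
  have \<eta>: "0 \<le> \<eta>" using \<theta> assms(27) by (simp add: \<eta>_def)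
  define noise where "noise k \<omega> = S.vq_norm (R.accumulated_noise \<theta> k \<omega>)" for k \<omega>
  have noise: "integrable M (noise k)" "integral\<^sup>L M (noise k) \<le> \<sigma> * sqrt (momentum_variance \<theta> k)" for k
  proof -
    \<comment> \<open>With this \<tau> the accumulated noise has block covariance at most \<tau>^2
      V_j V_j^T; its factor 1 / sqrt B goes into \<sigma>.\<close>
    let ?\<tau> = "sqrt (momentum_variance \<theta> k / real B)"
    let ?N = "R.accumulated_noise \<theta> k"
    have \<tau>: "0 \<le> ?\<tau>" "?\<tau>\<^sup>2 = momentum_variance \<theta> k / real B"
      by (auto simp: momentum_variance_nonneg)
    have int: "integrable M (\<lambda>\<omega>. (row_image_norm (blocks m n ent (?N \<omega>) j) x)\<^sup>2)" for j x
      unfolding row_image_norm_blocks_sq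
      using R.accumulated_noise_moment by (intro Bochner_Integration.integrable_sum) blast
    have le: "integral\<^sup>L M (\<lambda>\<omega>. (row_image_norm (blocks m n ent (?N \<omega>) j) x)\<^sup>2) \<le>
        ?\<tau>\<^sup>2 * (row_image_norm (V j) x)\<^sup>2" if j: "j \<in> {1..J}" for j x
    proof -
      \<comment> \<open>Pairing with \<open>?e c\<close> gives entry c of D_j^T x, so summing over c
        tests the block covariance at x.\<close>
      let ?e = "\<lambda>c. \<Sum>r<m j. x r *\<^sub>R axis (ent (j, r, c)) 1"
      have "(\<Sum>c<n j. integral\<^sup>L N (\<lambda>s. (inner (G y (\<xi> s) - gradf y) (?e c))\<^sup>2)) \<le> (row_image_norm (V j) x)\<^sup>2" for y
        using cov(2)[OF j, of y x] R.inner_noise_integrable unfolding row_image_norm_blocks_sq[of m n ent _ j] D_def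
        by simp
      from R.accumulated_noise_second_moment_le[where C = "{..<n j}" and e = ?e and \<theta> = \<theta> and k = k, OF this]
      show ?thesis
        unfolding row_image_norm_blocks_sq[of m n ent _ j] \<tau>(2) using R.accumulated_noise_moment by simp
    qed
    note * = S.expectation_vq_norm_le[OF \<open>prob_space M\<close> R.accumulated_noise_measurable V \<tau>(1) int le]
    show "integrable M (noise k)" unfolding noise_def[abs_def] using *(1) by simp
    have "integral\<^sup>L M (noise k) \<le> ?\<tau> * mixed_norm J (\<lambda>j. 1 / sqrt (L j)) q \<beta> V"
      unfolding noise_def[abs_def] using *(2) by simp
    then show "integral\<^sup>L M (noise k) \<le> \<sigma> * sqrt (momentum_variance \<theta> k)"
      by (simp add: \<sigma>_def real_sqrt_divide mult.commute)
  qed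
  have X_meas [measurable]: "X k \<in> borel_measurable M" for k
    by (rule measurable_from_subalg[OF R.subalgebra_past R.X_past]) auto
  \<comment> \<open>Steps of length at most \<eta> and the Lipschitz condition bound the gradient on
    all paths by a constant depending on k; integrability follows.\<close>
  have grad_bound: "S.vq_norm (gradf (X k \<omega>)) \<le> S.vq_norm (gradf X0) + real k * \<eta>" if "\<omega> \<in> space M" for k \<omega>
  proof (induction k)
    case 0
    then show ?case using run(1)[OF that] by simp
  next
    case (Suc k)
    have "S.vq_norm (gradf (X (Suc k) \<omega>)) \<le>
        S.vq_norm (gradf (X (Suc k) \<omega>) - gradf (X k \<omega>)) + S.vq_norm (gradf (X k \<omega>))"
      using S.dnrm_add_le[of "gradf (X (Suc k) \<omega>) - gradf (X k \<omega>)" "gradf (X k \<omega>)"] by simp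
    moreover have "S.vq_norm (gradf (X (Suc k) \<omega>) - gradf (X k \<omega>)) \<le> \<eta>"
      using F.lipschitz S.ball_oracle_step(1)[OF run(2)[OF that] \<eta>] by (rule order_trans)
    ultimately show ?case using Suc by (simp add: algebra_simps)
  qed
  have grad_int: "integrable M (\<lambda>\<omega>. S.vq_norm (gradf (X k \<omega>)))" for k
  proof (rule M.integrable_const_bound)
    show "AE \<omega> in M. norm (S.vq_norm (gradf (X k \<omega>))) \<le> S.vq_norm (gradf X0) + real k * \<eta>"
      using grad_bound S.dnrm_nonneg by (intro AE_I2) simp
  qed simp
  define r where "r = real K * (2 * \<eta> * (\<eta> * (1 - \<theta>) / \<theta>) + \<eta>\<^sup>2 / 2)"
  have path: "\<eta> * (\<Sum>k<K. S.vq_norm (gradf (X k \<omega>))) \<le> \<Delta> + 2 * \<eta> * (\<Sum>k<K. noise k \<omega>) + r"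
    if "\<omega> \<in> space M" for \<omega>
    using F.ball_oracle_path_bound[OF run(2)[OF that] \<theta> \<eta>, of f_low K] assms(13) run(1)[OF that]
    by (simp add: \<Delta>_def noise_def R.accumulated_noise_def r_def)
  have "\<eta> * (\<Sum>k<K. integral\<^sup>L M (\<lambda>\<omega>. S.vq_norm (gradf (X k \<omega>)))) =
      integral\<^sup>L M (\<lambda>\<omega>. \<eta> * (\<Sum>k<K. S.vq_norm (gradf (X k \<omega>))))"
    using grad_int by simp
  also have "\<dots> \<le> integral\<^sup>L M (\<lambda>\<omega>. \<Delta> + 2 * \<eta> * (\<Sum>k<K. noise k \<omega>) + r)"
    using grad_int noise(1) path by (intro integral_mono) auto
  also have "\<dots> = \<Delta> + 2 * \<eta> * (\<Sum>k<K. integral\<^sup>L M (noise k)) + r"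
    using noise(1) by (simp add: M.prob_space)
  also have "\<dots> \<le> \<Delta> + 2 * \<eta> * (\<sigma> * (1 / \<theta> + real K * sqrt \<theta>)) + r"
  proof -
    have "(\<Sum>k<K. integral\<^sup>L M (noise k)) \<le> \<sigma> * (\<Sum>k<K. sqrt (momentum_variance \<theta> k))"
      unfolding sum_distrib_left by (intro sum_mono noise(2))
    also have "\<dots> \<le> \<sigma> * (1 / \<theta> + real K * sqrt \<theta>)"
      using sum_sqrt_momentum_variance_le[OF \<theta>] \<sigma> by (intro mult_left_mono)
    finally show ?thesis using \<eta> by (intro add_mono mult_left_mono) auto
  qed
  finally have "1 / real K * (\<Sum>k<K. integral\<^sup>L M (\<lambda>\<omega>. S.vq_norm (gradf (X k \<omega>))))
      \<le> 6 * sqrt \<sigma> * (\<Delta> / real K) powr (1 / 4) + 8 * sqrt (\<Delta> / real K) + 2 * \<sigma>\<^sup>2 / sqrt (\<Delta> * real K)"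
    unfolding r_def
    by (rule convergence_rate_arithmetic[OF assms(27,26) \<sigma> \<theta>_def[THEN meta_eq_to_obj_eq] \<eta>_def[THEN meta_eq_to_obj_eq]])
  then show ?thesis using grad_int by (simp add: vq)
qed

end
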